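(* Let $\mathcal{K}$ be a finite connected simplicial complex with $n$ simplices and let $p\ge 0$ be an integer. Then an annotation for the $p$-simplices of $\mathcal{K}$ can be computed in $O(n^{\omega})$ time.
   Context: All homology is simplicial with $\mathbb{Z}_2$ coefficients. A $p$-chain is identified with the set of $p$-simplices having coefficient $1$ in it, so $\sigma\in z$ means that $\sigma$ has coefficient $1$ in $z$. Annotation: with $g=\dim\mathsf{H}_p(\mathcal{K})$, an annotation for $p$-simplices is a function $\mathrm{a}$ from the set of $p$-simplices of $\mathcal{K}$ to $(\mathbb{Z}_2)^g$ such that any two $p$-cycles $z,z'$ belong to the same homology class if and only if $\sum_{\sigma\in z}\mathrm{a}(\sigma)=\sum_{\sigma\in z'}\mathrm{a}(\sigma)$. $\omega>2$ denotes a real number such that two $n\times n$ matrices (over $\mathbb{Z}_2$) can be multiplied in $O(n^{\omega})$ time. Time is counted in unit-cost elementary operations. *)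

theory Defs
  imports
    "Jordan_Normal_Form.VS_Connect"
    "HOL-Library.Z2"
    "HOL-Library.Landau_Symbols"
begin

section \<open>Simplicial homology with coefficients in \<open>\<int>\<^sub>2\<close>\<close>

text \<open>Abstract simplicial complexes; the empty set is not a simplex, so homology is not reduced.\<close>

definition finite_simplicial_complex :: "'v set set \<Rightarrow> bool" where
  "finite_simplicial_complex K \<longleftrightarrow>
     finite K \<and> (\<forall>\<sigma>\<in>K. finite \<sigma> \<and> \<sigma> \<noteq> {} \<and> (\<forall>\<tau>. \<tau> \<subseteq> \<sigma> \<and> \<tau> \<noteq> {} \<longrightarrow> \<tau> \<in> K))"

definition connected_complex :: "'v set set \<Rightarrow> bool" where
  "connected_complex K \<longleftrightarrow> (\<forall>u\<in>\<Union>K. \<forall>v\<in>\<Union>K. (u, v) \<in> {(x, y). {x, y} \<in> K}\<^sup>*)"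

definition simplices :: "'v set set \<Rightarrow> nat \<Rightarrow> 'v set set" where
  "simplices K p = {\<sigma>\<in>K. card \<sigma> = Suc p}"

text \<open>A chain is the set of simplices having coefficient 1 in it, so that addition of chains is
  symmetric difference.\<close>

definition chains :: "'v set set \<Rightarrow> nat \<Rightarrow> 'v set set set" where
  "chains K p = Pow (simplices K p)"

definition boundary :: "'v set set \<Rightarrow> nat \<Rightarrow> 'v set set \<Rightarrow> 'v set set" where
  "boundary K p z = {\<tau>\<in>K. card \<tau> = p \<and> odd (card {\<sigma>\<in>z. \<tau> \<subseteq> \<sigma>})}"

definition cycles :: "'v set set \<Rightarrow> nat \<Rightarrow> 'v set set set" where
  "cycles K p = {z\<in>chains K p. boundary K p z = {}}"

definition boundaries :: "'v set set \<Rightarrow> nat \<Rightarrow> 'v set set set" where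
  "boundaries K p = boundary K (Suc p) ` chains K (Suc p)"

definition cycle_group :: "'v set set \<Rightarrow> nat \<Rightarrow> 'v set set monoid" where
  "cycle_group K p = \<lparr>carrier = cycles K p, mult = (\<lambda>z z'. (z - z') \<union> (z' - z)), one = {}\<rparr>"

definition homology_class :: "'v set set \<Rightarrow> nat \<Rightarrow> 'v set set \<Rightarrow> 'v set set set" where
  "homology_class K p z = boundaries K p #>\<^bsub>cycle_group K p\<^esub> z"

text \<open>The quotient of cycles by boundaries as a vector space over \<open>\<int>\<^sub>2\<close>. The fields \<open>mult\<close> and
  \<open>one\<close> only exist because modules extend the ring record; no vector space notion uses them.\<close>

definition homology :: "'v set set \<Rightarrow> nat \<Rightarrow> (bit, 'v set set set) module" where
  "homology K p =
     \<lparr>carrier = carrier (cycle_group K p Mod boundaries K p),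
      mult = (\<lambda>_ _. boundaries K p), one = boundaries K p,
      zero = \<one>\<^bsub>cycle_group K p Mod boundaries K p\<^esub>,
      add = mult (cycle_group K p Mod boundaries K p),
      smult = (\<lambda>c h. if c = 0 then boundaries K p else h)\<rparr>"

definition homology_dim :: "'v set set \<Rightarrow> nat \<Rightarrow> nat" where
  "homology_dim K p = vectorspace.dim (class_ring :: bit ring) (homology K p)"

definition is_annotation :: "'v set set \<Rightarrow> nat \<Rightarrow> ('v set \<Rightarrow> bit vec) \<Rightarrow> bool" where
  "is_annotation K p a \<longleftrightarrow>
     (\<forall>\<sigma>\<in>simplices K p. a \<sigma> \<in> carrier_vec (homology_dim K p)) \<and>
     (\<forall>z\<in>cycles K p. \<forall>z'\<in>cycles K p.
        homology_class K p z = homology_class K p z' \<longleftrightarrow>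
        finsum_vec TYPE(bit) (homology_dim K p) a z = finsum_vec TYPE(bit) (homology_dim K p) a z')"


section \<open>Unit-cost machine\<close>

text \<open>
  Programs of a word RAM: while programs over finitely many arrays of machine words with unit-cost
  elementary operations. All words are smaller than a bound \<open>W\<close>, which is a parameter of the
  semantics; an execution that produces a larger number is stuck. A program cannot refer to \<open>W\<close>.
  Algorithms are required below to work for every \<open>W\<close> above a polynomial in the input size, that is,
  for words of \<open>c log n\<close> bits. Without such a restriction unit-cost arithmetic on huge numbers would
  be unrealistically powerful.
\<close>

type_synonym memory = "nat \<Rightarrow> nat \<Rightarrow> nat"  \<comment> \<open>array, index\<close>

datatype binop = PLUS | MINUS | TIMES | DIV | MOD | LESS | EQUAL

fun apply_op :: "binop \<Rightarrow> nat \<Rightarrow> nat \<Rightarrow> nat" where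
  "apply_op PLUS x y = x + y"
| "apply_op MINUS x y = x - y"
| "apply_op TIMES x y = x * y"
| "apply_op DIV x y = x div y"
| "apply_op MOD x y = x mod y"
| "apply_op LESS x y = of_bool (x < y)"
| "apply_op EQUAL x y = of_bool (x = y)"

datatype expr = Const nat | Cell nat expr | Op binop expr expr

definition word :: "nat \<Rightarrow> nat \<Rightarrow> nat option" where
  "word W x = (if x < W then Some x else None)"

fun expr_value :: "nat \<Rightarrow> memory \<Rightarrow> expr \<Rightarrow> nat option" where
  "expr_value W s (Const k) = word W k"
| "expr_value W s (Cell a e) = Option.bind (expr_value W s e) (\<lambda>i. word W (s a i))"
| "expr_value W s (Op f e e') =
     Option.bind (expr_value W s e) (\<lambda>x.
     Option.bind (expr_value W s e') (\<lambda>y. word W (apply_op f x y)))"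

fun expr_cost :: "expr \<Rightarrow> nat" where
  "expr_cost (Const k) = 1"
| "expr_cost (Cell a e) = 1 + expr_cost e"
| "expr_cost (Op f e e') = 1 + expr_cost e + expr_cost e'"

datatype program =
    Skip
  | Assign nat expr expr  \<comment> \<open>array, index, new value\<close>
  | Seq program program
  | Cond expr program program
  | While expr program

text \<open>\<open>exec W P s t s'\<close>: started in memory \<open>s\<close>, program \<open>P\<close> halts with memory \<open>s'\<close> after \<open>t\<close>
  elementary operations.\<close>

inductive exec :: "nat \<Rightarrow> program \<Rightarrow> memory \<Rightarrow> nat \<Rightarrow> memory \<Rightarrow> bool" for W where
  Skip: "exec W Skip s 1 s"
| Assign: "expr_value W s e = Some i \<Longrightarrow> expr_value W s e' = Some x \<Longrightarrow>
    exec W (Assign a e e') s (1 + expr_cost e + expr_cost e') (s(a := (s a)(i := x)))"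
| Seq: "exec W P s t s' \<Longrightarrow> exec W Q s' t' s'' \<Longrightarrow> exec W (Seq P Q) s (t + t') s''"
| CondTrue: "expr_value W s e = Some x \<Longrightarrow> x \<noteq> 0 \<Longrightarrow> exec W P s t s' \<Longrightarrow>
    exec W (Cond e P Q) s (1 + expr_cost e + t) s'"
| CondFalse: "expr_value W s e = Some 0 \<Longrightarrow> exec W Q s t s' \<Longrightarrow>
    exec W (Cond e P Q) s (1 + expr_cost e + t) s'"
| WhileTrue: "expr_value W s e = Some x \<Longrightarrow> x \<noteq> 0 \<Longrightarrow> exec W P s t s' \<Longrightarrow>
    exec W (While e P) s' t' s'' \<Longrightarrow> exec W (While e P) s (1 + expr_cost e + t + t') s''"
| WhileFalse: "expr_value W s e = Some 0 \<Longrightarrow> exec W (While e P) s (1 + expr_cost e) s"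

text \<open>
  One program solves all instances in \<open>I\<close>, in worst-case time \<open>O(f)\<close> as a function of the size of
  the instance. Memory cells that do not hold input may contain arbitrary words initially.
\<close>

definition solvable_in_time ::
  "'i set \<Rightarrow> ('i \<Rightarrow> nat) \<Rightarrow> ('i \<Rightarrow> memory \<Rightarrow> bool) \<Rightarrow> ('i \<Rightarrow> memory \<Rightarrow> bool) \<Rightarrow> (nat \<Rightarrow> real) \<Rightarrow> bool"
where
  "solvable_in_time I size_of input output f \<longleftrightarrow>
     (\<exists>(P :: program) (T :: nat \<Rightarrow> nat) (B :: nat \<Rightarrow> nat) (k :: nat).
        (\<lambda>n. real (T n)) \<in> O(f) \<and> (\<lambda>n. real (B n)) \<in> O(\<lambda>n. real n ^ k) \<and>
        (\<forall>x\<in>I. \<forall>W\<ge>B (size_of x). \<forall>s. (\<forall>a i. s a i < W) \<and> input x s \<longrightarrow>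
           (\<exists>t s'. exec W P s t s' \<and> t \<le> T (size_of x) \<and> output x s')))"


section \<open>The two computational problems\<close>

definition stores_matrix :: "memory \<Rightarrow> nat \<Rightarrow> nat \<Rightarrow> bit mat \<Rightarrow> bool" where
  "stores_matrix s a n A \<longleftrightarrow> (\<forall>i<n. \<forall>j<n. s a (i * n + j) = of_bool (A $$ (i, j) = 1))"

definition multiplication_input :: "nat \<times> bit mat \<times> bit mat \<Rightarrow> memory \<Rightarrow> bool" where
  "multiplication_input = (\<lambda>(n, A, B) s.
     s 0 0 = n \<and> stores_matrix s 1 n A \<and> stores_matrix s 2 n B)"

definition multiplication_output :: "nat \<times> bit mat \<times> bit mat \<Rightarrow> memory \<Rightarrow> bool" where
  "multiplication_output = (\<lambda>(n, A, B) s. stores_matrix s 3 n (A * B))"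

definition matrices_multipliable_in_time :: "(nat \<Rightarrow> real) \<Rightarrow> bool" where
  "matrices_multipliable_in_time f \<longleftrightarrow>
     solvable_in_time {(n, A, B). A \<in> carrier_mat n n \<and> B \<in> carrier_mat n n} (\<lambda>(n, A, B). n)
       multiplication_input multiplication_output f"

text \<open>A complex is given to a program as a list of its simplices, each of them a list of its vertices,
  in arbitrary order. Vertices are named by arbitrary machine words.\<close>

definition lists_complex :: "nat list list \<Rightarrow> nat set set \<Rightarrow> bool" where
  "lists_complex xs K \<longleftrightarrow>
     (\<forall>vs\<in>set xs. distinct vs) \<and> distinct (map set xs) \<and> set (map set xs) = K"

text \<open>Array 2 holds the concatenation of the vertex lists, array 1 the position where each of them
  starts, followed by the total length.\<close>

definition annotation_input :: "nat set set \<times> nat list list \<times> nat \<Rightarrow> memory \<Rightarrow> bool" where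
  "annotation_input = (\<lambda>(K, xs, p) s.
     s 0 0 = length xs \<and> s 0 1 = p \<and>
     (\<forall>i\<le>length xs. s 1 i = length (concat (take i xs))) \<and>
     (\<forall>j<length (concat xs). s 2 j = concat xs ! j))"

text \<open>The output is the number \<open>g\<close> of entries of the vectors, and the vector of the \<open>i\<close>-th simplex of
  the input list from index \<open>i * g\<close> of array 4, if this is a \<open>p\<close>-simplex.\<close>

definition annotation_output :: "nat set set \<times> nat list list \<times> nat \<Rightarrow> memory \<Rightarrow> bool" where
  "annotation_output = (\<lambda>(K, xs, p) s.
     s 3 0 = homology_dim K p \<and>
     (\<exists>a. is_annotation K p a \<and>
        (\<forall>i<length xs. set (xs ! i) \<in> simplices K p \<longrightarrow>
           (\<forall>j<homology_dim K p.
              s 4 (i * homology_dim K p + j) = of_bool (a (set (xs ! i)) $ j = 1)))))"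

definition annotations_computable_in_time :: "(nat \<Rightarrow> real) \<Rightarrow> bool" where
  "annotations_computable_in_time f \<longleftrightarrow>
     solvable_in_time
       {(K, xs, p). finite_simplicial_complex K \<and> connected_complex K \<and> lists_complex xs K}
       (\<lambda>(K, xs, p). card K) annotation_input annotation_output f"

end

theory Submission
  imports Defs "HOL-Real_Asymp.Real_Asymp"
begin

text \<open>
  Gauss-Jordan elimination over \<open>\<int>\<^sub>2\<close> reduces to matrix multiplication. The row operations that
  belong to pivots in the rows \<open>\<pi>(j)\<close> and columns \<open>j\<close> of a block combine to a map
  \<open>T x = x + \<Sum>j. M\<^sub>j x(\<pi>(j))\<close>, and the vectors \<open>M\<^sub>j\<close> can overwrite the columns of the block. Consider
  two adjacent blocks of \<open>k\<close> columns. After the elimination of the first one, its map is applied to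
  the second one, and after the elimination of the second one, the map of that is applied to the
  vectors \<open>M\<^sub>j\<close> of the first one, which yields the map of the union. Each time an \<open>N \<times> k\<close> matrix is
  multiplied by a \<open>k \<times> k\<close> matrix, which takes \<open>N/k\<close> multiplications of size \<open>k\<close>. As there are \<open>N/k\<close>
  blocks, the total cost at size \<open>k = 2\<^sup>w\<close> is of order \<open>N\<^sup>2 k\<^sup>\<omega>\<^sup>-\<^sup>2\<close>. For \<open>\<omega> > 2\<close> this is a geometric
  sum, of order \<open>N\<^sup>\<omega>\<close>.

  The rows without pivot of the transformation \<open>T\<close> that eliminates the boundary matrix of dimension
  \<open>p + 1\<close> form a basis of the \<open>p\<close>-cocycles. Likewise the transposed boundary matrix of dimension \<open>p\<close>
  gives a basis of the \<open>p\<close>-cycles. The evaluations of the cocycles on the cycles form a matrix of rank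
  \<open>dim H\<^sub>p\<close>. The pivot rows of a third elimination, of that matrix, select cocycles that represent a
  basis of the cohomology, and their values on a simplex are its annotation.

  A simplex of a complex with \<open>n\<close> simplices has at most \<open>log\<^sub>2 (n + 1)\<close> vertices. Thus all pairs of
  simplices can be compared naively, in time \<open>O(n\<^sup>2 log\<^sup>2 n)\<close>.
\<close>

section \<open>Total correctness of word RAM programs\<close>

text \<open>Programs have no procedures, so the recursion on blocks has to become one loop over the
  columns. Which transformations follow column j depends only on the largest power of 2 that divides
  j + 1; matrices are padded to a power of two so that all blocks can be halved. The multiplication
  program is a black box. It assigns to finitely many arrays, which its text names, and everything
  that must survive a call is kept in arrays beyond them. A cochain f is a cocycle iff f C = 0 for
  the boundary matrix C of dimension p + 1, that is, iff it lies in the left kernel of C, and this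
  is what the rows of T without pivot span. Cycles are a right kernel; transposing the boundary
  matrix of dimension p lets the same elimination serve both. That the vectors have the right length
  is not shown by counting ranks. Evaluation of the selected cocycles is shown to map the cycles
  onto all bit vectors of length g, with the boundaries as its kernel. This gives the dimension of
  the homology and the separation of its classes at once.\<close>

fun ev :: "memory \<Rightarrow> expr \<Rightarrow> nat" where
  "ev s (Const k) = k"
| "ev s (Cell a e) = s a (ev s e)"
| "ev s (Op f e e') = apply_op f (ev s e) (ev s e')"

text \<open>Only constants, sums and products can leave the range of words: stored values are words
  already, truncated differences, quotients and remainders do not exceed the first operand, and
  comparisons yield 0 or 1.\<close>

fun safe :: "nat \<Rightarrow> memory \<Rightarrow> expr \<Rightarrow> bool" where
  "safe W s (Const k) \<longleftrightarrow> k < W"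
| "safe W s (Cell a e) \<longleftrightarrow> safe W s e"
| "safe W s (Op f e e') \<longleftrightarrow> safe W s e \<and> safe W s e' \<and>
     (f = PLUS \<longrightarrow> ev s e + ev s e' < W) \<and> (f = TIMES \<longrightarrow> ev s e * ev s e' < W)"

definition bounded :: "nat \<Rightarrow> memory \<Rightarrow> bool" where
  "bounded W s \<longleftrightarrow> (\<forall>a i. s a i < W)"

lemma boundedD: "bounded W s \<Longrightarrow> s a i < W"
  by (simp add: bounded_def)

lemma bounded_upd: "bounded W s \<Longrightarrow> x < W \<Longrightarrow> bounded W (s(a := (s a)(i := x)))"
  by (auto simp: bounded_def)

lemma ev_less: "bounded W s \<Longrightarrow> 1 < W \<Longrightarrow> safe W s e \<Longrightarrow> ev s e < W"
proof (induction e)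
  case (Op f e e')
  then show ?case
    using le_less_trans[OF div_le_dividend[of "ev s e" "ev s e'"]]
      le_less_trans[OF mod_less_eq_dividend[of "ev s e" "ev s e'"]]
    by (cases f) (auto simp: less_imp_diff_less)
qed (auto simp: boundedD)

lemma expr_value_safe:
  "bounded W s \<Longrightarrow> 1 < W \<Longrightarrow> safe W s e \<Longrightarrow> expr_value W s e = Some (ev s e)"
proof (induction e)
  case (Op f e e')
  then show ?case
    using ev_less[of W s "Op f e e'"] by (simp add: word_def)
qed (auto simp: word_def boundedD)

lemma exec_bounded: "exec W P s t s' \<Longrightarrow> bounded W s \<Longrightarrow> bounded W s'"
proof (induction rule: exec.induct)
  case (Assign s e i e' x a)
  have "x < W"
    using Assign(2) by (cases e') (auto simp: word_def bind_eq_Some_conv split: if_splits)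
  then show ?case using bounded_upd Assign by blast
qed auto

text \<open>An assignment names its array statically, so the text of a program bounds its side
  effects. For the given multiplication program nothing else is known about them.\<close>

fun written :: "program \<Rightarrow> nat set" where
  "written Skip = {}"
| "written (Assign a e e') = {a}"
| "written (Seq P Q) = written P \<union> written Q"
| "written (Cond e P Q) = written P \<union> written Q"
| "written (While e P) = written P"

lemma finite_written: "finite (written P)"
  by (induction P) auto

lemma exec_not_written: "exec W P s t s' \<Longrightarrow> a \<notin> written P \<Longrightarrow> s' a = s a"
  by (induction rule: exec.induct) auto

text \<open>The time is an upper bound, so that costs can be rounded at every level. Boundedness of
  the final memory is built in because every later step requires it.\<close>

definition runs :: "nat \<Rightarrow> program \<Rightarrow> memory \<Rightarrow> nat \<Rightarrow> (memory \<Rightarrow> bool) \<Rightarrow> bool" where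
  "runs W P s t Q \<longleftrightarrow> (\<exists>t' s'. exec W P s t' s' \<and> t' \<le> t \<and> bounded W s' \<and> Q s')"

lemma runs_mono:
  "runs W P s t Q \<Longrightarrow> t \<le> t' \<Longrightarrow> (\<And>s'. bounded W s' \<Longrightarrow> Q s' \<Longrightarrow> Q' s') \<Longrightarrow> runs W P s t' Q'"
  unfolding runs_def using order_trans by blast

lemma runs_Seq:
  assumes "runs W P s t (\<lambda>s'. runs W Q s' t' R)" "t + t' \<le> u"
  shows "runs W (Seq P Q) s u R"
proof -
  obtain t1 s1 t2 s2 where *: "exec W P s t1 s1" "t1 \<le> t" "exec W Q s1 t2 s2" "t2 \<le> t'"
    "bounded W s2" "R s2"
    using assms(1) by (auto simp: runs_def)
  moreover have "t1 + t2 \<le> u" using * assms(2) by linarith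
  ultimately show ?thesis unfolding runs_def using exec.Seq by blast
qed

lemma runs_Seq_mid:
  assumes "runs W P s t M" "\<And>s'. bounded W s' \<Longrightarrow> M s' \<Longrightarrow> runs W Q s' t' R" "t + t' \<le> u"
  shows "runs W (Seq P Q) s u R"
  using assms(1,2,3) by (blast intro: runs_Seq runs_mono order_refl)

lemma runs_Skip: "bounded W s \<Longrightarrow> Q s \<Longrightarrow> 1 \<le> t \<Longrightarrow> runs W Skip s t Q"
  unfolding runs_def using exec.Skip by blast

lemma runs_Assign:
  assumes "bounded W s" "1 < W" "safe W s e" "safe W s e'" "1 + expr_cost e + expr_cost e' \<le> t"
    and "Q (s(a := (s a)(ev s e := ev s e')))"
  shows "runs W (Assign a e e') s t Q"
  unfolding runs_def
  using exec.Assign[OF expr_value_safe expr_value_safe, OF assms(1-3,1,2,4)] assms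
    bounded_upd[OF assms(1) ev_less[OF assms(1,2,4)]] by blast

lemma runs_Cond:
  assumes "bounded W s" "1 < W" "safe W s e"
    and "ev s e \<noteq> 0 \<Longrightarrow> runs W P s t Q" "ev s e = 0 \<Longrightarrow> runs W P' s t Q"
    and "1 + expr_cost e + t \<le> u"
  shows "runs W (Cond e P P') s u Q"
proof (cases "ev s e = 0")
  case True
  obtain t1 s1 where *: "exec W P' s t1 s1" "t1 \<le> t" "bounded W s1" "Q s1"
    using assms(5)[OF True] by (auto simp: runs_def)
  have "exec W (Cond e P P') s (1 + expr_cost e + t1) s1"
    using exec.CondFalse[OF _ *(1)] expr_value_safe[OF assms(1-3)] True by simp
  moreover have "1 + expr_cost e + t1 \<le> u" using * assms(6) by simp
  ultimately show ?thesis using * unfolding runs_def by blast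
next
  case False
  obtain t1 s1 where *: "exec W P s t1 s1" "t1 \<le> t" "bounded W s1" "Q s1"
    using assms(4)[OF False] by (auto simp: runs_def)
  have "exec W (Cond e P P') s (1 + expr_cost e + t1) s1"
    using exec.CondTrue[OF expr_value_safe[OF assms(1-3)] False *(1)] .
  moreover have "1 + expr_cost e + t1 \<le> u" using * assms(6) by simp
  ultimately show ?thesis using * unfolding runs_def by blast
qed

lemma runs_While_step:
  assumes "bounded W s" "1 < W" "safe W s e" "ev s e \<noteq> 0"
    and "runs W P s t (\<lambda>s'. runs W (While e P) s' t' Q)" "1 + expr_cost e + t + t' \<le> u"
  shows "runs W (While e P) s u Q"
proof -
  obtain t1 s1 t2 s2 where *: "exec W P s t1 s1" "t1 \<le> t" "exec W (While e P) s1 t2 s2" "t2 \<le> t'"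
    "bounded W s2" "Q s2"
    using assms(5) by (auto simp: runs_def)
  have "exec W (While e P) s (1 + expr_cost e + t1 + t2) s2"
    using exec.WhileTrue[OF expr_value_safe[OF assms(1-3)] assms(4) *(1,3)] .
  moreover have "1 + expr_cost e + t1 + t2 \<le> u" using * assms(6) by simp
  ultimately show ?thesis using * unfolding runs_def by blast
qed

lemma runs_While_stop:
  assumes "bounded W s" "1 < W" "safe W s e" "ev s e = 0" "Q s" "1 + expr_cost e \<le> u"
  shows "runs W (While e P) s u Q"
proof -
  have "exec W (While e P) s (1 + expr_cost e) s"
    using exec.WhileFalse expr_value_safe[OF assms(1-3)] assms(4) by simp
  then show ?thesis using assms unfolding runs_def by blast
qed

text \<open>The invariant is indexed by the number of completed iterations, whose total
  \<open>m\<close> is known in advance. The induction is on the number \<open>k\<close> of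
  iterations still to come.\<close>

lemma runs_While:
  assumes W: "1 < W"
    and "bounded W s" "I 0 s"
    and test: "\<And>i s. i \<le> m \<Longrightarrow> bounded W s \<Longrightarrow> I i s \<Longrightarrow> safe W s e \<and> (ev s e \<noteq> 0 \<longleftrightarrow> i < m)"
    and body: "\<And>i s. i < m \<Longrightarrow> bounded W s \<Longrightarrow> I i s \<Longrightarrow> runs W P s (t i) (I (Suc i))"
    and "\<And>s. bounded W s \<Longrightarrow> I m s \<Longrightarrow> Q s"
    and "(\<Sum>i<m. t i) + (m + 1) * (1 + expr_cost e) \<le> u"
  shows "runs W (While e P) s u Q"
proof -
  have "runs W (While e P) s ((\<Sum>i\<in>{m-k..<m}. t i) + (k + 1) * (1 + expr_cost e)) Q"
    if "k \<le> m" "bounded W s" "I (m - k) s" for k s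
    using that
  proof (induction k arbitrary: s)
    case 0
    then show ?case using test[of m s] assms(6)[of s]
      by (intro runs_While_stop[OF _ W]) auto
  next
    case (Suc k)
    have 1: "Suc (m - Suc k) = m - k" using Suc.prems by simp
    have "runs W P s (t (m - Suc k)) (I (m - k))"
      using body[of "m - Suc k" s] Suc.prems 1 by simp
    then have "runs W P s (t (m - Suc k))
      (\<lambda>s'. runs W (While e P) s' ((\<Sum>i\<in>{m-k..<m}. t i) + (k + 1) * (1 + expr_cost e)) Q)"
      by (rule runs_mono) (use Suc in auto)
    moreover have "(\<Sum>i\<in>{m-Suc k..<m}. t i) = t (m - Suc k) + (\<Sum>i\<in>{m-k..<m}. t i)"
      using Suc.prems sum.atLeast_Suc_lessThan[of "m - Suc k" m t] 1 by simp
    ultimately show ?case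
      using test[of "m - Suc k" s] Suc.prems
      by (intro runs_While_step[OF _ W]) auto
  qed
  from this[of m s] show ?thesis
    using assms(2,3,7) by (intro runs_mono[of W _ s _ Q u Q]) (auto simp: atLeast0LessThan)
qed

abbreviation V :: "nat \<Rightarrow> expr" where "V x \<equiv> Cell x (Const 0)"

definition For :: "nat \<Rightarrow> expr \<Rightarrow> program \<Rightarrow> program" where
  "For x e P = Seq (Assign x (Const 0) (Const 0))
     (While (Op LESS (V x) e) (Seq P (Assign x (Const 0) (Op PLUS (V x) (Const 1)))))"

text \<open>The bound is evaluated again before every iteration, so the invariant has to fix its
  value. The invariant describes the memory after the counter has been increased, whereas the body
  stops before that.\<close>

lemma runs_For:
  assumes W: "1 < W" and s: "bounded W s" and n: "n < W"
    and init: "I 0 (s(x := (s x)(0 := 0)))"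
    and bound: "\<And>i s. i \<le> n \<Longrightarrow> bounded W s \<Longrightarrow> I i s \<Longrightarrow> s x 0 = i \<and> safe W s e \<and> ev s e = n"
    and body: "\<And>i s. i < n \<Longrightarrow> bounded W s \<Longrightarrow> I i s \<Longrightarrow>
      runs W P s (t i) (\<lambda>s'. s' x 0 = i \<and> I (Suc i) (s'(x := (s' x)(0 := Suc i))))"
    and Q: "\<And>s. bounded W s \<Longrightarrow> I n s \<Longrightarrow> Q s"
    and u: "(\<Sum>i<n. t i) + (n + 1) * (expr_cost e + 20) \<le> u"
  shows "runs W (For x e P) s u Q"
  unfolding For_def
proof (rule runs_Seq)
  show "(3 :: nat) + (u - 3) \<le> u" using u by (simp add: algebra_simps)
  have "runs W (While (Op LESS (V x) e) (Seq P (Assign x (Const 0) (Op PLUS (V x) (Const 1)))))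
      (s(x := (s x)(0 := 0))) (u - 3) Q"
  proof (rule runs_While[where I = I and m = n and t = "\<lambda>i. t i + 6"])
    show "bounded W (s(x := (s x)(0 := 0)))" using s W by (simp add: bounded_upd)
    show "sum (\<lambda>i. t i + 6) {..<n} + (n + 1) * (1 + expr_cost (Op LESS (V x) e)) \<le> u - 3"
      using u by (simp add: sum.distrib algebra_simps)
  next
    fix i s assume i: "i \<le> n" "bounded W s" "I i s"
    show "safe W s (Op LESS (V x) e) \<and> (ev s (Op LESS (V x) e) \<noteq> 0) = (i < n)"
      using bound[OF i] W by auto
  next
    fix i s assume i: "i < n" "bounded W s" "I i s"
    show "runs W (Seq P (Assign x (Const 0) (Op PLUS (V x) (Const 1)))) s (t i + 6) (I (Suc i))"
      by (rule runs_Seq_mid[OF body[OF i]], rule runs_Assign) (use W i n in auto)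
  qed (use init Q W in auto)
  then show "runs W (Assign x (Const 0) (Const 0)) s 3 (\<lambda>s'. runs W (While (Op LESS (V x) e)
      (Seq P (Assign x (Const 0) (Op PLUS (V x) (Const 1))))) s' (u - 3) Q)"
    using s W by (intro runs_Assign) auto
qed

text \<open>The assigned expression may read the cell that is overwritten.\<close>

definition Fill :: "nat \<Rightarrow> nat \<Rightarrow> expr \<Rightarrow> expr \<Rightarrow> expr \<Rightarrow> program" where
  "Fill x a off cnt e = For x cnt (Assign a (Op PLUS off (V x)) e)"

definition filled :: "(nat \<Rightarrow> nat) \<Rightarrow> nat \<Rightarrow> nat \<Rightarrow> (nat \<Rightarrow> nat) \<Rightarrow> nat \<Rightarrow> nat" where
  "filled h d n f = (\<lambda>y. if d \<le> y \<and> y < d + n then f (y - d) else h y)"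

text \<open>The content \<open>h\<close> of the target array during the loop is arbitrary except at
  the cell that is about to be overwritten. This spares every caller an invariant about half-filled
  arrays.\<close>

lemma runs_Fill:
  assumes W: "1 < W" and s: "bounded W s" and n: "n < W" and x: "x \<noteq> a"
    and bound: "\<And>i h. i \<le> n \<Longrightarrow> safe W (s(x := (s x)(0 := i), a := h)) cnt \<and>
          ev (s(x := (s x)(0 := i), a := h)) cnt = n"
    and body: "\<And>i h. i < n \<Longrightarrow> h (d + i) = s a (d + i) \<Longrightarrow>
          safe W (s(x := (s x)(0 := i), a := h)) off \<and> ev (s(x := (s x)(0 := i), a := h)) off = d \<and>
          d + i < W \<and>
          safe W (s(x := (s x)(0 := i), a := h)) e \<and> ev (s(x := (s x)(0 := i), a := h)) e = f i"
    and Q: "Q (s(x := (s x)(0 := n), a := filled (s a) d n f))"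
    and u: "(n + 1) * (expr_cost cnt + expr_cost off + expr_cost e + 30) \<le> u"
  shows "runs W (Fill x a off cnt e) s u Q"
  unfolding Fill_def
proof (rule runs_For[where I = "\<lambda>i s'. s' = s(x := (s x)(0 := i), a := filled (s a) d i f)" and n = n
       and t = "\<lambda>_. 10 + expr_cost off + expr_cost e"])
  show "s(x := (s x)(0 := 0)) = s(x := (s x)(0 := 0), a := filled (s a) d 0 f)"
    using x by (auto simp: fun_eq_iff filled_def)
next
  fix i s' assume i: "i < n" "bounded W s'" and s': "s' = s(x := (s x)(0 := i), a := filled (s a) d i f)"
  have b: "safe W s' off \<and> ev s' off = d \<and> d + i < W \<and> safe W s' e \<and> ev s' e = f i"
    unfolding s' by (rule body[OF i(1)]) (simp add: filled_def)
  have xi: "s' x 0 = i" using x s' by simp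
  have ff: "filled (s a) d (Suc i) f = (filled (s a) d i f)(d + i := f i)"
    by (auto simp: filled_def fun_eq_iff)
  show "runs W (Assign a (Op PLUS off (V x)) e) s' (10 + expr_cost off + expr_cost e)
          (\<lambda>s'. s' x 0 = i \<and> s'(x := (s' x)(0 := Suc i)) = s(x := (s x)(0 := Suc i), a := filled (s a) d (Suc i) f))"
    using b i W x by (intro runs_Assign) (auto simp: xi s' ff fun_eq_iff)
qed (use W s n Q x u bound in \<open>auto simp: algebra_simps\<close>)

section \<open>Gauss-Jordan elimination by column blocks\<close>

text \<open>These rules replace the arithmetic of bits by Boolean operations.\<close>

declare add_bit_eq_xor [simp del] mult_bit_eq_and [simp del]

lemma bit_add_self [simp]: "x + x = (0 :: bit)"
  by (cases x) simp_all

type_synonym bmat = "nat \<Rightarrow> nat \<Rightarrow> bit"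

text \<open>All columns in \<open>J\<close> read the old \<open>x\<close>, so this is one linear map
  and not a sequence of row operations. A column without pivot has \<open>pv j = N\<close> and
  contributes nothing.\<close>

definition apply_pivots :: "nat \<Rightarrow> bmat \<Rightarrow> (nat \<Rightarrow> nat) \<Rightarrow> nat set \<Rightarrow> (nat \<Rightarrow> bit) \<Rightarrow> nat \<Rightarrow> bit" where
  "apply_pivots N M pv J x = (\<lambda>r. x r + (\<Sum>j\<in>J. M r j * (if pv j < N then x (pv j) else 0)))"

text \<open>The form in which linearity composes two blocks: applying a later map to
  \<open>x + \<Sum>j. M\<^sub>j x(\<pi>(j))\<close> amounts to applying it to \<open>x\<close> and
  to the vectors \<open>M\<^sub>j\<close>.\<close>

lemma apply_pivots_linear:
  assumes "finite J'"
  shows "apply_pivots N M pv J (\<lambda>r. x r + (\<Sum>i\<in>J'. f i r * c i)) =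
    (\<lambda>r. apply_pivots N M pv J x r + (\<Sum>i\<in>J'. apply_pivots N M pv J (f i) r * c i))"
proof
  fix r
  have "(\<Sum>j\<in>J. M r j * (if pv j < N then \<Sum>i\<in>J'. f i (pv j) * c i else 0)) =
        (\<Sum>j\<in>J. \<Sum>i\<in>J'. M r j * (if pv j < N then f i (pv j) else 0) * c i)"
    by (rule sum.cong) (auto simp: sum_distrib_left mult.assoc)
  also have "\<dots> = (\<Sum>i\<in>J'. \<Sum>j\<in>J. M r j * (if pv j < N then f i (pv j) else 0) * c i)"
    by (rule sum.swap)
  finally have *: "(\<Sum>j\<in>J. M r j * (if pv j < N then \<Sum>i\<in>J'. f i (pv j) * c i else 0)) =
    (\<Sum>i\<in>J'. (\<Sum>j\<in>J. M r j * (if pv j < N then f i (pv j) else 0)) * c i)"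
    by (simp add: sum_distrib_right)
  have "(\<Sum>j\<in>J. M r j * (if pv j < N then x (pv j) + (\<Sum>i\<in>J'. f i (pv j) * c i) else 0)) =
     (\<Sum>j\<in>J. M r j * (if pv j < N then x (pv j) else 0) +
              M r j * (if pv j < N then \<Sum>i\<in>J'. f i (pv j) * c i else 0))"
    by (rule sum.cong) (auto simp: ring_distribs)
  then show "apply_pivots N M pv J (\<lambda>r. x r + (\<Sum>i\<in>J'. f i r * c i)) r =
     apply_pivots N M pv J x r + (\<Sum>i\<in>J'. apply_pivots N M pv J (f i) r * c i)"
    by (simp add: apply_pivots_def sum.distrib * ring_distribs)
qed

lemma apply_pivots_union:
  assumes "finite J" "finite J'" "J \<inter> J' = {}"
  shows "apply_pivots N M pv (J \<union> J') x =
    (\<lambda>r. apply_pivots N M pv J x r + (\<Sum>j\<in>J'. M r j * (if pv j < N then x (pv j) else 0)))"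
  using assms by (simp add: apply_pivots_def sum.union_disjoint add.assoc)

lemma apply_pivots_cong:
  "(\<And>j r. j \<in> J \<Longrightarrow> M r j = M' r j) \<Longrightarrow> (\<And>j. j \<in> J \<Longrightarrow> pv j = pv' j) \<Longrightarrow>
    apply_pivots N M pv J = apply_pivots N M' pv' J"
  by (auto simp: apply_pivots_def fun_eq_iff intro!: sum.cong)

lemma apply_pivots_fix: "(\<And>j. j \<in> J \<Longrightarrow> pv j < N \<Longrightarrow> x (pv j) = 0) \<Longrightarrow> apply_pivots N M pv J x = x"
  by (auto simp: apply_pivots_def fun_eq_iff intro!: sum.neutral)

text \<open>A state of the elimination consists of the matrix, the pivot row of each column
  (\<open>N\<close> if there is none), and the set of all pivot rows. A column that has been processed no longer
  belongs to the matrix that is eliminated, but is used by \<^const>\<open>apply_pivots\<close>.\<close>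

type_synonym estate = "bmat \<times> (nat \<Rightarrow> nat) \<times> nat set"

text \<open>Follows a loop over the rows in which later candidates overwrite earlier ones, so the
  largest admissible row wins.\<close>

fun pivot :: "nat \<Rightarrow> bmat \<Rightarrow> nat set \<Rightarrow> nat \<Rightarrow> nat \<Rightarrow> nat" where
  "pivot N M U j 0 = N"
| "pivot N M U j (Suc i) = (if i \<notin> U \<and> M i j = 1 then i else pivot N M U j i)"

lemma pivot_le: "i \<le> N \<Longrightarrow> pivot N M U j i \<le> N"
  by (induction i) auto

lemma pivot_less: "pivot N M U j i < N \<Longrightarrow> pivot N M U j i \<notin> U \<and> M (pivot N M U j i) j = 1"
  by (induction i) (auto split: if_splits)

lemma pivot_none: "\<not> pivot N M U j i < N \<Longrightarrow> i \<le> N \<Longrightarrow> r < i \<Longrightarrow> r \<notin> U \<Longrightarrow> M r j = 0"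
  by (induction i) (auto simp: less_Suc_eq split: if_splits)

text \<open>For a column c with pivot row r, clearing entry r gives the vector M = c + e_r. As c has
  entry 1 at r, the map x + M x(r) sends c to c + M = e_r.\<close>

fun leaf :: "nat \<Rightarrow> nat \<Rightarrow> estate \<Rightarrow> estate" where
  "leaf N j (M, pv, U) = (let r = pivot N M U j N in
     (if r < N then M(r := (M r)(j := 0)) else M, pv(j := r), if r < N then insert r U else U))"

text \<open>Serves both directions: unprocessed destination columns are eliminated further, while
  processed ones hold vectors of an earlier map, which is thereby composed with the later
  one.\<close>

fun transform :: "nat \<Rightarrow> nat \<Rightarrow> nat \<Rightarrow> nat \<Rightarrow> estate \<Rightarrow> estate" where
  "transform N src dst k (M, pv, U) =
     (\<lambda>r c. if dst \<le> c \<and> c < dst + k then apply_pivots N M pv {src..<src + k} (\<lambda>r. M r c) r else M r c, pv, U)"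

fun eliminate_block :: "nat \<Rightarrow> nat \<Rightarrow> nat \<Rightarrow> estate \<Rightarrow> estate" where
  "eliminate_block N lo 0 st = leaf N lo st"
| "eliminate_block N lo (Suc v) st = transform N (lo + 2^v) lo (2^v) (eliminate_block N (lo + 2^v) v
     (transform N lo (lo + 2^v) (2^v) (eliminate_block N lo v st)))"

text \<open>The map built from the final vectors is applied to the columns as they were before the
  elimination. A column without pivot only has to vanish outside \<open>U'\<close>, the pivot rows
  of all columns so far. Injectivity is recorded instead of an inverse because it passes to
  compositions directly.\<close>

definition reduces :: "nat \<Rightarrow> nat set \<Rightarrow> estate \<Rightarrow> estate \<Rightarrow> bool" where
  "reduces N J = (\<lambda>(M, pv, U) (M', pv', U').
     (\<forall>j. j \<notin> J \<longrightarrow> pv' j = pv j \<and> (\<forall>r. M' r j = M r j)) \<and>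
     (\<forall>j\<in>J. pv' j < N \<longrightarrow> pv' j \<notin> U) \<and> inj_on pv' {j\<in>J. pv' j < N} \<and> (\<forall>j\<in>J. pv' j \<le> N) \<and>
     U' = U \<union> {r. r < N \<and> r \<in> pv' ` J} \<and>
     inj (apply_pivots N M' pv' J) \<and>
     (\<forall>j\<in>J. if pv' j < N then apply_pivots N M' pv' J (\<lambda>r. M r j) = (\<lambda>r. of_bool (r = pv' j))
       else \<forall>r<N. r \<notin> U' \<longrightarrow> apply_pivots N M' pv' J (\<lambda>r. M r j) r = 0))"

lemma reduces_leaf: "reduces N {j} (M, pv, U) (leaf N j (M, pv, U))"
proof (cases "pivot N M U j N < N")
  case True
  define p where "p = pivot N M U j N"
  have p: "p < N" "p \<notin> U" "M p j = 1" using True pivot_less unfolding p_def by blast+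
  have g: "apply_pivots N (M(p := (M p)(j := 0))) (pv(j := p)) {j} =
    (\<lambda>x r. x r + (if r = p then 0 else M r j * x p))" for j
    using p by (auto simp: apply_pivots_def fun_eq_iff)
  \<comment> \<open>The map leaves coordinate \<open>p\<close> unchanged; once that is known, the
    other coordinates can be recovered.\<close>
  have "inj (\<lambda>x r. x r + (if r = p then 0 else M r j * x p))"
  proof (rule injI, rule ext)
    fix x y r assume *: "(\<lambda>r. x r + (if r = p then 0 else M r j * x p)) = (\<lambda>r. y r + (if r = p then 0 else M r j * y p))"
    have "x p = y p" using fun_cong[OF *, of p] by simp
    then show "x r = y r" using fun_cong[OF *, of r] by (auto split: if_splits)
  qed
  then show ?thesis using p
    by (auto simp: reduces_def p_def[symmetric] Let_def g)
next
  case False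
  have "pivot N M U j N = N" using False pivot_le[of N N M U j] by simp
  then show ?thesis using pivot_none[OF False]
    by (auto simp: reduces_def Let_def apply_pivots_def inj_def fun_eq_iff)
qed

text \<open>The final vectors represent the composition \<open>T2 (T1 x)\<close>: by linearity
  \<open>T2\<close> only has to be applied to the vectors of the first block. It does not spoil the
  columns that \<open>T1\<close> has reduced, because these vanish in all rows that can still become
  pivots.\<close>

lemma reduces_join:
  assumes R1: "reduces N {lo..<lo+k} (M, pv, U) (M1, pv1, U1)"
    and M2: "(M2, pv2, U2) = transform N lo (lo+k) k (M1, pv1, U1)"
    and R2: "reduces N {lo+k..<lo+k+k} (M2, pv2, U2) (M3, pv3, U3)"
    and M4: "(M4, pv4, U4) = transform N (lo+k) lo k (M3, pv3, U3)"
  shows "reduces N {lo..<lo+k+k} (M, pv, U) (M4, pv4, U4)"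
proof -
  define A where "A = {lo..<lo+k}"
  define B where "B = {lo+k..<lo+k+k}"
  have AB: "{lo..<lo+k+k} = A \<union> B" "A \<inter> B = {}" "finite A" "finite B"
    by (auto simp: A_def B_def)
  have pv: "pv2 = pv1" "pv4 = pv3" "U2 = U1" "U4 = U3" using M2 M4 by auto
  note R1 = R1[folded A_def, unfolded reduces_def, simplified]
  note R2 = R2[folded B_def, unfolded reduces_def, simplified, unfolded pv]
  define T1 where "T1 = apply_pivots N M1 pv1 A"
  define T2 where "T2 = apply_pivots N M3 pv3 B"
  have M2B: "(\<lambda>r. M2 r j) = T1 (\<lambda>r. M1 r j)" if "j \<in> B" for j
    using M2 that by (auto simp: B_def T1_def A_def)
  have M2A: "(\<lambda>r. M2 r j) = (\<lambda>r. M1 r j)" if "j \<notin> B" for j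
    using M2 that by (auto simp: B_def)
  have M4A: "(\<lambda>r. M4 r j) = T2 (\<lambda>r. M1 r j)" if "j \<in> A" for j
  proof -
    have "(\<lambda>r. M4 r j) = T2 (\<lambda>r. M3 r j)"
      using M4 that by (auto simp: T2_def A_def B_def)
    moreover have "(\<lambda>r. M3 r j) = (\<lambda>r. M1 r j)"
    proof -
      have "j \<notin> B" using that AB(2) by blast
      then show ?thesis using R2 M2A[of j] by (simp add: fun_eq_iff)
    qed
    ultimately show ?thesis by simp
  qed
  have M4n: "(\<lambda>r. M4 r j) = (\<lambda>r. M3 r j)" if "j \<notin> A" for j
    using M4 that by (auto simp: A_def)
  have pvA: "pv3 j = pv1 j" if "j \<in> A" for j
    using R2 that AB(2) by auto
  have T: "apply_pivots N M4 pv3 (A \<union> B) x = T2 (T1 x)" for x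
  proof -
    have "T2 (T1 x) = T2 (\<lambda>r. x r + (\<Sum>j\<in>A. M1 r j * (if pv1 j < N then x (pv1 j) else 0)))"
      by (simp add: T1_def apply_pivots_def)
    also have "\<dots> = (\<lambda>r. T2 x r + (\<Sum>j\<in>A. T2 (\<lambda>r. M1 r j) r * (if pv1 j < N then x (pv1 j) else 0)))"
      unfolding T2_def by (rule apply_pivots_linear) (rule AB)
    also have "\<dots> = (\<lambda>r. T2 x r + (\<Sum>j\<in>A. M4 r j * (if pv3 j < N then x (pv3 j) else 0)))"
      by (intro ext arg_cong2[of _ _ _ _ "(+)"] refl sum.cong)
        (simp_all add: pvA M4A[symmetric])
    also have "\<dots> = apply_pivots N M4 pv3 (B \<union> A) x"
      using apply_pivots_union[of B A N M4 pv3 x] AB apply_pivots_cong[of B M4 M3 pv3 pv3 N] M4n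
      by (simp add: Int_commute T2_def fun_eq_iff) (metis IntI empty_iff)
    finally show ?thesis by (simp add: Un_commute)
  qed
  have T1M: "T1 (\<lambda>r. M r j) = (\<lambda>r. of_bool (r = pv1 j))" if "j \<in> A" "pv1 j < N" for j
    using R1 that by (auto simp: T1_def)
  have T1M0: "T1 (\<lambda>r. M r j) r = 0" if "j \<in> A" "\<not> pv1 j < N" "r < N" "r \<notin> U1" for j r
    using R1 that by (auto simp: T1_def)
  \<comment> \<open>The pivots of the second block lie outside \<open>U1\<close>, so
    \<open>T2\<close> reads only zeros from a vector supported in \<open>U1\<close>.\<close>
  have T2fix: "T2 x = x" if "\<And>r. r < N \<Longrightarrow> r \<notin> U1 \<Longrightarrow> x r = 0" for x
    unfolding T2_def by (rule apply_pivots_fix) (use R2 that in auto)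
  have U1: "r \<in> U1" if "j \<in> A" "pv1 j = r" "r < N" for j r using R1 that by auto
  have MB: "(\<lambda>r. M1 r j) = (\<lambda>r. M r j)" if "j \<in> B" for j
    using R1 that AB(2) by (auto simp: fun_eq_iff)
  have col: "if pv3 j < N then T2 (T1 (\<lambda>r. M r j)) = (\<lambda>r. of_bool (r = pv3 j))
       else \<forall>r<N. r \<notin> U3 \<longrightarrow> T2 (T1 (\<lambda>r. M r j)) r = 0" if "j \<in> A \<union> B" for j
    using that
  proof
    assume j: "j \<in> A"
    have "T2 (T1 (\<lambda>r. M r j)) = T1 (\<lambda>r. M r j)"
    proof (cases "pv1 j < N")
      case True then show ?thesis using T1M[OF j True] U1[OF j refl] by (intro T2fix) auto
    next
      case False then show ?thesis using T1M0[OF j False] by (intro T2fix) auto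
    qed
    then show ?thesis using T1M[OF j] T1M0[OF j] pvA[OF j] R2 by auto
  next
    assume j: "j \<in> B"
    then show ?thesis using R2 M2B[OF j] MB[OF j] by (auto simp: T2_def)
  qed
  have inj: "inj (\<lambda>x. T2 (T1 x))"
    using R1 R2 inj_compose[of T2 T1] by (simp add: T1_def T2_def o_def)
  have injpv: "inj_on pv3 {j \<in> A \<union> B. pv3 j < N}"
  proof (rule inj_onI)
    fix i j assume ij: "i \<in> {j \<in> A \<union> B. pv3 j < N}" "j \<in> {j \<in> A \<union> B. pv3 j < N}" "pv3 i = pv3 j"
    have *: "i = j" if "i \<in> A" "j \<in> A" "pv1 i = pv1 j" "pv1 j < N" for i j
      using R1 that by (auto dest!: inj_onD)
    have **: "i = j" if "i \<in> B" "j \<in> B" "pv3 i = pv3 j" "pv3 j < N" for i j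
      using R2 that by (auto dest!: inj_onD)
    have ***: False if "i \<in> A" "j \<in> B" "pv3 i = pv3 j" "pv3 j < N" for i j
      using R2 U1[OF that(1) refl] that pvA[OF that(1)] by auto
    show "i = j" using ij * ** *** pvA by (metis (no_types, lifting) UnE mem_Collect_eq)
  qed
  show ?thesis
    unfolding AB(1) reduces_def prod.case pv
  proof (intro conjI ballI allI impI)
    show "inj (apply_pivots N M4 pv3 (A \<union> B))" using inj T by (simp add: inj_def)
    show "U3 = U \<union> {r. r < N \<and> r \<in> pv3 ` (A \<union> B)}"
      using R1 R2 by (auto simp: image_Un pvA image_iff)
  next
    fix j assume "j \<in> A \<union> B"
    then show "if pv3 j < N then apply_pivots N M4 pv3 (A \<union> B) (\<lambda>r. M r j) = (\<lambda>r. of_bool (r = pv3 j))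
       else \<forall>r<N. r \<notin> U3 \<longrightarrow> apply_pivots N M4 pv3 (A \<union> B) (\<lambda>r. M r j) r = 0"
      using col T by simp
  next
    fix j r assume "j \<notin> A \<union> B"
    then show "M4 r j = M r j" using M4n[of j] R2 M2A[of j] R1 by (simp add: fun_eq_iff)
  qed (use R1 R2 injpv pvA in auto)
qed

lemma reduces_eliminate_block: "reduces N {lo..<lo + 2^v} st (eliminate_block N lo v st)"
proof (induction v arbitrary: lo st)
  case 0
  then show ?case using reduces_leaf by (cases st) simp
next
  case (Suc v)
  obtain M pv U M1 pv1 U1 M2 pv2 U2 M3 pv3 U3 M4 pv4 U4 where
    st: "st = (M, pv, U)" and 1: "eliminate_block N lo v st = (M1, pv1, U1)"
    and 2: "(M2, pv2, U2) = transform N lo (lo + 2^v) (2^v) (M1, pv1, U1)"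
    and 3: "eliminate_block N (lo + 2^v) v (M2, pv2, U2) = (M3, pv3, U3)"
    and 4: "(M4, pv4, U4) = transform N (lo + 2^v) lo (2^v) (M3, pv3, U3)"
    by (metis prod_cases3)
  have "reduces N {lo..<lo + 2^v + 2^v} (M, pv, U) (M4, pv4, U4)"
    using reduces_join[OF _ 2 _ 4] Suc[of lo st] Suc[of "lo + 2^v" "(M2, pv2, U2)"] 1 3 st by simp
  then show ?case using 1 2 3 4 st by (simp add: add.assoc mult_2)
qed

text \<open>The schedule of \<^term>\<open>eliminate_block\<close> without recursion: column \<open>j\<close> is followed by all
  transformations that only had to wait for it.\<close>

definition combine :: "nat \<Rightarrow> nat \<Rightarrow> nat \<Rightarrow> estate \<Rightarrow> estate" where
  "combine N J v st = fold (\<lambda>w. transform N (J - 2^w) (J - 2 * 2^w) (2^w)) [0..<v] st"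

text \<open>After \<open>J\<close> columns, the blocks of sizes 2^0, ..., 2^(v-1) that end at
  \<open>J\<close> are right halves, so each is combined with its left neighbour. The block of size
  2^v that ends at \<open>J\<close> is a left half: its map is passed on to its right neighbour,
  which exists unless the matrix is exhausted.\<close>

definition step :: "nat \<Rightarrow> nat \<Rightarrow> estate \<Rightarrow> estate" where
  "step N j st = (let J = Suc j; v = multiplicity 2 J; st' = combine N J v (leaf N j st) in
     if J < N then transform N (J - 2^v) J (2^v) st' else st')"

text \<open>Identifies the size of the block that is passed on at the midpoint of an aligned block:
  it is exactly the left half.\<close>

lemma multiplicity_add_power:
  assumes "(2::nat) ^ Suc v dvd lo"
  shows "multiplicity 2 (lo + 2^v) = v"
proof -
  have "(2::nat) ^ v dvd lo + 2^v" using assms by (simp add: dvd_add power_le_dvd[of _ "Suc v"])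
  moreover have "\<not> (2::nat) ^ Suc v dvd lo + 2^v"
    using assms by (simp only: dvd_add_right_iff) (simp add: power_dvd_imp_le nat_dvd_not_less)
  ultimately show ?thesis by (rule multiplicity_eqI)
qed

text \<open>The last column of the block is written as \<open>leaf\<close> and \<open>v\<close>
  combinations instead of a \<open>step\<close>, because a \<open>step\<close> there would also
  perform transformations that belong to enclosing blocks.\<close>

lemma steps_eliminate_block:
  assumes "2 ^ v dvd lo" "lo + 2 ^ v \<le> N"
  shows "combine N (lo + 2^v) v (leaf N (lo + 2^v - 1) (fold (step N) [lo..<lo + 2^v - 1] st)) = eliminate_block N lo v st"
  using assms
proof (induction v arbitrary: lo st)
  case 0
  then show ?case by (simp add: combine_def)
next
  case (Suc v)
  let ?k = "2 ^ v :: nat"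
  have k: "0 < ?k" by simp
  define st1 where "st1 = eliminate_block N lo v st"
  define st2 where "st2 = transform N lo (lo + ?k) ?k st1"
  define st3 where "st3 = eliminate_block N (lo + ?k) v st2"
  have dv: "?k dvd lo" using Suc.prems(1) power_le_dvd by (metis le_SucI order_refl)
  have IH1: "combine N (lo + ?k) v (leaf N (lo + ?k - 1) (fold (step N) [lo..<lo + ?k - 1] st)) = st1"
    unfolding st1_def using Suc.prems dv by (intro Suc.IH) auto
  have IH2: "combine N (lo + ?k + ?k) v (leaf N (lo + ?k + ?k - 1) (fold (step N) [lo + ?k..<lo + ?k + ?k - 1] st2)) = st3"
    unfolding st3_def using Suc.prems dv by (intro Suc.IH) auto
  have s: "step N (lo + ?k - 1) (fold (step N) [lo..<lo + ?k - 1] st) = st2"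
  proof -
    have "lo + ?k < N" "Suc (lo + ?k - 1) = lo + ?k" using Suc.prems(2) k unfolding power_Suc by linarith+
    then show ?thesis
      using IH1 multiplicity_add_power[OF Suc.prems(1)] unfolding step_def Let_def by (simp add: st2_def)
  qed
  have e: "[lo..<lo + 2 ^ Suc v - 1] = [lo..<lo + ?k - 1] @ [lo + ?k - 1] @ [lo + ?k..<lo + ?k + ?k - 1]"
  proof -
    have "[lo..<lo + 2 ^ Suc v - 1] = [lo..<lo + ?k - 1] @ [lo + ?k - 1..<lo + ?k + ?k - 1]"
    proof -
      have "lo \<le> lo + ?k - 1" "lo + 2 ^ Suc v - 1 = lo + ?k - 1 + ?k" "lo + ?k + ?k - 1 = lo + ?k - 1 + ?k"
        using k unfolding power_Suc by linarith+
      then show ?thesis using upt_add_eq_append[of lo "lo + ?k - 1" ?k] by metis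
    qed
    also have "[lo + ?k - 1..<lo + ?k + ?k - 1] = (lo + ?k - 1) # [lo + ?k..<lo + ?k + ?k - 1]"
    proof -
      have "lo + ?k - 1 < lo + ?k + ?k - 1" "Suc (lo + ?k - 1) = lo + ?k" using k by linarith+
      then show ?thesis using upt_conv_Cons by metis
    qed
    finally show ?thesis by simp
  qed
  have "combine N (lo + 2 ^ Suc v) (Suc v) (leaf N (lo + 2 ^ Suc v - 1) (fold (step N) [lo..<lo + 2 ^ Suc v - 1] st)) =
     transform N (lo + ?k) lo ?k (combine N (lo + ?k + ?k) v (leaf N (lo + ?k + ?k - 1) (fold (step N) [lo + ?k..<lo + ?k + ?k - 1] st2)))"
    unfolding e by (simp add: combine_def s[simplified] mult_2 add.assoc)
  also have "\<dots> = eliminate_block N lo (Suc v) st" unfolding IH2 by (simp add: st3_def st2_def st1_def)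
  finally show ?case .
qed

lemma fold_step_eliminate_block: "fold (step (2^v)) [0..<2^v] st = eliminate_block (2^v) 0 v st"
proof -
  have "[0..<2^v] = [0..<2^v - 1] @ [2^v - 1 :: nat]"
    using upt_Suc_append[of 0 "2^v - 1"] by simp
  then show ?thesis
    using steps_eliminate_block[of v 0 "2^v" st] by (simp add: step_def Let_def)
qed

section \<open>The result of an elimination\<close>

declare sum_mult_of_bool_eq [simp del] sum_of_bool_mult_eq [simp del]

definition mat_mul :: "nat \<Rightarrow> bmat \<Rightarrow> bmat \<Rightarrow> bmat" where
  "mat_mul N A B = (\<lambda>r c. \<Sum>s<N. A r s * B s c)"

definition mat_vec :: "nat \<Rightarrow> bmat \<Rightarrow> (nat \<Rightarrow> bit) \<Rightarrow> nat \<Rightarrow> bit" where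
  "mat_vec N A x = (\<lambda>r. \<Sum>s<N. A r s * x s)"

lemma mat_vec_assoc: "mat_vec N A (mat_vec N B x) = mat_vec N (mat_mul N A B) x"
proof
  fix r
  have "mat_vec N A (mat_vec N B x) r = (\<Sum>s<N. \<Sum>t<N. A r s * B s t * x t)"
    by (simp add: mat_vec_def sum_distrib_left mult.assoc)
  also have "\<dots> = (\<Sum>t<N. \<Sum>s<N. A r s * B s t * x t)" by (rule sum.swap)
  also have "\<dots> = mat_vec N (mat_mul N A B) x r" by (simp add: mat_vec_def mat_mul_def sum_distrib_right)
  finally show "mat_vec N A (mat_vec N B x) r = mat_vec N (mat_mul N A B) x r" .
qed

lemma mat_vec_col: "mat_vec N A (\<lambda>s. B s c) = (\<lambda>r. mat_mul N A B r c)"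
  by (simp add: mat_vec_def mat_mul_def)

lemma mat_mul_assoc: "mat_mul N (mat_mul N A B) C = mat_mul N A (mat_mul N B C)"
proof (intro ext)
  fix r c
  show "mat_mul N (mat_mul N A B) C r c = mat_mul N A (mat_mul N B C) r c"
    using fun_cong[OF mat_vec_assoc[of N A B "\<lambda>s. C s c"], of r] by (simp add: mat_vec_col)
qed

lemma mat_vec_cong: "(\<And>s. s < N \<Longrightarrow> A r s = A' r s) \<Longrightarrow> (\<And>s. s < N \<Longrightarrow> x s = x' s) \<Longrightarrow> mat_vec N A x r = mat_vec N A' x' r"
  unfolding mat_vec_def by (rule sum.cong) auto

lemma mat_vec_add: "mat_vec N A (\<lambda>s. x s + y s) = (\<lambda>r. mat_vec N A x r + mat_vec N A y r)"
  by (simp add: mat_vec_def sum.distrib ring_distribs)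

lemma mat_vec_sum: "mat_vec N A (\<lambda>s. \<Sum>i\<in>I. f i s * c i) = (\<lambda>r. \<Sum>i\<in>I. mat_vec N A (f i) r * c i)"
proof
  fix r
  have "mat_vec N A (\<lambda>s. \<Sum>i\<in>I. f i s * c i) r = (\<Sum>s<N. \<Sum>i\<in>I. A r s * f i s * c i)"
    by (simp add: mat_vec_def sum_distrib_left mult.assoc)
  also have "\<dots> = (\<Sum>i\<in>I. \<Sum>s<N. A r s * f i s * c i)" by (rule sum.swap)
  finally show "mat_vec N A (\<lambda>s. \<Sum>i\<in>I. f i s * c i) r = (\<Sum>i\<in>I. mat_vec N A (f i) r * c i)"
    by (simp add: mat_vec_def sum_distrib_right)
qed

lemma sum_of_bool_mult:
  fixes x :: "nat \<Rightarrow> bit"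
  shows "r < N \<Longrightarrow> (\<Sum>s<N. of_bool (r = s) * x s) = x r"
    and "r < N \<Longrightarrow> (\<Sum>s<N. x s * of_bool (s = r)) = x r"
proof -
  assume r: "r < N"
  have "(\<Sum>s<N. of_bool (r = s) * x s) = (\<Sum>s<N. if s = r then x s else 0)"
    "(\<Sum>s<N. x s * of_bool (s = r)) = (\<Sum>s<N. if s = r then x s else 0)"
    by (rule sum.cong; auto)+
  then show "(\<Sum>s<N. of_bool (r = s) * x s) = x r" "(\<Sum>s<N. x s * of_bool (s = r)) = x r"
    using r by simp_all
qed

text \<open>The interface of an elimination, without reference to the order of columns. The rows of
  \<open>T\<close> outside \<open>P\<close> are a basis of the left kernel of \<open>A\<close>. As
  the columns of \<open>T\<close> outside \<open>P\<close> are unit vectors, \<open>T\<close> fixes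
  every vector that vanishes on \<open>P\<close>; hence the rows of \<open>A\<close> in
  \<open>P\<close> are a basis of its row space.\<close>

definition eliminates :: "nat \<Rightarrow> bmat \<Rightarrow> bmat \<Rightarrow> nat set \<Rightarrow> bool" where
  "eliminates N A T P \<longleftrightarrow> P \<subseteq> {..<N} \<and>
     (\<exists>R. \<forall>r<N. \<forall>c<N. mat_mul N T R r c = of_bool (r = c) \<and> mat_mul N R T r c = of_bool (r = c)) \<and>
     (\<forall>i<N. i \<notin> P \<longrightarrow> (\<forall>r<N. T r i = of_bool (r = i))) \<and>
     (\<forall>i\<in>P. \<exists>j<N. \<forall>r<N. mat_mul N T A r j = of_bool (r = i)) \<and>
     (\<forall>r<N. r \<notin> P \<longrightarrow> (\<forall>j<N. mat_mul N T A r j = 0))"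

lemma eliminatesD:
  assumes "eliminates N A T P"
  shows eliminates_subset: "P \<subseteq> {..<N}"
    and eliminates_inverse: "\<exists>R. \<forall>r<N. \<forall>c<N. mat_mul N R T r c = of_bool (r = c)"
    and eliminates_unit: "i < N \<Longrightarrow> i \<notin> P \<Longrightarrow> r < N \<Longrightarrow> T r i = of_bool (r = i)"
    and eliminates_pivot: "i \<in> P \<Longrightarrow> \<exists>j<N. \<forall>r<N. mat_mul N T A r j = of_bool (r = i)"
    and eliminates_zero: "r < N \<Longrightarrow> r \<notin> P \<Longrightarrow> j < N \<Longrightarrow> mat_mul N T A r j = 0"
  using assms unfolding eliminates_def by meson+

text \<open>An injective map of the finite set of bit vectors to itself is onto, which yields a
  right inverse.\<close>

lemma injective_matrix_inverse:
  assumes inj: "\<And>x. (\<And>r. r < N \<Longrightarrow> mat_vec N T x r = 0) \<Longrightarrow> (\<And>r. r < N \<Longrightarrow> x r = 0)"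
  shows "\<exists>R. \<forall>r<N. \<forall>c<N. mat_mul N T R r c = of_bool (r = c) \<and> mat_mul N R T r c = of_bool (r = c)"
proof -
  \<comment> \<open>Vectors continued by 0 beyond \<open>N\<close>: this makes the set finite and
    turns agreement below \<open>N\<close> into equality.\<close>
  define S where "S = {x. \<forall>r. (r \<in> {..<N} \<longrightarrow> x r \<in> {0, 1::bit}) \<and> (r \<notin> {..<N} \<longrightarrow> x r = 0)}"
  define f where "f x = (\<lambda>r. if r < N then mat_vec N T x r else 0)" for x
  have fin: "finite S" unfolding S_def by (rule finite_set_of_finite_funs) auto
  have S: "f x \<in> S" for x by (auto simp: S_def f_def)
  have "inj_on f S"
  proof (rule inj_onI, rule ext)
    fix x y r assume xy: "x \<in> S" "y \<in> S" "f x = f y"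
    show "x r = y r"
    proof (cases "r < N")
      case True
      have "x r + y r = 0"
      proof (rule inj[OF _ True])
        fix r assume "r < N"
        then have "mat_vec N T x r = mat_vec N T y r" using fun_cong[OF xy(3), of r] by (simp add: f_def)
        then show "mat_vec N T (\<lambda>s. x s + y s) r = 0" by (simp add: mat_vec_add)
      qed
      then show ?thesis by (cases "x r"; cases "y r") auto
    qed (use xy in \<open>auto simp: S_def\<close>)
  qed
  then have surj: "f ` S = S" using endo_inj_surj[OF fin] S by blast
  have "\<exists>x. f x = (\<lambda>r. of_bool (r = c))" if "c < N" for c
  proof -
    have "(\<lambda>r. of_bool (r = c)) \<in> S" using that by (auto simp: S_def)
    then show ?thesis using surj by (metis imageE)
  qed
  then obtain X where X: "\<And>c. c < N \<Longrightarrow> f (X c) = (\<lambda>r. of_bool (r = c))" by metis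
  define R where "R = (\<lambda>r c. X c r)"
  have TR: "mat_mul N T R r c = of_bool (r = c)" if "r < N" "c < N" for r c
    using fun_cong[OF X[OF that(2)], of r] that by (simp add: f_def R_def mat_vec_def mat_mul_def)
  have RT: "mat_mul N R T r c = of_bool (r = c)" if r: "r < N" and c: "c < N" for r c
  proof -
    \<comment> \<open>T R = I gives T (R T + I) = T + T = 0, so each column of R T + I is in the
      trivial kernel.\<close>
    have "mat_mul N R T r c + of_bool (r = c) = 0"
    proof (rule inj[OF _ r])
      fix r assume r: "r < N"
      have "mat_vec N T (\<lambda>s. mat_mul N R T s c) r = mat_mul N (mat_mul N T R) T r c"
        by (simp add: mat_vec_col mat_mul_assoc)
      also have "\<dots> = (\<Sum>s<N. of_bool (r = s) * T s c)"
        unfolding mat_mul_def[of _ "mat_mul N T R"] by (rule sum.cong) (auto simp: TR r)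
      also have "\<dots> = T r c" using r by (rule sum_of_bool_mult)
      finally show "mat_vec N T (\<lambda>s. mat_mul N R T s c + of_bool (s = c)) r = 0"
        using sum_of_bool_mult(2)[OF c, of "T r"] by (simp add: mat_vec_add) (simp add: mat_vec_def)
    qed
    then show ?thesis by (cases "mat_mul N R T r c"; cases "r = c") auto
  qed
  show ?thesis using TR RT by blast
qed

text \<open>The matrix of \<open>apply_pivots\<close>: column s is the unit vector, plus the vector
  \<open>M\<^sub>j\<close> if s is the pivot row of column j.\<close>

definition pivots_mat :: "nat \<Rightarrow> estate \<Rightarrow> bmat" where
  "pivots_mat N = (\<lambda>(M, pv, U) r s. of_bool (r = s) + (\<Sum>j<N. M r j * of_bool (pv j = s)))"

lemma pivots_mat_pivot:
  assumes "inj_on pv {j\<in>{..<N}. pv j < N}" "j < N" "pv j < N"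
  shows "pivots_mat N (M, pv, U) r (pv j) = of_bool (r = pv j) + M r j"
proof -
  have "(\<Sum>i<N. M r i * of_bool (pv i = pv j)) = (\<Sum>i<N. M r i * of_bool (i = j))"
    using assms by (intro sum.cong) (auto dest: inj_onD)
  also have "\<dots> = M r j" using assms(2) by (rule sum_of_bool_mult)
  finally show ?thesis by (simp add: pivots_mat_def)
qed

lemma pivots_mat_no_pivot: "\<forall>j<N. pv j \<noteq> s \<Longrightarrow> pivots_mat N (M, pv, U) r s = of_bool (r = s)"
  by (simp add: pivots_mat_def)

lemma mat_vec_pivots_mat:
  assumes "r < N" shows "mat_vec N (pivots_mat N (M, pv, U)) x r = apply_pivots N M pv {..<N} x r"
proof -
  have "mat_vec N (pivots_mat N (M, pv, U)) x r =
     (\<Sum>s<N. of_bool (r = s) * x s) + (\<Sum>s<N. \<Sum>j<N. M r j * (of_bool (pv j = s) * x s))"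
    by (simp add: mat_vec_def pivots_mat_def ring_distribs sum.distrib sum_distrib_right mult.assoc)
  also have "(\<Sum>s<N. of_bool (r = s) * x s) = x r" by (rule sum_of_bool_mult) fact
  also have "(\<Sum>s<N. \<Sum>j<N. M r j * (of_bool (pv j = s) * x s)) =
     (\<Sum>j<N. \<Sum>s<N. M r j * (of_bool (pv j = s) * x s))" by (rule sum.swap)
  also have "\<dots> = (\<Sum>j<N. M r j * (if pv j < N then x (pv j) else 0))"
  proof (rule sum.cong[OF refl])
    fix j
    show "(\<Sum>s<N. M r j * (of_bool (pv j = s) * x s)) = M r j * (if pv j < N then x (pv j) else 0)"
    proof (cases "pv j < N")
      case True
      then show ?thesis using sum_of_bool_mult(1)[OF True, of x] by (simp add: sum_distrib_left[symmetric])
    next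
      case False
      then have "(\<Sum>s<N. M r j * (of_bool (pv j = s) * x s)) = 0" by (intro sum.neutral) auto
      then show ?thesis using False by simp
    qed
  qed
  finally show ?thesis by (simp add: apply_pivots_def)
qed

lemma eliminates_reduces:
  assumes "reduces N {..<N} (A, pv0, {}) (M, pv, U)"
  shows "eliminates N A (pivots_mat N (M, pv, U)) U"
proof -
  define T where "T = pivots_mat N (M, pv, U)"
  note R = assms[unfolded reduces_def, simplified]
  have U: "U = {r. r < N \<and> r \<in> pv ` {..<N}}" using R by auto
  have TA: "mat_mul N T A r j = apply_pivots N M pv {..<N} (\<lambda>r. A r j) r" if "r < N" for r j
    using mat_vec_pivots_mat[OF that, of M pv U "\<lambda>r. A r j"] by (simp add: mat_vec_col T_def)
  have "x r = 0" if *: "\<And>r. r < N \<Longrightarrow> mat_vec N T x r = 0" and "r < N" for x r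
  proof -
    \<comment> \<open>Injectivity is known for functions on all natural numbers, but the hypothesis
      controls the image only below \<open>N\<close>. Beyond \<open>N\<close> the argument is
      changed such that the image vanishes there too; the map reads only pivots below
      \<open>N\<close>, so nothing else changes.\<close>
    define x' where "x' = (\<lambda>r. if r < N then x r else apply_pivots N M pv {..<N} x r + x r)"
    have "apply_pivots N M pv {..<N} x' = (\<lambda>_. 0)"
    proof
      fix r
      have "apply_pivots N M pv {..<N} x' r = x' r + (apply_pivots N M pv {..<N} x r + x r)"
        by (simp add: apply_pivots_def x'_def cong: if_cong)
      then show "apply_pivots N M pv {..<N} x' r = 0"
        using *[of r] mat_vec_pivots_mat[of r N M pv U x] by (auto simp: x'_def T_def)
    qed
    also have "\<dots> = apply_pivots N M pv {..<N} (\<lambda>_. 0)" by (simp add: apply_pivots_def cong: if_cong)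
    finally have "x' = (\<lambda>_. 0)" using R by (auto dest!: injD)
    then have "x' r = 0" by simp
    then show ?thesis using \<open>r < N\<close> by (simp add: x'_def)
  qed
  then have inv: "\<exists>R. \<forall>r<N. \<forall>c<N. mat_mul N T R r c = of_bool (r = c) \<and> mat_mul N R T r c = of_bool (r = c)"
    using injective_matrix_inverse[of N T] by blast
  show ?thesis
    unfolding eliminates_def T_def[symmetric]
  proof (intro conjI inv allI impI ballI)
    show "U \<subseteq> {..<N}" using U by auto
  next
    fix i r assume "i < N" "i \<notin> U" "r < N"
    then show "T r i = of_bool (r = i)" unfolding T_def by (intro pivots_mat_no_pivot) (auto simp: U)
  next
    fix i assume "i \<in> U"
    then obtain j where j: "j < N" "i = pv j" "i < N" using U by auto
    then show "\<exists>j<N. \<forall>r<N. mat_mul N T A r j = of_bool (r = i)"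
      using R by (intro exI[of _ j]) (auto simp: TA)
  next
    fix r j assume r: "r < N" "r \<notin> U" "j < N"
    then show "mat_mul N T A r j = 0"
      using R U by (cases "pv j < N") (auto simp: TA)
  qed
qed

lemma eliminates_injD:
  assumes "eliminates N A T P" "\<And>r. r < N \<Longrightarrow> mat_vec N T x r = mat_vec N T y r" "r < N"
  shows "x r = y r"
proof -
  obtain R where R: "\<forall>r<N. \<forall>c<N. mat_mul N R T r c = of_bool (r = c)"
    using eliminates_inverse[OF assms(1)] ..
  have *: "mat_vec N (mat_mul N R T) x r = x r" for x
  proof -
    have "mat_vec N (mat_mul N R T) x r = (\<Sum>s<N. of_bool (r = s) * x s)"
      unfolding mat_vec_def using R assms(3) by (intro sum.cong) auto
    then show ?thesis using sum_of_bool_mult(1)[OF assms(3)] by simp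
  qed
  have "mat_vec N R (mat_vec N T x) r = mat_vec N R (mat_vec N T y) r" by (rule mat_vec_cong) (simp_all add: assms(2))
  then show ?thesis by (simp add: mat_vec_assoc *)
qed

lemma eliminates_fix:
  assumes "eliminates N A T P" "\<And>r. r \<in> P \<Longrightarrow> x r = 0" "r < N"
  shows "mat_vec N T x r = x r"
proof -
  have "mat_vec N T x r = (\<Sum>s<N. of_bool (r = s) * x s)"
    unfolding mat_vec_def
  proof (rule sum.cong[OF refl])
    fix s assume "s \<in> {..<N}"
    then show "T r s * x s = of_bool (r = s) * x s"
      using assms(2)[of s] eliminates_unit[OF assms(1), of s r] assms(3) by (cases "s \<in> P") simp_all
  qed
  then show ?thesis using sum_of_bool_mult(1)[OF assms(3)] by simp
qed

text \<open>The column space of \<open>A\<close> is cut out by the rows of \<open>T\<close> outside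
  \<open>P\<close>. If these annihilate \<open>x\<close>, then T x is supported in \<open>P\<close>,
  each unit vector e_i with i in \<open>P\<close> is a column of T A, and T is injective.\<close>

lemma eliminates_solve:
  assumes "eliminates N A T P" "\<And>r. r < N \<Longrightarrow> r \<notin> P \<Longrightarrow> mat_vec N T x r = 0"
  shows "\<exists>w. \<forall>r<N. x r = mat_vec N A w r"
proof -
  obtain j where j: "\<And>i. i \<in> P \<Longrightarrow> j i < N" "\<And>i r. i \<in> P \<Longrightarrow> r < N \<Longrightarrow> mat_mul N T A r (j i) = of_bool (r = i)"
    using eliminates_pivot[OF assms(1)] by metis
  have P: "P \<subseteq> {..<N}" "finite P" using eliminates_subset[OF assms(1)] finite_subset[of P] by auto
  define w where "w = (\<lambda>s. \<Sum>i\<in>P. of_bool (s = j i) * mat_vec N T x i)"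
  have 1: "mat_vec N T (mat_vec N A w) r = mat_vec N T x r" if r: "r < N" for r
  proof -
    have "mat_vec N (mat_mul N T A) (\<lambda>s. of_bool (s = j i)) r = of_bool (r = i)" if "i \<in> P" for i
      unfolding mat_vec_def using sum_of_bool_mult(2)[OF j(1)[OF that], of "mat_mul N T A r"] j(2)[OF that r] by simp
    then have "mat_vec N T (mat_vec N A w) r = (\<Sum>i\<in>P. of_bool (r = i) * mat_vec N T x i)"
      by (simp add: mat_vec_assoc w_def mat_vec_sum)
    also have "\<dots> = (if r \<in> P then mat_vec N T x r else 0)"
    proof -
      have "(\<Sum>i\<in>P. of_bool (r = i) * mat_vec N T x i) = (\<Sum>i\<in>P. if i = r then mat_vec N T x i else 0)"
        by (rule sum.cong) auto
      then show ?thesis using P by simp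
    qed
    finally show ?thesis using assms(2)[OF r] by auto
  qed
  show ?thesis
    by (rule exI[of _ w]) (use eliminates_injD[OF assms(1), of x "mat_vec N A w"] 1 in auto)
qed

text \<open>Independence of the rows of \<open>A\<close> in \<open>P\<close>: values prescribed
  there extend to a vector of the column space.\<close>

lemma eliminates_rows_surj:
  assumes "eliminates N A T P"
  shows "\<exists>w. \<forall>r\<in>P. mat_vec N A w r = y r"
proof -
  note P = eliminates_subset[OF assms]
  \<comment> \<open>Outside \<open>P\<close> the entries repeat those of the transform of
    \<open>y\<close>. They are fixed by \<open>T\<close> and cancel it there, so
    \<open>eliminates_solve\<close> applies.\<close>
  define x where "x = (\<lambda>r. if r \<in> P then y r else mat_vec N T (\<lambda>r. if r \<in> P then y r else 0) r)"
  define u where "u = (\<lambda>r. if r \<in> P then 0 else x r)"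
  have "\<exists>w. \<forall>r<N. (if r \<in> P then y r else 0) + u r = mat_vec N A w r"
  proof (rule eliminates_solve[OF assms])
    fix r assume r: "r < N" "r \<notin> P"
    have "mat_vec N T u r = u r" using r by (intro eliminates_fix[OF assms]) (auto simp: u_def)
    then show "mat_vec N T (\<lambda>r. (if r \<in> P then y r else 0) + u r) r = 0"
      using r by (simp add: mat_vec_add) (simp add: u_def x_def)
  qed
  then obtain w where w: "\<And>r. r < N \<Longrightarrow> (if r \<in> P then y r else 0) + u r = mat_vec N A w r" by blast
  show ?thesis
  proof (rule exI[of _ w], rule ballI)
    fix r assume "r \<in> P"
    then show "mat_vec N A w r = y r" using w[of r] P by (auto simp: u_def)
  qed
qed

text \<open>The rows in \<open>P\<close> span all rows: if A w vanishes on \<open>P\<close>, then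
  \<open>T\<close> fixes it, and T A w vanishes outside \<open>P\<close>.\<close>

lemma eliminates_rows_kernel:
  assumes "eliminates N A T P" "\<forall>r\<in>P. mat_vec N A w r = 0" "r < N"
  shows "mat_vec N A w r = 0"
proof -
  have "mat_vec N A w r = mat_vec N T (mat_vec N A w) r"
    using assms by (intro eliminates_fix[OF assms(1), symmetric]) auto
  also have "\<dots> = 0" if "r \<notin> P"
  proof -
    have "mat_vec N (mat_mul N T A) w r = 0"
      unfolding mat_vec_def using eliminates_zero[OF assms(1,3) that] by (intro sum.neutral) auto
    then show ?thesis by (simp add: mat_vec_assoc)
  qed
  finally show ?thesis using assms(2) by blast
qed

text \<open>Entry (r, s) is the value of cocycle r, a row of \<open>T\<close>, on cycle s, a row of
  \<open>T'\<close> restricted to \<open>S\<close>. The restriction is needed because the left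
  kernel of \<open>D\<close> also contains the unit vectors of indices outside \<open>S\<close>.
  Pivot rows are zeroed instead of deleted, so that the size stays \<open>N\<close>.\<close>

definition pairing :: "nat \<Rightarrow> nat set \<Rightarrow> nat set \<Rightarrow> nat set \<Rightarrow> bmat \<Rightarrow> bmat \<Rightarrow> bmat" where
  "pairing N S P Q T T' = (\<lambda>r s. of_bool (r \<notin> P) * of_bool (s \<notin> Q) *
     (\<Sum>i<N. of_bool (i \<in> S) * T r i * T' s i))"

text \<open>In the application, the columns of \<open>C\<close> are the boundaries of simplices, and \<open>D\<close> is the
  transposed matrix of the boundary operator.\<close>

lemma cohomology_basis:
  fixes D C :: bmat and S :: "nat set"
  assumes C: "eliminates N C T P" "\<And>r c. r < N \<Longrightarrow> r \<notin> S \<Longrightarrow> c < N \<Longrightarrow> C r c = 0"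
    and D: "eliminates N D T' Q" "\<And>r c. r < N \<Longrightarrow> r \<notin> S \<Longrightarrow> c < N \<Longrightarrow> D r c = 0"
    and H: "eliminates N (pairing N S P Q T T') T'' B"
  defines "Z \<equiv> {z. (\<forall>r<N. r \<notin> S \<longrightarrow> z r = 0) \<and> (\<forall>c<N. (\<Sum>r<N. z r * D r c) = 0)}"
  shows "\<exists>z\<in>Z. \<forall>r\<in>B. mat_vec N T z r = y r"
    and "z \<in> Z \<Longrightarrow> (\<forall>r\<in>B. mat_vec N T z r = 0) \<longleftrightarrow> (\<exists>w. \<forall>r<N. z r = mat_vec N C w r)"
proof -
  note B = eliminates_subset[OF H] eliminates_subset[OF D(1)]
  let ?H = "pairing N S P Q T T'"
  \<comment> \<open>The cycle with coefficients \<open>v\<close> with respect to the rows of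
    \<open>T'\<close> outside \<open>Q\<close>; its pairing with the cocycles is the product of
    \<open>?H\<close> and \<open>v\<close>.\<close>
  define z' where "z' v = (\<lambda>i. of_bool (i \<in> S) * (\<Sum>s<N. of_bool (s \<notin> Q) * v s * T' s i))" for v
  have z'Z: "z' v \<in> Z" for v
  proof -
    have "(\<Sum>r<N. z' v r * D r c) = 0" if "c < N" for c
    proof -
      have "(\<Sum>r<N. z' v r * D r c) = (\<Sum>r<N. \<Sum>s<N. of_bool (s \<notin> Q) * v s * (T' s r * D r c))"
      proof (rule sum.cong[OF refl])
        fix r assume "r \<in> {..<N}"
        then show "z' v r * D r c = (\<Sum>s<N. of_bool (s \<notin> Q) * v s * (T' s r * D r c))"
          using D(2)[of r c] that by (cases "r \<in> S") (auto simp: z'_def sum_distrib_right mult.assoc)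
      qed
      also have "\<dots> = (\<Sum>s<N. \<Sum>r<N. of_bool (s \<notin> Q) * v s * (T' s r * D r c))" by (rule sum.swap)
      also have "\<dots> = (\<Sum>s<N. of_bool (s \<notin> Q) * v s * mat_mul N T' D s c)"
        by (simp add: mat_mul_def sum_distrib_left)
      also have "\<dots> = 0" using eliminates_zero[OF D(1)] that by (intro sum.neutral) auto
      finally show ?thesis .
    qed
    then show ?thesis by (auto simp: Z_def z'_def)
  qed
  have Tz': "mat_vec N T (z' v) r = mat_vec N ?H v r" if "r \<notin> P" for v r
  proof -
    have "mat_vec N T (z' v) r = (\<Sum>i<N. \<Sum>s<N. of_bool (s \<notin> Q) * (of_bool (i \<in> S) * T r i * T' s i) * v s)"
      by (simp add: mat_vec_def z'_def sum_distrib_left mult_ac)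
    also have "\<dots> = (\<Sum>s<N. \<Sum>i<N. of_bool (s \<notin> Q) * (of_bool (i \<in> S) * T r i * T' s i) * v s)"
      by (rule sum.swap)
    also have "\<dots> = mat_vec N ?H v r"
      using that by (simp add: mat_vec_def pairing_def sum_distrib_left sum_distrib_right)
    finally show ?thesis .
  qed
  \<comment> \<open>The rows of \<open>?H\<close> in \<open>P\<close> are zero, whereas the selected
    rows are independent.\<close>
  have BP: "r \<notin> P" if "r \<in> B" for r
  proof
    assume "r \<in> P"
    then have 0: "mat_vec N (pairing N S P Q T T') w r = 0" for w by (simp add: mat_vec_def pairing_def)
    obtain w where "\<forall>r\<in>B. mat_vec N (pairing N S P Q T T') w r = 1"
      using eliminates_rows_surj[OF H, of "\<lambda>_. 1"] ..
    then show False using that 0[of w] by simp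
  qed
  show "\<exists>z\<in>Z. \<forall>r\<in>B. mat_vec N T z r = y r"
  proof -
    obtain w where "\<forall>r\<in>B. mat_vec N ?H w r = y r" using eliminates_rows_surj[OF H] by blast
    then show ?thesis using Tz' BP by (intro bexI[OF _ z'Z[of w]]) auto
  qed
  show "(\<forall>r\<in>B. mat_vec N T z r = 0) \<longleftrightarrow> (\<exists>w. \<forall>r<N. z r = mat_vec N C w r)" if z: "z \<in> Z"
  proof
    assume "\<exists>w. \<forall>r<N. z r = mat_vec N C w r"
    then obtain w where w: "\<And>r. r < N \<Longrightarrow> z r = mat_vec N C w r" by blast
    show "\<forall>r\<in>B. mat_vec N T z r = 0"
    proof
      fix r assume r: "r \<in> B"
      have "mat_vec N T z r = mat_vec N T (mat_vec N C w) r" by (rule mat_vec_cong) (simp_all add: w)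
      also have "\<dots> = mat_vec N (mat_mul N T C) w r" by (simp add: mat_vec_assoc)
      also have "\<dots> = 0" unfolding mat_vec_def[of N "mat_mul N T C"]
        using eliminates_zero[OF C(1)] BP[OF r] r B by (intro sum.neutral) auto
      finally show "mat_vec N T z r = 0" .
    qed
  next
    assume *: "\<forall>r\<in>B. mat_vec N T z r = 0"
    obtain R where R: "\<And>r c. r < N \<Longrightarrow> c < N \<Longrightarrow> mat_mul N R T' r c = of_bool (r = c)"
      using eliminates_inverse[OF D(1)] by blast
    \<comment> \<open>The coordinates of \<open>z\<close> with respect to all rows of
      \<open>T'\<close>, obtained from the inverse: z = z R T' = v T'.\<close>
    define v where "v = (\<lambda>s. \<Sum>r<N. z r * R r s)"
    have vT: "(\<Sum>s<N. v s * T' s i) = z i" if "i < N" for i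
    proof -
      have "(\<Sum>s<N. v s * T' s i) = (\<Sum>s<N. \<Sum>r<N. z r * (R r s * T' s i))"
        by (simp add: v_def sum_distrib_right mult.assoc)
      also have "\<dots> = (\<Sum>r<N. \<Sum>s<N. z r * (R r s * T' s i))" by (rule sum.swap)
      also have "\<dots> = (\<Sum>r<N. z r * mat_mul N R T' r i)" by (simp add: mat_mul_def sum_distrib_left)
      also have "\<dots> = (\<Sum>r<N. z r * of_bool (r = i))" using R that by (intro sum.cong) auto
      also have "\<dots> = z i" using that by (rule sum_of_bool_mult)
      finally show ?thesis .
    qed
    \<comment> \<open>Some column j of T' D is the unit vector e_i, so the equation v T' D = z D = 0
      has v_i as its entry j. Hence only rows outside \<open>Q\<close> contribute to
      \<open>z\<close>.\<close>
    have vQ: "v i = 0" if i: "i \<in> Q" for i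
    proof -
      obtain j where j: "j < N" "\<And>r. r < N \<Longrightarrow> mat_mul N T' D r j = of_bool (r = i)"
        using eliminates_pivot[OF D(1) i] by blast
      have "(\<Sum>r<N. z r * D r j) = (\<Sum>r<N. \<Sum>s<N. v s * (T' s r * D r j))"
        using vT by (intro sum.cong) (auto simp: sum_distrib_right[symmetric] mult.assoc[symmetric])
      also have "\<dots> = (\<Sum>s<N. \<Sum>r<N. v s * (T' s r * D r j))" by (rule sum.swap)
      also have "\<dots> = (\<Sum>s<N. v s * mat_mul N T' D s j)" by (simp add: mat_mul_def sum_distrib_left)
      also have "\<dots> = (\<Sum>s<N. v s * of_bool (s = i))" using j by (intro sum.cong) auto
      also have "\<dots> = v i" using i B by (intro sum_of_bool_mult) auto
      finally show ?thesis using z j by (simp add: Z_def)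
    qed
    have zv: "z i = z' v i" if "i < N" for i
    proof (cases "i \<in> S")
      case True
      have "(\<Sum>s<N. of_bool (s \<notin> Q) * v s * T' s i) = (\<Sum>s<N. v s * T' s i)"
        using vQ by (intro sum.cong) auto
      then show ?thesis using vT[OF that] True by (simp add: z'_def)
    qed (use z that in \<open>simp add: Z_def z'_def\<close>)
    have Tz: "mat_vec N T z r = mat_vec N T (z' v) r" for r by (rule mat_vec_cong) (simp_all add: zv)
    \<comment> \<open>The selected rows span all rows of \<open>?H\<close>, so every cocycle
      vanishes on \<open>z\<close>, and \<open>eliminates_solve\<close> turns this into a bounding
      chain.\<close>
    have "mat_vec N ?H v r = 0" if "r < N" for r
    proof (rule eliminates_rows_kernel[OF H _ that])
      show "\<forall>r\<in>B. mat_vec N ?H v r = 0" using * BP Tz Tz' by auto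
    qed
    then show "\<exists>w. \<forall>r<N. z r = mat_vec N C w r"
      using Tz Tz' by (intro eliminates_solve[OF C(1)]) auto
  qed
qed

section \<open>Elimination on the word RAM\<close>

abbreviation plus_expr (infixl "\<^bold>+" 65) where "e \<^bold>+ e' \<equiv> Op PLUS e e'"
abbreviation minus_expr (infixl "\<^bold>-" 65) where "e \<^bold>- e' \<equiv> Op MINUS e e'"
abbreviation times_expr (infixl "\<^bold>*" 70) where "e \<^bold>* e' \<equiv> Op TIMES e e'"
abbreviation div_expr (infixl "\<^bold>div" 70) where "e \<^bold>div e' \<equiv> Op DIV e e'"
abbreviation mod_expr (infixl "\<^bold>mod" 70) where "e \<^bold>mod e' \<equiv> Op MOD e e'"
abbreviation less_expr (infix "\<^bold><" 50) where "e \<^bold>< e' \<equiv> Op LESS e e'"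
abbreviation eq_expr (infix "\<^bold>=" 50) where "e \<^bold>= e' \<equiv> Op EQUAL e e'"

lemma runs_to_bounded: "runs W P s t (\<lambda>s'. s' = s1) \<Longrightarrow> bounded W s1"
  by (auto simp: runs_def)

lemma runs_Seq_to: "runs W P s t (\<lambda>s'. s' = s1) \<Longrightarrow> runs W Q s1 t' R \<Longrightarrow> runs W (Seq P Q) s (t + t') R"
  by (rule runs_Seq[OF _ order_refl], erule runs_mono) auto

lemma index_less: "i < m \<Longrightarrow> j < (k::nat) \<Longrightarrow> i * k + j < m * k"
proof -
  assume "i < m" "j < k"
  then have "Suc i * k \<le> m * k" by (intro mult_le_mono1) simp
  then show ?thesis using \<open>j < k\<close> by simp
qed

lemma index_div_mod: "j < (k::nat) \<Longrightarrow> (i * k + j) div k = i \<and> (i * k + j) mod k = j"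
  by simp

lemma filled_index: "i < m \<Longrightarrow> j < k \<Longrightarrow> n = m * k \<Longrightarrow> filled h 0 n f (i * k + j) = f (i * k + j)"
  using index_less[of i m j k] by (simp add: filled_def)

lemma div_less_sq: "x < k * k \<Longrightarrow> x div k < (k::nat) \<and> x mod k < k"
  by (metis less_mult_imp_div_less mod_less_divisor mult_0_right not_gr_zero not_less_zero)

definition bit_nat :: "bit \<Rightarrow> nat" where "bit_nat x = of_bool (x = 1)"

lemma bit_nat_simps [simp]: "bit_nat 0 = 0" "bit_nat 1 = 1" "bit_nat (of_bool P) = of_bool P" "bit_nat x \<le> 1" "bit_nat x = 0 \<longleftrightarrow> x = 0"
  by (cases x; auto simp: bit_nat_def)+

lemma bit_nat_less [simp]: "1 < W \<Longrightarrow> bit_nat x < W"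
  using bit_nat_simps(4)[of x] by linarith

lemma bit_nat_add: "(bit_nat x + bit_nat y) mod 2 = bit_nat (x + y)"
  by (cases x; cases y) auto

lemma bit_nat_mult: "bit_nat (x * y) = bit_nat x * bit_nat y"
  by (cases x; cases y) auto

text \<open>Column-major order, because blocks of adjacent columns are then contiguous. The
  multiplication program expects rows.\<close>

definition holds :: "nat \<Rightarrow> (nat \<Rightarrow> nat) \<Rightarrow> bmat \<Rightarrow> bool" where
  "holds N h M \<longleftrightarrow> (\<forall>r<N. \<forall>c<N. h (c * N + r) = bit_nat (M r c))"

text \<open>Arrays 0 to 4 carry the input and output of both problems, so everything from
  \<open>b + 5\<close> on is out of reach of \<open>Pm\<close>. Correctness holds for arbitrary
  contents of the remaining cells; therefore \<open>Pm\<close> can be called again on the memory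
  that an earlier call has left behind.\<close>

locale multiplication =
  fixes Pm :: program and b :: nat and Tm Bm :: "nat \<Rightarrow> nat"
  assumes written: "a \<in> written Pm \<Longrightarrow> a < b + 5"
    and correct: "A \<in> carrier_mat k k \<Longrightarrow> B \<in> carrier_mat k k \<Longrightarrow> Bm k \<le> W \<Longrightarrow> bounded W s \<Longrightarrow>
      multiplication_input (k, A, B) s \<Longrightarrow>
      \<exists>t s'. exec W Pm s t s' \<and> t \<le> Tm k \<and> multiplication_output (k, A, B) s'"
begin

lemma runs_mult:
  assumes "Bm k \<le> W" "bounded W s" "s 0 0 = k"
    and A: "\<And>i j. i < k \<Longrightarrow> j < k \<Longrightarrow> s 1 (i * k + j) = bit_nat (A i j)"
    and B: "\<And>i j. i < k \<Longrightarrow> j < k \<Longrightarrow> s 2 (i * k + j) = bit_nat (B i j)"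
  shows "runs W Pm s (Tm k) (\<lambda>s'. (\<forall>a\<ge>b + 5. s' a = s a) \<and>
     (\<forall>i<k. \<forall>j<k. s' 3 (i * k + j) = bit_nat (mat_mul k A B i j)))"
proof -
  define A' where "A' = mat k k (\<lambda>(i, j). A i j)"
  define B' where "B' = mat k k (\<lambda>(i, j). B i j)"
  have "multiplication_input (k, A', B') s"
    using assms by (auto simp: multiplication_input_def stores_matrix_def A'_def B'_def bit_nat_def)
  then obtain t s' where *: "exec W Pm s t s'" "t \<le> Tm k" "multiplication_output (k, A', B') s'"
    using correct[of A' k B' W s] assms by (auto simp: A'_def B'_def)
  have "s' 3 (i * k + j) = bit_nat (mat_mul k A B i j)" if "i < k" "j < k" for i j
  proof -
    have "(A' * B') $$ (i, j) = mat_mul k A B i j"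
      using that by (auto simp: A'_def B'_def scalar_prod_def mat_mul_def atLeast0LessThan intro!: sum.cong)
    then show ?thesis using *(3) that by (simp add: multiplication_output_def stores_matrix_def bit_nat_def)
  qed
  moreover have "s' a = s a" if "a \<ge> b + 5" for a
    using exec_not_written[OF *(1)] written[of a] that by force
  ultimately show ?thesis unfolding runs_def using * exec_bounded[OF *(1) assms(2)] by blast
qed

text \<open>Arrays below \<open>b + 5\<close> belong to the multiplication program. A larger number means that
  fewer of the subroutines below change the array.\<close>

abbreviation "vX \<equiv> b + 5"
abbreviation "vQ \<equiv> b + 6"
abbreviation "aR \<equiv> b + 7"
abbreviation "aG \<equiv> b + 8"
abbreviation "aM \<equiv> b + 9"
abbreviation "vSrc \<equiv> b + 10"
abbreviation "vDst \<equiv> b + 11"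
abbreviation "vK \<equiv> b + 12"
abbreviation "vJ \<equiv> b + 13"
abbreviation "aPV \<equiv> b + 14"
abbreviation "aUS \<equiv> b + 15"
abbreviation "vPR \<equiv> b + 16"
abbreviation "vN \<equiv> b + 20"

section \<open>One square block of the product of an N x k and a k x k matrix\<close>

definition left_prog :: program where
  "left_prog = Fill vX 1 (Const 0) (V vK \<^bold>* V vK)
     (Cell aM ((V vSrc \<^bold>+ (V vX \<^bold>mod V vK)) \<^bold>* V vN \<^bold>+ (V vQ \<^bold>* V vK \<^bold>+ (V vX \<^bold>div V vK))))"

definition right_prog :: program where
  "right_prog = Fill vX 2 (Const 0) (V vK \<^bold>* V vK) (Cell aG (V vX))"

definition product_prog :: program where
  "product_prog = Fill vX aR (V vQ \<^bold>* V vK \<^bold>* V vK) (V vK \<^bold>* V vK) (Cell 3 (V vX))"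

definition block_prog :: program where
  "block_prog =
     Seq (Assign 0 (Const 0) (V vK)) (Seq left_prog (Seq right_prog (Seq Pm product_prog)))"

lemma runs_block:
  assumes W: "1 < W" "N * N + N < W" "Bm k \<le> W" and s: "bounded W s"
    and vars: "s vN 0 = N" "s vK 0 = k" "s vQ 0 = q" "s vSrc 0 = src"
    and le: "q * k + k \<le> N" "src + k \<le> N"
    and M: "holds N (s aM) M"
    and G: "\<And>i j. i < k \<Longrightarrow> j < k \<Longrightarrow> s aG (i * k + j) = bit_nat (G i j)"
  shows "runs W block_prog s (300 * (k * k) + Tm k + 300)
     (\<lambda>s'. (\<forall>a\<ge>b + 8. s' a = s a) \<and> s' vQ = s vQ \<and>
        s' aR = filled (s aR) (q * k * k) (k * k) (\<lambda>x. bit_nat (mat_mul k (\<lambda>r i. M r (src + i)) G (q * k + x div k) (x mod k))))"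
proof -
  define R where "R = (\<lambda>x. mat_mul k (\<lambda>r i. M r (src + i)) G (q * k + x div k) (x mod k))"
  define A where "A = (\<lambda>i j. M (q * k + i) (src + j))"
  have kN: "k \<le> N" using le by simp
  then have kk: "k * k \<le> N * N" by (intro mult_le_mono)
  have qk: "q * k \<le> N" using le by simp
  have qkk: "q * k * k \<le> N * N" using qk kN by (intro mult_le_mono)
  have qkk2: "q * k * k + k * k \<le> N * N"
    using mult_le_mono[OF le(1) kN] by (simp add: add_mult_distrib)
  define s1 where "s1 = s(0 := (s 0)(0 := k))"
  define s2 where "s2 = s1(vX := (s1 vX)(0 := k * k), 1 := filled (s1 1) 0 (k * k) (\<lambda>x. bit_nat (A (x div k) (x mod k))))"
  define s3 where "s3 = s2(vX := (s2 vX)(0 := k * k), 2 := filled (s2 2) 0 (k * k) (\<lambda>x. bit_nat (G (x div k) (x mod k))))"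
  have r1: "runs W (Assign 0 (Const 0) (V vK)) s 5 (\<lambda>s'. s' = s1)"
    using s W by (intro runs_Assign) (auto simp: vars s1_def)
  note b1 = runs_to_bounded[OF r1]
  have r2: "runs W left_prog
     s1 ((k * k + 1) * 60) (\<lambda>s'. s' = s2)"
    unfolding s2_def left_prog_def
  proof (rule runs_Fill[OF W(1) b1, where n = "k * k" and d = 0 and f = "\<lambda>x. bit_nat (A (x div k) (x mod k))"], goal_cases)
    case (4 i h)
    note i = 4(1)
    have dm: "i div k < k" "i mod k < k" using div_less_sq[OF i] by auto
    have r: "q * k + i div k < N" and c: "src + i mod k < N" using dm le by linarith+
    have *: "(src + i mod k) * N + (q * k + i div k) < N * N" by (rule index_less) fact+
    have "s aM ((src + i mod k) * N + (q * k + i div k)) = bit_nat (A (i div k) (i mod k))"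
      using M r c by (simp add: holds_def A_def)
    then show ?case
      using W i kk r c * by (simp add: s1_def vars)
  qed (use W kk in \<open>auto simp: s1_def vars\<close>)
  note b2 = runs_to_bounded[OF r2]
  have r3: "runs W right_prog s2 ((k * k + 1) * 60) (\<lambda>s'. s' = s3)"
    unfolding s3_def right_prog_def
  proof (rule runs_Fill[OF W(1) b2, where n = "k * k" and d = 0 and f = "\<lambda>x. bit_nat (G (x div k) (x mod k))"], goal_cases)
    case (4 i h)
    note i = 4(1)
    have dm: "i div k < k" "i mod k < k" using div_less_sq[OF i] by auto
    then have "s aG i = bit_nat (G (i div k) (i mod k))" using G[OF dm] by simp
    then show ?case
      using W i kk by (simp add: s1_def s2_def)
  qed (use W kk in \<open>auto simp: s1_def s2_def vars\<close>)
  note b3 = runs_to_bounded[OF r3]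
  have r4: "runs W Pm s3 (Tm k) (\<lambda>s'. (\<forall>a\<ge>b + 5. s' a = s3 a) \<and>
     (\<forall>i<k. \<forall>j<k. s' 3 (i * k + j) = bit_nat (mat_mul k A G i j)))"
    by (rule runs_mult) (use W b3 in \<open>auto simp: s1_def s2_def s3_def vars filled_index\<close>)
  have r5: "runs W product_prog s4 ((k * k + 1) * 60)
     (\<lambda>s'. (\<forall>a\<ge>b + 8. s' a = s a) \<and> s' vQ = s vQ \<and>
        s' aR = filled (s aR) (q * k * k) (k * k) (\<lambda>x. bit_nat (R x)))"
    if b4: "bounded W s4" and 6: "(\<forall>a\<ge>b + 5. s4 a = s3 a) \<and> (\<forall>i<k. \<forall>j<k. s4 3 (i * k + j) = bit_nat (mat_mul k A G i j))" for s4
  proof -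
    have s4: "\<And>a. a \<ge> b + 5 \<Longrightarrow> s4 a = s3 a" using 6 by blast
    have v: "s4 vK 0 = k" "s4 vQ 0 = q" by (simp_all add: s4 s3_def s2_def s1_def vars)
    have prod: "s4 3 i = bit_nat (mat_mul k A G (i div k) (i mod k))" if "i < k * k" for i
    proof -
      have "s4 3 (i div k * k + i mod k) = bit_nat (mat_mul k A G (i div k) (i mod k))"
        using 6 div_less_sq[OF that] by blast
      then show ?thesis by simp
    qed
    have AG: "mat_mul k A G i j = mat_mul k (\<lambda>r i. M r (src + i)) G (q * k + i) j" for i j
      by (simp add: mat_mul_def A_def)
    show ?thesis
      unfolding product_prog_def
    proof (rule runs_Fill[OF W(1) b4, where n = "k * k" and d = "q * k * k" and f = "\<lambda>x. bit_nat (R x)"], goal_cases)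
      case (4 i h)
      then show ?case using W qk qkk qkk2 prod[OF 4(1)] AG by (simp add: v R_def)
    next
      case 5
      show ?case by (auto simp: s4 s3_def s2_def s1_def)
    qed (use W kk in \<open>auto simp: v\<close>)
  qed
  have "runs W block_prog s (5 + ((k*k+1)*60 + ((k*k+1)*60 + (Tm k + (k*k+1)*60))))
     (\<lambda>s'. (\<forall>a\<ge>b + 8. s' a = s a) \<and> s' vQ = s vQ \<and>
        s' aR = filled (s aR) (q * k * k) (k * k) (\<lambda>x. bit_nat (R x)))"
    unfolding block_prog_def
    by (intro runs_Seq_to[OF r1] runs_Seq_to[OF r2] runs_Seq_to[OF r3])
      (rule runs_Seq_mid[OF r4 r5 order_refl])
  then show ?thesis unfolding R_def by (rule runs_mono) auto
qed

section \<open>Application of the map of a block of pivots to a block of columns\<close>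

definition represents :: "nat \<Rightarrow> memory \<Rightarrow> estate \<Rightarrow> bool" where
  "represents N s = (\<lambda>(M, pv, U). s vN 0 = N \<and> holds N (s aM) M \<and> (\<forall>j<N. s aPV j = pv j \<and> pv j \<le> N) \<and>
     (\<forall>r<N. s aUS r = of_bool (r \<in> U)))"

abbreviation "gathered_row \<equiv> Cell aPV (V vSrc \<^bold>+ (V vX \<^bold>div V vK))"

text \<open>Copies the pivot rows of the destination before they change. Expressions cannot branch:
  without pivot the row number is \<open>N\<close>, and the cell read there is annihilated by the
  factor 0. Its address is at most N * N; for this bound \<open>represents\<close> includes
  \<open>pv j \<le> N\<close>.\<close>

definition gather_prog :: program where
  "gather_prog = Fill vX aG (Const 0) (V vK \<^bold>* V vK)
     ((gathered_row \<^bold>< V vN) \<^bold>* Cell aM ((V vDst \<^bold>+ (V vX \<^bold>mod V vK)) \<^bold>* V vN \<^bold>+ gathered_row))"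

definition add_prog :: program where
  "add_prog = Fill vX aM (V vDst \<^bold>* V vN) (V vK \<^bold>* V vN)
     ((Cell aM (V vDst \<^bold>* V vN \<^bold>+ V vX) \<^bold>+ Cell aR ((V vX \<^bold>mod V vN) \<^bold>* V vK \<^bold>+ (V vX \<^bold>div V vN))) \<^bold>mod Const 2)"

definition transform_prog :: program where
  "transform_prog = Seq gather_prog (Seq (For vQ (V vN \<^bold>div V vK) block_prog) add_prog)"

definition transform_time :: "nat \<Rightarrow> nat \<Rightarrow> nat" where
  "transform_time N k = 2000 * (N * k) + (N div k) * Tm k"

text \<open>With N = q k there are q block products, and every copying term is at most a multiple of
  q k k = N k.\<close>

lemma transform_time_bound:
  assumes "k dvd N" "0 < k" "0 < N"
  shows "(k * k + 1) * 100 + ((N div k) * (300 * (k * k) + Tm k + 300) + (N div k + 1) * 30 + (k * N + 1) * 100) \<le> transform_time N k"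
proof -
  obtain q where N: "N = q * k" using assms(1) by (metis dvdE mult.commute)
  have q: "0 < q" "N div k = q" using assms N by auto
  have 1: "k * k \<le> q * k * k" using q by simp
  have 2: "q \<le> q * k * k" using assms by simp
  have 3: "1 \<le> q * k * k" using assms q by simp
  have 4: "N * k = q * k * k" "k * N = q * k * k" using N by auto
  have 5: "q * (300 * (k * k) + Tm k + 300) = 300 * (q * k * k) + q * Tm k + 300 * q"
    by (simp add: algebra_simps)
  have "(a + 1) * 100 + (300 * P + T + 300 * q + (q + 1) * 30 + (P + 1) * 100) \<le> 2000 * P + T"
    if "a \<le> P" "q \<le> P" "1 \<le> P" for a P T :: nat
    using that by simp
  from this[OF 1 2 3] show ?thesis unfolding transform_time_def 4 q 5 .
qed

lemma apply_pivots_transform: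
  "apply_pivots N M pv {src..<src + k} (\<lambda>r. M r c) r =
     M r c + mat_mul k (\<lambda>r i. M r (src + i)) (\<lambda>i c. if pv (src + i) < N then M (pv (src + i)) c else 0) r c"
proof -
  have "(\<Sum>j\<in>{src..<src + k}. M r j * (if pv j < N then M (pv j) c else 0)) =
    (\<Sum>i<k. M r (src + i) * (if pv (src + i) < N then M (pv (src + i)) c else 0))"
    using sum.atLeastLessThan_shift_0[of "\<lambda>j. M r j * (if pv j < N then M (pv j) c else 0)" src "src + k"]
    by (simp add: o_def atLeast0LessThan)
  then show ?thesis by (simp add: apply_pivots_def mat_mul_def)
qed

lemma runs_transform:
  assumes W: "10 < W" "N * N + N < W" "Bm k \<le> W" and s: "bounded W s"
    and represents: "represents N s st"
    and vars: "s vK 0 = k" "s vSrc 0 = src" "s vDst 0 = dst"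
    and le: "src + k \<le> N" "dst + k \<le> N" and k: "k dvd N" "0 < k"
  shows "runs W transform_prog s (transform_time N k)
     (\<lambda>s'. represents N s' (transform N src dst k st) \<and> (\<forall>a\<ge>b + 10. s' a = s a))"
proof -
  obtain M pv U where st: "st = (M, pv, U)" by (cases st) auto
  note rep' = represents[unfolded represents_def st prod.case]
  have vN: "s vN 0 = N" and M: "holds N (s aM) M" using rep' by auto
  obtain q where q: "N = q * k" using k by (metis dvdE mult.commute)
  have kN: "k \<le> N" "0 < N" using le k by auto
  have kk: "k * k \<le> N * N" "k * N \<le> N * N" using kN by (auto intro: mult_le_mono)
  have W1: "1 < W" and kNW: "k * N < W" using W kk(2) by linarith+
  have qN: "q \<le> N" using q k by simp
  define G where "G = (\<lambda>i c. if pv (src + i) < N then M (pv (src + i)) (dst + c) else 0)"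
  define R where "R = mat_mul k (\<lambda>r i. M r (src + i)) G"
  define s1 where "s1 = s(vX := (s vX)(0 := k * k), aG := filled (s aG) 0 (k * k) (\<lambda>x. bit_nat (G (x div k) (x mod k))))"
  have r1: "runs W gather_prog
     s ((k * k + 1) * 100) (\<lambda>s'. s' = s1)"
    unfolding s1_def gather_prog_def
  proof (rule runs_Fill[OF W1 s, where n = "k * k" and d = 0 and f = "\<lambda>x. bit_nat (G (x div k) (x mod k))"], goal_cases)
    case (4 i h)
    have dm: "i div k < k" "i mod k < k" using div_less_sq[OF 4(1)] by auto
    have r: "src + i div k < N" and c: "dst + i mod k < N" using dm le by linarith+
    then have pv: "s aPV (src + i div k) = pv (src + i div k)" "pv (src + i div k) \<le> N" using rep' by auto
    have *: "(dst + i mod k) * N + N \<le> N * N"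
      using mult_le_mono1[of "Suc (dst + i mod k)" N N] c by simp
    have "s aM ((dst + i mod k) * N + pv (src + i div k)) = bit_nat (M (pv (src + i div k)) (dst + i mod k))"
      if "pv (src + i div k) < N"
      using M that c by (simp add: holds_def)
    moreover have "s aM ((dst + i mod k) * N + pv (src + i div k)) < W" using s by (rule boundedD)
    moreover have "bit_nat (G (i div k) (i mod k)) = of_bool (pv (src + i div k) < N) * bit_nat (M (pv (src + i div k)) (dst + i mod k))"
      by (simp add: G_def)
    ultimately show ?case
      using W 4 kk r c * pv le_square[of N] by (simp add: vars vN)
  qed (use W kk in \<open>auto simp: vars vN\<close>)
  note b1 = runs_to_bounded[OF r1]
  define I where "I = (\<lambda>i s'. s' vQ 0 = i \<and> (\<forall>a\<ge>b + 8. s' a = s1 a) \<and>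
     (\<forall>r<i*k. \<forall>c<k. s' aR (r * k + c) = bit_nat (R r c)))"
  have r2: "runs W (For vQ (V vN \<^bold>div V vK) block_prog) s1
      ((N div k) * (300 * (k * k) + Tm k + 300) + (N div k + 1) * 30) (I q)"
  proof (rule runs_For[OF W1 b1, where n = q and I = I and t = "\<lambda>_. 300 * (k * k) + Tm k + 300"], goal_cases)
    case (4 i s')
    have eq: "\<And>a. a \<ge> b + 8 \<Longrightarrow> s' a = s1 a" using 4 by (simp add: I_def)
    have ik: "i * k + k \<le> N" using mult_le_mono1[of "Suc i" q k] 4 q by simp
    have "runs W block_prog s' (300 * (k * k) + Tm k + 300)
     (\<lambda>s''. (\<forall>a\<ge>b + 8. s'' a = s' a) \<and> s'' vQ = s' vQ \<and>
        s'' aR = filled (s' aR) (i * k * k) (k * k) (\<lambda>x. bit_nat (R (i * k + x div k) (x mod k))))"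
      unfolding R_def
    proof (rule runs_block[OF W1 W(2,3) 4(2) _ _ _ _ ik le(1)])
      show "s' vN 0 = N" "s' vK 0 = k" "s' vSrc 0 = src" "holds N (s' aM) M"
        using vN vars M by (simp_all add: eq s1_def)
      show "s' vQ 0 = i" using 4(3) by (simp add: I_def)
      show "s' aG (i * k + j) = bit_nat (G i j)" if "i < k" "j < k" for i j
        using that index_div_mod[OF that(2), of i] by (simp add: eq s1_def filled_index)
    qed
    then show ?case
    proof (rule runs_mono, goal_cases)
      case (2 t)
      have "t aR (r * k + c) = bit_nat (R r c)" if "r < Suc i * k" "c < k" for r c
      proof (cases "r < i * k")
        case True
        then have "r * k + c < i * k * k" using index_less[OF True that(2)] by simp
        then have "t aR (r * k + c) = s' aR (r * k + c)" using 2 by (simp add: filled_def)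
        then show ?thesis using 4(3) True that by (simp add: I_def)
      next
        case False
        define r' where "r' = r - i * k"
        have r': "r = i * k + r'" "r' < k" using False that by (auto simp: r'_def)
        have "r * k + c = i * k * k + (r' * k + c)" using r' by (simp add: algebra_simps)
        moreover have "r' * k + c < k * k" using index_less[OF r'(2) that(2)] .
        ultimately show ?thesis using 2 r' that by (simp add: filled_def)
      qed
      then show ?case using 2 4 by (auto simp: I_def)
    qed simp
  next
    case (3 i s')
    then show ?case using W1 q k by (auto simp: I_def s1_def vars vN)
  next
    case 6
    then show ?case using q k by simp
  qed (use W qN le_square[of N] in \<open>auto simp: I_def\<close>)
  define M' where "M' = fst (transform N src dst k (M, pv, U))"
  have M': "M' r (dst + c) = M r (dst + c) + R r c" if "c < k" for r c
    using that apply_pivots_transform[of N M pv src k "dst + c" r] by (simp add: M'_def R_def G_def mat_mul_def)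
  have M'2: "M' r c = M r c" if "\<not> (dst \<le> c \<and> c < dst + k)" for r c
    using that by (auto simp: M'_def)
  have r3: "runs W add_prog
      s2 ((k * N + 1) * 100) (\<lambda>s'. represents N s' (transform N src dst k st) \<and> (\<forall>a\<ge>b + 10. s' a = s a))"
    if b2: "bounded W s2" and I2: "I q s2" for s2
  proof -
    have eq: "\<And>a. a \<ge> b + 8 \<Longrightarrow> s2 a = s1 a" using I2 by (simp add: I_def)
    have v: "s2 vK 0 = k" "s2 vN 0 = N" "s2 vDst 0 = dst" "s2 aM = s aM"
      using vars vN by (simp_all add: eq s1_def)
    have dN: "dst * N + k * N \<le> N * N" using mult_le_mono1[OF le(2), of N] by (simp add: add_mult_distrib)
    show ?thesis
      unfolding add_prog_def
    proof (rule runs_Fill[OF W1 b2, where n = "k * N" and d = "dst * N"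
          and f = "\<lambda>x. bit_nat (M' (x mod N) (dst + x div N))"], goal_cases)
      case (4 i h)
      have i: "i div N < k" "i mod N < N" using 4 kN by (auto simp: less_mult_imp_div_less)
      have c: "dst + i div N < N" using i le by linarith
      have e1: "(dst + i div N) * N + i mod N = dst * N + i" by (simp add: add_mult_distrib)
      have m: "h (dst * N + i) = bit_nat (M (i mod N) (dst + i div N))"
        using 4(2) M[unfolded holds_def, rule_format, OF i(2) c] unfolding e1 v(4) by simp
      have r: "s2 aR (i mod N * k + i div N) = bit_nat (R (i mod N) (i div N))"
        using I2 i by (simp add: I_def q)
      have "bit_nat (M' (i mod N) (dst + i div N)) = (bit_nat (M (i mod N) (dst + i div N)) + bit_nat (R (i mod N) (i div N))) mod 2"
        unfolding M'[OF i(1)] by (rule bit_nat_add[symmetric])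
      moreover have "i mod N * k + i div N < N * N"
      proof -
        have "N * k \<le> N * N" using kN by simp
        then show ?thesis using index_less[OF i(2) i(1)] by linarith
      qed
      moreover have "bit_nat (M (i mod N) (dst + i div N)) + bit_nat (R (i mod N) (i div N)) < W"
        using bit_nat_simps(4)[of "M (i mod N) (dst + i div N)"] bit_nat_simps(4)[of "R (i mod N) (i div N)"] W
        by linarith
      ultimately show ?case using W 4(1) dN m r by (simp add: v)
    next
      case 5
      let ?f = "\<lambda>x. bit_nat (M' (x mod N) (dst + x div N))"
      have "filled (s aM) (dst * N) (k * N) ?f (c * N + r) = bit_nat (M' r c)" if rc: "r < N" "c < N" for r c
      proof (cases "dst \<le> c \<and> c < dst + k")
        case True
        then obtain c' where c': "c = dst + c'" "c' < k" using le_Suc_ex by fastforce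
        have e: "c * N + r = dst * N + (c' * N + r)" using c' by (simp add: add_mult_distrib)
        show ?thesis unfolding e using index_less[OF c'(2) rc(1)] rc c' by (simp add: filled_def)
      next
        case False
        have "\<not> (dst * N \<le> c * N + r \<and> c * N + r < dst * N + k * N)"
        proof (cases "c < dst")
          case True
          then show ?thesis using index_less[OF True rc(1)] by simp
        next
          case *: False
          then have "dst + k \<le> c" using False by simp
          then show ?thesis using mult_le_mono1[of "dst + k" c N] by (simp add: add_mult_distrib)
        qed
        then show ?thesis using M rc M'2[OF False, of r] by (auto simp: filled_def holds_def)
      qed
      then have "holds N (filled (s aM) (dst * N) (k * N) ?f) M'" by (simp add: holds_def)
      then show ?case using rep' eq vars
        by (auto simp: represents_def st v M'_def) (auto simp: s1_def)
    qed (use W kk kNW in \<open>auto simp: v\<close>)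
  qed
  have "runs W transform_prog s ((k * k + 1) * 100 + ((N div k) * (300 * (k * k) + Tm k + 300) + (N div k + 1) * 30 + (k * N + 1) * 100))
    (\<lambda>s'. represents N s' (transform N src dst k st) \<and> (\<forall>a\<ge>b + 10. s' a = s a))"
    unfolding transform_prog_def
    by (intro runs_Seq_to[OF r1]) (rule runs_Seq_mid[OF r2 r3 order_refl])
  then show ?thesis using transform_time_bound[OF k kN(2)] by (rule runs_mono) auto
qed

definition leaf_prog :: program where
  "leaf_prog =
     Seq (Assign vPR (Const 0) (V vN))
     (Seq (For vX (V vN) (Cond (Cell aUS (V vX) \<^bold>< Cell aM (V vJ \<^bold>* V vN \<^bold>+ V vX))
        (Assign vPR (Const 0) (V vX)) Skip))
     (Seq (Assign aPV (V vJ) (V vPR))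
     (Cond (V vPR \<^bold>< V vN)
        (Seq (Assign aUS (V vPR) (Const 1)) (Assign aM (V vJ \<^bold>* V vN \<^bold>+ V vPR) (Const 0))) Skip)))"

lemma runs_leaf:
  assumes W: "10 < W" "N * N + N < W" and s: "bounded W s"
    and represents: "represents N s st" and j: "s vJ 0 = j" "j < N"
  shows "runs W leaf_prog s (100 * N + 100)
     (\<lambda>s'. represents N s' (leaf N j st) \<and> s' vJ 0 = j \<and> (\<forall>a\<ge>b + 17. s' a = s a))"
proof -
  obtain M pv U where st: "st = (M, pv, U)" by (cases st) auto
  note rep' = represents[unfolded represents_def st prod.case]
  have vN: "s vN 0 = N" and M: "\<And>r c. r < N \<Longrightarrow> c < N \<Longrightarrow> s aM (c * N + r) = bit_nat (M r c)"
    and US: "\<And>r. r < N \<Longrightarrow> s aUS r = of_bool (r \<in> U)" using rep' by (auto simp: holds_def)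
  have W1: "1 < W" using W by simp
  define s1 where "s1 = s(vPR := (s vPR)(0 := N))"
  have r1: "runs W (Assign vPR (Const 0) (V vN)) s 10 (\<lambda>s'. s' = s1)"
    using s W by (intro runs_Assign) (auto simp: vN s1_def)
  note b1 = runs_to_bounded[OF r1]
  define I where "I = (\<lambda>i s'. s' = s(vX := (s vX)(0 := i), vPR := (s vPR)(0 := pivot N M U j i)))"
  have r2: "runs W (For vX (V vN) (Cond (Cell aUS (V vX) \<^bold>< Cell aM (V vJ \<^bold>* V vN \<^bold>+ V vX))
        (Assign vPR (Const 0) (V vX)) Skip)) s1 (60 * N + 40) (I N)"
  proof (rule runs_For[OF W1 b1, where n = N and I = I and t = "\<lambda>_. 30"], goal_cases)
    case (4 i s')
    have jN: "j * N + i < N * N" using index_less[OF j(2) 4(1)] .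
    have "j * N < W" using jN W by linarith
    moreover have "s aM (j * N + i) = bit_nat (M i j)" "s aUS i = of_bool (i \<in> U)"
      using M[OF 4(1) j(2)] US[OF 4(1)] by auto
    moreover have s': "s' = s(vX := (s vX)(0 := i), vPR := (s vPR)(0 := pivot N M U j i))" using 4 by (simp add: I_def)
    ultimately have *: "safe W s' (Cell aUS (V vX) \<^bold>< Cell aM (V vJ \<^bold>* V vN \<^bold>+ V vX))"
      "ev s' (Cell aUS (V vX) \<^bold>< Cell aM (V vJ \<^bold>* V vN \<^bold>+ V vX)) = of_bool (i \<notin> U \<and> M i j = 1)"
      using W jN j by (auto simp: vN bit_nat_def)
    show ?case
    proof (rule runs_Cond[OF 4(2) W1 *(1), where t = 10], goal_cases)
      case 1
      then show ?case unfolding *(2) using W 4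
        by (intro runs_Assign) (auto simp: I_def fun_eq_iff)
    next
      case 2
      then show ?case unfolding *(2) using W 4
        by (intro runs_Skip) (auto simp: I_def fun_eq_iff)
    qed simp
  qed (use W W1 in \<open>auto simp: I_def s1_def vN fun_eq_iff\<close>)
  define p where "p = pivot N M U j N"
  have pN: "p \<le> N" unfolding p_def by (rule pivot_le) simp
  define s2 where "s2 = s(vX := (s vX)(0 := N), vPR := (s vPR)(0 := p))"
  have r2': "runs W (For vX (V vN) (Cond (Cell aUS (V vX) \<^bold>< Cell aM (V vJ \<^bold>* V vN \<^bold>+ V vX))
        (Assign vPR (Const 0) (V vX)) Skip)) s1 (60 * N + 40) (\<lambda>s'. s' = s2)"
    using r2 by (rule runs_mono) (auto simp: I_def s2_def p_def)
  note b2 = runs_to_bounded[OF r2']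
  define s3 where "s3 = s2(aPV := (s2 aPV)(j := p))"
  have r3: "runs W (Assign aPV (V vJ) (V vPR)) s2 10 (\<lambda>s'. s' = s3)"
    using b2 W j by (intro runs_Assign) (auto simp: s2_def s3_def)
  note b3 = runs_to_bounded[OF r3]
  have jN: "j * N + p < N * N" if "p < N" using index_less[OF j(2) that] .
  have r4: "runs W (Cond (V vPR \<^bold>< V vN)
        (Seq (Assign aUS (V vPR) (Const 1)) (Assign aM (V vJ \<^bold>* V vN \<^bold>+ V vPR) (Const 0))) Skip) s3 40
     (\<lambda>s'. represents N s' (leaf N j st) \<and> s' vJ 0 = j \<and> (\<forall>a\<ge>b + 17. s' a = s a))"
  proof (rule runs_Cond[OF b3 W1, where t = 30], goal_cases)
    case 2
    then have p: "p < N" by (auto simp: s3_def s2_def vN)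
    define s4 where "s4 = s3(aUS := (s3 aUS)(p := 1))"
    have r: "runs W (Assign aUS (V vPR) (Const 1)) s3 10 (\<lambda>s'. s' = s4)"
      using b3 W by (intro runs_Assign) (auto simp: s4_def s2_def s3_def)
    note b4 = runs_to_bounded[OF r]
    have inj: "c * N + r = j * N + p \<longleftrightarrow> c = j \<and> r = p" if "r < N" for c r
      using that p by (metis index_div_mod)
    have jW: "j * N < W" using jN[OF p] W by linarith
    have "runs W (Assign aM (V vJ \<^bold>* V vN \<^bold>+ V vPR) (Const 0)) s4 20
       (\<lambda>s'. represents N s' (leaf N j st) \<and> s' vJ 0 = j \<and> (\<forall>a\<ge>b + 17. s' a = s a))"
      using b4 W jN[OF p] jW rep' p inj
      by (intro runs_Assign)
        (auto simp: s4_def s3_def s2_def vN j represents_def st p_def[symmetric] Let_def holds_def)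
    then show ?case by (rule runs_Seq_to[OF r, THEN runs_mono]) auto
  next
    case 3
    then have p: "\<not> p < N" by (auto simp: s3_def s2_def vN split: if_splits)
    then show ?case using b3 rep' pN j
      by (intro runs_Skip) (auto simp: s3_def s2_def vN represents_def st p_def[symmetric] Let_def holds_def)
  qed (use W in auto)
  have "runs W leaf_prog s (10 + ((60 * N + 40) + (10 + 40)))
     (\<lambda>s'. represents N s' (leaf N j st) \<and> s' vJ 0 = j \<and> (\<forall>a\<ge>b + 17. s' a = s a))"
    unfolding leaf_prog_def by (intro runs_Seq_to[OF r1] runs_Seq_to[OF r2'] runs_Seq_to[OF r3] r4)
  then show ?thesis by (rule runs_mono) auto
qed

section \<open>One column and the transformations that follow it\<close>

abbreviation "vJ1 \<equiv> V vJ \<^bold>+ Const 1"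

definition combine_prog :: program where
  "combine_prog = Seq (Assign vSrc (Const 0) (vJ1 \<^bold>- V vK))
     (Seq (Assign vDst (Const 0) (vJ1 \<^bold>- Const 2 \<^bold>* V vK))
     (Seq transform_prog (Assign vK (Const 0) (Const 2 \<^bold>* V vK))))"

definition update_prog :: program where
  "update_prog = Cond (vJ1 \<^bold>< V vN)
     (Seq (Assign vSrc (Const 0) (vJ1 \<^bold>- V vK)) (Seq (Assign vDst (Const 0) vJ1) transform_prog)) Skip"

text \<open>The multiplicity of 2 in j + 1 is not computed separately. The block size is doubled as
  long as its double divides j + 1; after the loop it is the size of the block to be passed
  on.\<close>

definition column_prog :: program where
  "column_prog =
     Seq leaf_prog
     (Seq (Assign vK (Const 0) (Const 1))
     (Seq (While (vJ1 \<^bold>mod (Const 2 \<^bold>* V vK) \<^bold>= Const 0) combine_prog)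
     update_prog))"

definition column_time :: "nat \<Rightarrow> nat \<Rightarrow> nat" where
  "column_time N J = 1000 * N + 2 * (\<Sum>w\<le>multiplicity 2 J. transform_time N (2^w))"

lemma transform_time_ge: "0 < N \<Longrightarrow> 0 < k \<Longrightarrow> 2000 \<le> transform_time N k"
proof -
  assume "0 < N" "0 < k"
  then have "1 \<le> N * k" by (simp add: Suc_leI)
  then show ?thesis unfolding transform_time_def by linarith
qed

lemma combine_Suc: "combine N J (Suc w) st = transform N (J - 2^w) (J - 2 * 2^w) (2^w) (combine N J w st)"
  by (simp add: combine_def)

lemma represents_upd: "x < b + 9 \<or> (b + 9 < x \<and> x < b + 14) \<Longrightarrow> represents N (s(x := h)) st = represents N s st"
  by (cases st) (auto simp: represents_def)

lemma runs_column:
  assumes W: "10 < W" "N * N + 4 * N < W" "\<And>k. k \<le> N \<Longrightarrow> Bm k \<le> W" and s: "bounded W s"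
    and N: "N = 2^v" and represents: "represents N s st" and j: "s vJ 0 = j" "j < N"
  shows "runs W column_prog s (column_time N (Suc j))
     (\<lambda>s'. represents N s' (step N j st) \<and> s' vJ 0 = j \<and> (\<forall>a\<ge>b + 17. s' a = s a))"
proof -
  define J where "J = Suc j"
  define m where "m = multiplicity 2 J"
  have N0: "0 < N" using N by simp
  have W1: "1 < W" and W2: "N * N + N < W" using W by auto
  have NW: "4 * N < W" using W(2) by linarith
  have J: "0 < J" "J \<le> N" using j by (auto simp: J_def)
  have dvd: "2 ^ w dvd J \<longleftrightarrow> w \<le> m" for w
    unfolding m_def using J(1) by (intro power_dvd_iff_le_multiplicity) auto
  have le: "(2::nat) ^ w \<le> J" if "w \<le> m" for w using that dvd[of w] J(1) dvd_imp_le by blast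
  have dN: "(2::nat) ^ w dvd N" if "w \<le> m" for w
  proof -
    have "(2::nat) ^ w \<le> 2 ^ v" using le[OF that] J N by linarith
    then have "w \<le> v" by simp
    then show ?thesis unfolding N by (rule le_imp_power_dvd)
  qed
  define st0 where "st0 = leaf N j st"
  define S where "S = (\<lambda>w s'. represents N s' (combine N J w st0) \<and> s' vJ 0 = j \<and> s' vK 0 = 2 ^ w \<and> (\<forall>a\<ge>b + 17. s' a = s a))"
  have r1: "runs W leaf_prog s (100 * N + 100) (\<lambda>s'. represents N s' st0 \<and> s' vJ 0 = j \<and> (\<forall>a\<ge>b + 17. s' a = s a))"
    unfolding st0_def using runs_leaf[OF W(1) W2 s represents j] .
  have r2: "runs W (Assign vK (Const 0) (Const 1)) s1 10 (S 0)"
    if "bounded W s1" "represents N s1 st0 \<and> s1 vJ 0 = j \<and> (\<forall>a\<ge>b + 17. s1 a = s a)" for s1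
    using that W by (intro runs_Assign) (auto simp: S_def combine_def represents_upd)
  have r3: "runs W (While (vJ1 \<^bold>mod (Const 2 \<^bold>* V vK) \<^bold>= Const 0) combine_prog) s2
      ((\<Sum>w<m. transform_time N (2^w) + 60) + (m + 1) * 20) (S m)"
    if b2: "bounded W s2" and S0: "S 0 s2" for s2
  proof (rule runs_While[OF W1 b2, where I = S and m = m and t = "\<lambda>w. transform_time N (2^w) + 60"], goal_cases)
    case 1
    show ?case using S0 .
  next
    case (2 w s')
    then have v: "s' vJ 0 = j" "s' vK 0 = 2 ^ w" by (auto simp: S_def)
    have "J mod (2 * 2 ^ w) = 0 \<longleftrightarrow> w < m"
      using dvd[of "Suc w"] by (simp add: mod_eq_0_iff_dvd Suc_le_eq)
    moreover have "2 * 2 ^ w < W" "Suc j < W" using le[OF 2(1)] J NW by (simp_all add: J_def)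
    ultimately show ?case using W by (auto simp: v J_def)
  next
    case (3 w s')
    then have v: "s' vJ 0 = j" "s' vK 0 = 2 ^ w" and rep': "represents N s' (combine N J w st0)"
      and fr: "\<And>a. a \<ge> b + 17 \<Longrightarrow> s' a = s a" by (auto simp: S_def)
    have w: "2 * 2 ^ w \<le> J" "2 ^ w \<le> J" using le[of "Suc w"] le[of w] 3(1) by auto
    have lt: "2 * 2 ^ w < W" "Suc j < W" using w J NW by (auto simp: J_def)
    define s3 where "s3 = s'(vSrc := (s' vSrc)(0 := J - 2 ^ w))"
    have q1: "runs W (Assign vSrc (Const 0) (vJ1 \<^bold>- V vK)) s' 10 (\<lambda>s'. s' = s3)"
      using 3(2) lt W by (intro runs_Assign) (auto simp: v s3_def J_def)
    note b3 = runs_to_bounded[OF q1]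
    define s4 where "s4 = s3(vDst := (s3 vDst)(0 := J - 2 * 2 ^ w))"
    have q2: "runs W (Assign vDst (Const 0) (vJ1 \<^bold>- Const 2 \<^bold>* V vK)) s3 15 (\<lambda>s'. s' = s4)"
      using b3 lt W by (intro runs_Assign) (auto simp: v s3_def s4_def J_def)
    note b4 = runs_to_bounded[OF q2]
    have q3: "runs W transform_prog s4 (transform_time N (2 ^ w))
       (\<lambda>s'. represents N s' (combine N J (Suc w) st0) \<and> (\<forall>a\<ge>b + 10. s' a = s4 a))"
      unfolding combine_Suc
    proof (rule runs_transform[OF W(1) W2 _ b4])
      show "Bm (2 ^ w) \<le> W" using w J by (intro W) linarith
      show "represents N s4 (combine N J w st0)" using rep' by (simp add: s4_def s3_def represents_upd)
      show "2 ^ w dvd N" using 3(1) by (intro dN) simp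
    qed (use w J in \<open>auto simp: s4_def s3_def v\<close>)
    have q4: "runs W (Assign vK (Const 0) (Const 2 \<^bold>* V vK)) s5 10 (S (Suc w))"
      if "bounded W s5" "represents N s5 (combine N J (Suc w) st0) \<and> (\<forall>a\<ge>b + 10. s5 a = s4 a)" for s5
      using that lt W by (intro runs_Assign) (auto simp: S_def represents_upd s4_def s3_def v fr)
    have "runs W combine_prog s'
      (10 + (15 + (transform_time N (2 ^ w) + 10))) (S (Suc w))"
      unfolding combine_prog_def by (intro runs_Seq_to[OF q1] runs_Seq_to[OF q2]) (rule runs_Seq_mid[OF q3 q4 order_refl])
    then show ?case by (rule runs_mono) auto
  qed (auto simp: S_def)
  have r4: "runs W update_prog s2 (transform_time N (2^m) + 60)
      (\<lambda>s'. represents N s' (step N j st) \<and> s' vJ 0 = j \<and> (\<forall>a\<ge>b + 17. s' a = s a))"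
    if b2: "bounded W s2" and Sm: "S m s2" for s2
  proof -
    have v: "s2 vJ 0 = j" "s2 vK 0 = 2 ^ m" and rep': "represents N s2 (combine N J m st0)"
      and fr: "\<And>a. a \<ge> b + 17 \<Longrightarrow> s2 a = s a" using Sm by (auto simp: S_def)
    have vN: "s2 vN 0 = N" using rep' by (cases "combine N J m st0") (auto simp: represents_def)
    have lt: "Suc j < W" using J NW by (auto simp: J_def)
    have le': "(2::nat) ^ m \<le> J" by (rule le) simp
    show ?thesis
      unfolding update_prog_def
    proof (rule runs_Cond[OF b2 W1, where t = "transform_time N (2^m) + 50"], goal_cases)
      case 2
      then have JN: "J < N" by (auto simp: v vN J_def split: if_splits)
      define s3 where "s3 = s2(vSrc := (s2 vSrc)(0 := J - 2 ^ m))"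
      have q1: "runs W (Assign vSrc (Const 0) (vJ1 \<^bold>- V vK)) s2 10 (\<lambda>s'. s' = s3)"
        using b2 lt W by (intro runs_Assign) (auto simp: v s3_def J_def)
      note b3 = runs_to_bounded[OF q1]
      define s4 where "s4 = s3(vDst := (s3 vDst)(0 := J))"
      have q2: "runs W (Assign vDst (Const 0) vJ1) s3 15 (\<lambda>s'. s' = s4)"
        using b3 lt W by (intro runs_Assign) (auto simp: v s3_def s4_def J_def)
      note b4 = runs_to_bounded[OF q2]
      have q0: "runs W transform_prog s4 (transform_time N (2 ^ m))
         (\<lambda>s'. represents N s' (transform N (J - 2^m) J (2^m) (combine N J m st0)) \<and> (\<forall>a\<ge>b + 10. s' a = s4 a))"
      proof (rule runs_transform[OF W(1) W2 _ b4])
        show "Bm (2 ^ m) \<le> W" using le' J by (intro W) linarith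
        show "represents N s4 (combine N J m st0)" using rep' by (simp add: s4_def s3_def represents_upd)
        show "2 ^ m dvd N" by (intro dN) simp
        \<comment> \<open>The positive difference is a multiple of 2^m, so another block of this
          size fits after \<open>J\<close>.\<close>
        have "2 ^ m dvd N - J" using dN[of m] dvd[of m] by (simp add: dvd_diff_nat)
        then have "2 ^ m \<le> N - J" using JN by (intro dvd_imp_le) auto
        then show "J + 2 ^ m \<le> N" using JN by simp
      qed (use le' J in \<open>auto simp: s4_def s3_def v\<close>)
      have q3: "runs W transform_prog s4 (transform_time N (2 ^ m))
         (\<lambda>s'. represents N s' (step N j st) \<and> s' vJ 0 = j \<and> (\<forall>a\<ge>b + 17. s' a = s a))"
        by (rule runs_mono[OF q0]) (use JN in \<open>auto simp: step_def Let_def J_def m_def st0_def s4_def s3_def v fr\<close>)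
      show ?case by (rule runs_mono[OF runs_Seq_to[OF q1 runs_Seq_to[OF q2 q3]]]) auto
    next
      case 3
      then have "\<not> J < N" by (auto simp: v vN J_def split: if_splits)
      then show ?case using b2 rep' fr
        by (intro runs_Skip) (auto simp: step_def Let_def J_def m_def st0_def v)
    qed (use lt W in \<open>auto simp: v vN\<close>)
  qed
  have run: "runs W column_prog s (100 * N + 100 + (10 + (((\<Sum>w<m. transform_time N (2^w) + 60) + (m + 1) * 20) + (transform_time N (2^m) + 60))))
     (\<lambda>s'. represents N s' (step N j st) \<and> s' vJ 0 = j \<and> (\<forall>a\<ge>b + 17. s' a = s a))"
    unfolding column_prog_def
    by (rule runs_Seq_mid[OF r1 runs_Seq_mid[OF r2 runs_Seq_mid[OF r3 r4 order_refl] order_refl] order_refl])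
  \<comment> \<open>Each iteration has an overhead of 60 for assignments and 20 for the test. It is
    charged to the second copy of the sum in \<open>column_time\<close>.\<close>
  have "(\<Sum>w<m. 80 :: nat) \<le> (\<Sum>w<m. transform_time N (2^w))"
  proof (rule sum_mono)
    show "80 \<le> transform_time N (2 ^ w)" for w using transform_time_ge[OF N0, of "2 ^ w"] by simp
  qed
  then have "100 * N + 100 + (10 + (((\<Sum>w<m. transform_time N (2^w) + 60) + (m + 1) * 20) + (transform_time N (2^m) + 60))) \<le> column_time N (Suc j)"
    using N0 by (simp add: column_time_def m_def[folded J_def, symmetric] J_def[symmetric] sum.distrib lessThan_Suc_atMost[symmetric])
  then show ?thesis by (rule runs_mono[OF run])
qed

section \<open>Elimination of a whole matrix\<close>

definition eliminate_prog :: program where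
  "eliminate_prog =
     Seq (Fill vX aPV (Const 0) (V vN) (V vN))
     (Seq (Fill vX aUS (Const 0) (V vN) (Const 0)) (For vJ (V vN) column_prog))"

definition eliminate_time :: "nat \<Rightarrow> nat" where
  "eliminate_time N = 200 * N + 200 + (\<Sum>j<N. column_time N (Suc j))"

lemma runs_eliminate:
  assumes W: "10 < W" "N * N + 4 * N < W" "\<And>k. k \<le> N \<Longrightarrow> Bm k \<le> W" and s: "bounded W s"
    and N: "N = 2^v" and sN: "s vN 0 = N" and M: "holds N (s aM) A"
  shows "runs W eliminate_prog s (eliminate_time N)
     (\<lambda>s'. \<exists>M pv U. represents N s' (M, pv, U) \<and> reduces N {..<N} (A, \<lambda>_. N, {}) (M, pv, U) \<and> (\<forall>a\<ge>b + 17. s' a = s a))"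
proof -
  have W1: "1 < W" and NW: "N < W" using W(1,2) by linarith+
  define s1 where "s1 = s(vX := (s vX)(0 := N), aPV := filled (s aPV) 0 N (\<lambda>_. N))"
  have r1: "runs W (Fill vX aPV (Const 0) (V vN) (V vN)) s ((N + 1) * 50) (\<lambda>s'. s' = s1)"
    unfolding s1_def by (rule runs_Fill[OF W1 s, where n = N and d = 0 and f = "\<lambda>_. N"]) (use W1 NW in \<open>auto simp: sN\<close>)
  note b1 = runs_to_bounded[OF r1]
  define s2 where "s2 = s1(vX := (s1 vX)(0 := N), aUS := filled (s1 aUS) 0 N (\<lambda>_. 0))"
  have r2: "runs W (Fill vX aUS (Const 0) (V vN) (Const 0)) s1 ((N + 1) * 50) (\<lambda>s'. s' = s2)"
    unfolding s2_def by (rule runs_Fill[OF W1 b1, where n = N and d = 0 and f = "\<lambda>_. 0"]) (use W1 NW in \<open>auto simp: sN s1_def\<close>)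
  note b2 = runs_to_bounded[OF r2]
  define st where "st = (A, \<lambda>_::nat. N, {} :: nat set)"
  have represents: "represents N s2 st"
    using M by (auto simp: represents_def st_def s2_def s1_def sN filled_def)
  define I where "I = (\<lambda>j s'. s' vJ 0 = j \<and> represents N s' (fold (step N) [0..<j] st) \<and> (\<forall>a\<ge>b + 17. s' a = s a))"
  have r3: "runs W (For vJ (V vN) column_prog) s2 ((\<Sum>j<N. column_time N (Suc j)) + (N + 1) * 30) (I N)"
  proof (rule runs_For[OF W1 b2 NW, where I = I and t = "\<lambda>j. column_time N (Suc j)"], goal_cases)
    case 1
    show ?case using represents by (auto simp: I_def represents_upd) (auto simp: s1_def s2_def)
  next
    case (3 j s')
    have "runs W column_prog s' (column_time N (Suc j))
      (\<lambda>s''. represents N s'' (step N j (fold (step N) [0..<j] st)) \<and> s'' vJ 0 = j \<and> (\<forall>a\<ge>b + 17. s'' a = s' a))"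
      by (rule runs_column[OF W 3(2) N]) (use 3 in \<open>auto simp: I_def\<close>)
    then show ?case by (rule runs_mono) (use 3 in \<open>auto simp: I_def represents_upd\<close>)
  qed (use W1 sN in \<open>auto simp: I_def\<close>)
  have "runs W eliminate_prog s ((N + 1) * 50 + ((N + 1) * 50 + ((\<Sum>j<N. column_time N (Suc j)) + (N + 1) * 30))) (I N)"
    unfolding eliminate_prog_def by (intro runs_Seq_to[OF r1] runs_Seq_to[OF r2] r3)
  then show ?thesis
  proof (rule runs_mono)
    fix s' assume "I N s'"
    moreover obtain M pv U where "fold (step N) [0..<N] st = (M, pv, U)" by (metis prod_cases3)
    moreover have "reduces N {0..<0 + N} st (fold (step N) [0..<N] st)"
      unfolding N fold_step_eliminate_block by (rule reduces_eliminate_block)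
    ultimately show "\<exists>M pv U. represents N s' (M, pv, U) \<and> reduces N {..<N} (A, \<lambda>_. N, {}) (M, pv, U) \<and> (\<forall>a\<ge>b + 17. s' a = s a)"
      by (auto simp: I_def st_def atLeast0LessThan)
  qed (simp add: eliminate_time_def)
qed

section \<open>The transformation matrix from the recorded pivots\<close>

abbreviation "aINV \<equiv> b + 17"

definition inverse_prog :: program where
  "inverse_prog = For vX (V vN) (Cond (Cell aPV (V vX) \<^bold>< V vN) (Assign aINV (Cell aPV (V vX)) (V vX)) Skip)"

text \<open>Cells of \<open>aINV\<close> that belong to no pivot hold arbitrary words. The remainder
  modulo \<open>N\<close> makes the address legal, and the factor from \<open>aUS\<close> discards
  what is read there.\<close>

definition matrix_prog :: "nat \<Rightarrow> program" where
  "matrix_prog a = Fill vX a (Const 0) (V vN \<^bold>* V vN)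
     (((V vX \<^bold>mod V vN \<^bold>= V vX \<^bold>div V vN) \<^bold>+ 
      Cell aUS (V vX \<^bold>div V vN) \<^bold>* Cell aM ((Cell aINV (V vX \<^bold>div V vN) \<^bold>mod V vN) \<^bold>* V vN \<^bold>+ (V vX \<^bold>mod V vN))) \<^bold>mod Const 2)"

definition copy_prog :: "nat \<Rightarrow> program" where
  "copy_prog u = Fill vX u (Const 0) (V vN) (Cell aUS (V vX))"

definition reduce_prog :: "nat \<Rightarrow> nat \<Rightarrow> program" where
  "reduce_prog a u = Seq eliminate_prog (Seq inverse_prog (Seq (matrix_prog a) (copy_prog u)))"

definition reduce_time :: "nat \<Rightarrow> nat" where
  "reduce_time N = eliminate_time N + 100 * (N * N) + 300 * N + 400"

lemma runs_reduce:
  assumes W: "10 < W" "N * N + 4 * N < W" "\<And>k. k \<le> N \<Longrightarrow> Bm k \<le> W" and s: "bounded W s"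
    and N: "N = 2^v" and sN: "s vN 0 = N" and A: "holds N (s aM) A"
    and au: "a > b + 20" "u > b + 20" "a \<noteq> u"
  shows "runs W (reduce_prog a u) s (reduce_time N)
     (\<lambda>s'. \<exists>T P. eliminates N A T P \<and> holds N (s' a) T \<and> (\<forall>r<N. s' u r = of_bool (r \<in> P)) \<and>
        (\<forall>x\<ge>b + 18. x \<noteq> a \<longrightarrow> x \<noteq> u \<longrightarrow> s' x = s x))" (is "runs _ _ _ _ ?Q")
proof -
  have W1: "1 < W" and NW: "N < W" and NNW: "N * N < W" using W(1,2) by linarith+
  have N0: "0 < N" using N by simp
  define R where "R = (\<lambda>M pv U s'. represents N s' (M, pv, U) \<and> reduces N {..<N} (A, \<lambda>_. N, {}) (M, pv, U) \<and> (\<forall>a\<ge>b + 17. s' a = s a))"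
  have r1: "runs W eliminate_prog s (eliminate_time N) (\<lambda>s'. \<exists>M pv U. R M pv U s')"
    unfolding R_def by (rule runs_eliminate[OF W s N sN A])
  have r2: "runs W (Seq inverse_prog
     (Seq (matrix_prog a)
     (copy_prog u))) s1 ((60 * N + 60) + ((N * N + 1) * 100 + (N + 1) * 100))
     ?Q"
    if b1: "bounded W s1" and R: "R M pv U s1" for s1 M pv U
  proof -
    have represents: "s1 vN 0 = N" "\<And>r c. r < N \<Longrightarrow> c < N \<Longrightarrow> s1 aM (c * N + r) = bit_nat (M r c)"
      "\<And>j. j < N \<Longrightarrow> s1 aPV j = pv j" "\<And>r. r < N \<Longrightarrow> s1 aUS r = of_bool (r \<in> U)"
      and red: "reduces N {..<N} (A, \<lambda>_. N, {}) (M, pv, U)" and fr: "\<And>a. a \<ge> b + 17 \<Longrightarrow> s1 a = s a"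
      using R by (auto simp: R_def represents_def holds_def)
    have inj: "inj_on pv {j\<in>{..<N}. pv j < N}" and U: "U = {r. r < N \<and> r \<in> pv ` {..<N}}"
      using red by (auto simp: reduces_def)
    define I where "I = (\<lambda>i s'. s' vX 0 = i \<and> (\<forall>a. a \<noteq> vX \<longrightarrow> a \<noteq> aINV \<longrightarrow> s' a = s1 a) \<and>
      (\<forall>j<i. pv j < N \<longrightarrow> s' aINV (pv j) = j))"
    have q1: "runs W inverse_prog s1        (60 * N + 60) (I N)"
      unfolding inverse_prog_def
    proof (rule runs_For[OF W1 b1 NW, where I = I and t = "\<lambda>_. 30"], goal_cases)
      case prem: (3 i s')
      have v: "s' vN 0 = N" "s' vX 0 = i" "s' aPV i = pv i" using prem represents by (auto simp: I_def)
      have ne: "pv j \<noteq> pv i" if "j < i" "pv j < N" for j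
        using inj prem(1) that by (auto dest!: inj_onD)
      show ?case
      proof (rule runs_Cond[OF prem(2) W1, where t = 15], goal_cases)
        case 2
        have "\<forall>j<Suc i. pv j < N \<longrightarrow> ((s' aINV)(pv i := i)) (pv j) = j"
          using prem(3) ne by (auto simp: I_def less_Suc_eq)
        moreover have "\<forall>a. a \<noteq> vX \<longrightarrow> a \<noteq> aINV \<longrightarrow> s' a = s1 a" using prem(3) by (simp add: I_def)
        ultimately show ?case using prem(2) W1
          by (intro runs_Assign) (auto simp: v represents(3)[OF prem(1)] I_def)
      next
        case 3
        then show ?case using prem W1
          by (intro runs_Skip) (auto simp: v I_def less_Suc_eq split: if_splits)
      qed (use W1 in auto)
    qed (use W1 represents in \<open>auto simp: I_def\<close>)
    define T where "T = pivots_mat N (M, pv, U)"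
    have q2: "runs W (Seq (matrix_prog a)
       (copy_prog u)) s2 ((N * N + 1) * 100 + (N + 1) * 100) ?Q"
      if b2: "bounded W s2" and I2: "I N s2" for s2
    proof -
      have eq: "\<And>a. a \<noteq> vX \<Longrightarrow> a \<noteq> aINV \<Longrightarrow> s2 a = s1 a" and inv: "\<And>j. j < N \<Longrightarrow> pv j < N \<Longrightarrow> s2 aINV (pv j) = j"
        using I2 by (auto simp: I_def)
      have v: "s2 vN 0 = N" using represents by (simp add: eq)
      define s3 where "s3 = s2(vX := (s2 vX)(0 := N * N), a := filled (s2 a) 0 (N * N) (\<lambda>x. bit_nat (T (x mod N) (x div N))))"
      have q3: "runs W (matrix_prog a)
        s2 ((N * N + 1) * 100) (\<lambda>s'. s' = s3)"
        unfolding s3_def matrix_prog_def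
      proof (rule runs_Fill[OF W1 b2, where n = "N * N" and d = 0 and f = "\<lambda>x. bit_nat (T (x mod N) (x div N))"], goal_cases)
        case (4 i h)
        define r c j where "r = i mod N" and "c = i div N" and "j = s2 aINV c mod N"
        have rc: "r < N" "c < N" "j < N" using div_less_sq[OF 4(1)] N0 by (auto simp: r_def c_def j_def)
        have ji: "j * N + r < N * N" using index_less[OF rc(3,1)] .
        have jN: "j * N < W" using ji NNW by linarith
        have T: "bit_nat (T r c) = (of_bool (r = c) + of_bool (c \<in> U) * bit_nat (M r j)) mod 2"
        proof (cases "c \<in> U")
          case True
          then obtain j' where j': "j' < N" "pv j' = c" using U by auto
          then have "j = j'" using inv[of j'] rc by (simp add: j_def)
          then have "T r c = of_bool (r = c) + M r j"
            using pivots_mat_pivot[OF inj j'(1)] j' rc by (simp add: T_def)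
          then show ?thesis using True by (simp flip: bit_nat_add)
        next
          case False
          then have "T r c = of_bool (r = c)"
            unfolding T_def by (intro pivots_mat_no_pivot) (use U rc in auto)
          then show ?thesis using False by simp
        qed
        have vals: "s2 aUS c = of_bool (c \<in> U)" "s2 aM (j * N + r) = bit_nat (M r j)" using represents rc by (simp_all add: eq)
        have le: "of_bool (r = c) + of_bool (c \<in> U) * bit_nat (M r j) < W" "of_bool (c \<in> U) * bit_nat (M r j) < W"
          using bit_nat_simps(4)[of "M r j"] W by (auto simp: of_bool_def intro: le_less_trans)
        obtain t where t: "t = s2(vX := (s2 vX)(0 := i), a := h)" by blast
        have tv: "t vX 0 = i" "t vN 0 = N" "t aUS c = of_bool (c \<in> U)" "t aINV c mod N = j" "t aM (j * N + r) = bit_nat (M r j)"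
          using au by (simp_all add: t v vals j_def[symmetric])
        show ?case unfolding t[symmetric] using W(1) 4(1) ji jN le rc NNW
          by (simp only: safe.simps ev.simps apply_op.simps tv r_def[symmetric] c_def[symmetric] T) simp
      qed (use W1 NNW v au in auto)
      note b3 = runs_to_bounded[OF q3]
      have "holds N (filled (s2 a) 0 (N * N) (\<lambda>x. bit_nat (T (x mod N) (x div N)))) T"
        by (auto simp: holds_def filled_index)
      moreover have "eliminates N A T U" unfolding T_def by (rule eliminates_reduces[OF red])
      ultimately have *: "eliminates N A T U \<and> holds N (s3 a) T" using au by (simp add: s3_def)
      have s3: "\<And>x. x \<noteq> vX \<Longrightarrow> x \<noteq> a \<Longrightarrow> s3 x = s2 x" by (simp add: s3_def)
      have s3': "s3 x = s1 x" if "x \<noteq> vX" "x \<noteq> a" "x \<noteq> aINV" for x using s3 eq that by simp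
      define s4 where "s4 = s3(vX := (s3 vX)(0 := N), u := filled (s3 u) 0 N (s1 aUS))"
      have "runs W (copy_prog u) s3 ((N + 1) * 100) (\<lambda>s'. s' = s4)"
        unfolding s4_def copy_prog_def
        by (rule runs_Fill[OF W1 b3 NW, where d = 0 and f = "s1 aUS"])
          (use W1 NW au represents(1) in \<open>simp_all add: s3'\<close>)
      moreover have "?Q s4"
      proof (intro exI[of _ T] exI[of _ U] conjI allI impI)
        show "holds N (s4 a) T" "eliminates N A T U" using * au by (simp_all add: s4_def)
        show "s4 u r = of_bool (r \<in> U)" if "r < N" for r using that represents(4) by (simp add: s4_def filled_def)
        show "s4 x = s x" if "b + 18 \<le> x" "x \<noteq> a" "x \<noteq> u" for x
          using that fr[of x] s3'[of x] by (simp add: s4_def)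
      qed
      ultimately have "runs W (copy_prog u) s3 ((N + 1) * 100) ?Q"
        by (elim runs_mono) (blast, blast)
      then show ?thesis by (rule runs_Seq_to[OF q3])
    qed
    show ?thesis by (rule runs_Seq_mid[OF q1 q2 order_refl])
  qed
  have "runs W (reduce_prog a u) s (eliminate_time N + ((60 * N + 60) + ((N * N + 1) * 100 + (N + 1) * 100)))
     ?Q"
    unfolding reduce_prog_def by (rule runs_Seq_mid[OF r1 _ order_refl]) (use r2 in blast)
  then show ?thesis by (rule runs_mono) (auto simp: reduce_time_def)
qed

end

section \<open>The annotation program\<close>

text \<open>A single loop runs over all pairs of positions, encoded by quotient and remainder. As
  the lists are distinct, each common vertex is met exactly once.\<close>

lemma count_common:
  assumes "distinct vs" "distinct ws"
  shows "(\<Sum>x<length vs * length ws. of_bool (vs ! (x div length ws) = ws ! (x mod length ws))) = card (set vs \<inter> set ws)"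
proof -
  let ?a = "length vs" and ?b = "length ws"
  let ?f = "\<lambda>x. of_bool (vs ! (x div ?b) = ws ! (x mod ?b)) :: nat"
  have "(\<Sum>x<?a * ?b. ?f x) = (\<Sum>u<?a. \<Sum>x\<in>{u * ?b..<u * ?b + ?b}. ?f x)"
    by (rule sum.nat_group[symmetric])
  also have "\<dots> = (\<Sum>u<?a. \<Sum>w<?b. of_bool (vs ! u = ws ! w))"
  proof (rule sum.cong[OF refl])
    fix u
    have "(\<Sum>x\<in>{u * ?b..<u * ?b + ?b}. ?f x) = (\<Sum>w\<in>{0..<?b}. ?f (u * ?b + w))"
      using sum.atLeastLessThan_shift_0[of ?f "u * ?b" "u * ?b + ?b"] by (simp add: o_def)
    also have "\<dots> = (\<Sum>w\<in>{0..<?b}. of_bool (vs ! u = ws ! w))"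
    proof (rule sum.cong[OF refl])
      fix w assume "w \<in> {0..<?b}"
      then show "?f (u * ?b + w) = of_bool (vs ! u = ws ! w)"
        using index_div_mod[of w ?b u] by simp
    qed
    finally show "(\<Sum>x\<in>{u * ?b..<u * ?b + ?b}. ?f x) = (\<Sum>w<?b. of_bool (vs ! u = ws ! w))"
      by (simp add: atLeast0LessThan)
  qed
  also have "\<dots> = (\<Sum>u<?a. \<Sum>w\<in>set ws. of_bool (vs ! u = w))"
    by (intro sum.cong refl sum.reindex_bij_betw bij_betw_nth assms)
  also have "\<dots> = (\<Sum>v\<in>set vs. \<Sum>w\<in>set ws. of_bool (v = w))"
    by (intro sum.reindex_bij_betw[of "(!) vs" "{..<?a}" "set vs" "\<lambda>v. \<Sum>w\<in>set ws. of_bool (v = w)"] bij_betw_nth assms) auto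
  also have "\<dots> = (\<Sum>v\<in>set vs. of_bool (v \<in> set ws))"
  proof (rule sum.cong[OF refl])
    fix v
    have "(\<Sum>w\<in>set ws. of_bool (v = w)) = (\<Sum>w\<in>set ws. if v = w then 1 else 0 :: nat)" by (rule sum.cong) auto
    then show "(\<Sum>w\<in>set ws. of_bool (v = w)) = (of_bool (v \<in> set ws) :: nat)" by simp
  qed
  also have "\<dots> = card (set vs \<inter> set ws)"
    by (simp add: of_bool_def sum.If_cases Int_def)
  finally show ?thesis .
qed

lemma nth_concat_take:
  assumes "i < length xs" "j < length (xs ! i)"
  shows "concat xs ! (length (concat (take i xs)) + j) = xs ! i ! j"
    and "length (concat (take i xs)) + j < length (concat xs)"
proof -
  have "concat xs = concat (take i xs) @ xs ! i @ concat (drop (Suc i) xs)"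
    by (metis assms(1) concat.simps(2) concat_append id_take_nth_drop)
  then show "concat xs ! (length (concat (take i xs)) + j) = xs ! i ! j"
    "length (concat (take i xs)) + j < length (concat xs)"
    using assms(2) by (simp_all add: nth_append)
qed

text \<open>Simplices are nonempty, so the value 0 marks the indices that were added by
  padding.\<close>

definition size_of :: "nat list list \<Rightarrow> nat \<Rightarrow> nat" where
  "size_of xs i = (if i < length xs then length (xs ! i) else 0)"

definition common :: "nat list list \<Rightarrow> nat \<Rightarrow> nat \<Rightarrow> nat" where
  "common xs i j = (if i < length xs \<and> j < length xs then card (set (xs ! i) \<inter> set (xs ! j)) else 0)"

definition listed :: "nat list list \<Rightarrow> nat \<Rightarrow> nat \<Rightarrow> bool" where
  "listed xs d i \<longleftrightarrow> i < length xs \<and> length (xs ! i) = d"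

definition coface_mat :: "nat list list \<Rightarrow> nat \<Rightarrow> bmat" where
  "coface_mat xs p i j = of_bool (listed xs (Suc p) i \<and> listed xs (Suc (Suc p)) j \<and> set (xs ! i) \<subseteq> set (xs ! j))"

text \<open>The transposed boundary operator of dimension p. For p = 0 it vanishes on the list of a
  complex, since no simplex is empty, so every 0-chain is a cycle.\<close>

definition face_mat :: "nat list list \<Rightarrow> nat \<Rightarrow> bmat" where
  "face_mat xs p i j = of_bool (listed xs (Suc p) i \<and> listed xs p j \<and> set (xs ! j) \<subseteq> set (xs ! i))"

definition padded :: "nat \<Rightarrow> nat" where
  "padded n = 2 ^ (LEAST v. n \<le> 2 ^ v)"

text \<open>The summand 1 is there for \<open>n = 0\<close>, which is padded to 1. The last two
  claims serve the doubling loop: they bound its length and describe its test.\<close>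

lemma padded: "n \<le> padded n" "padded n \<le> 2 * n + 1" "(LEAST v. n \<le> 2 ^ v) < padded n"
  "i \<le> (LEAST v. n \<le> 2 ^ v) \<Longrightarrow> 2 ^ i < n \<longleftrightarrow> i < (LEAST v. n \<le> 2 ^ v)"
proof -
  define v where "v = (LEAST v. n \<le> 2 ^ v)"
  have v: "n \<le> 2 ^ v" unfolding v_def by (rule LeastI[of _ n]) (simp add: less_imp_le)
  have lt: "2 ^ i < n" if "i < v" for i using not_less_Least that unfolding v_def by fastforce
  show "n \<le> padded n" "(LEAST v. n \<le> 2 ^ v) < padded n" using v by (simp_all add: padded_def v_def[symmetric])
  show "2 ^ i < n \<longleftrightarrow> i < (LEAST v. n \<le> 2 ^ v)" if "i \<le> (LEAST v. n \<le> 2 ^ v)"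
    using that v lt[of i] unfolding v_def[symmetric] by (cases "i = v") auto
  show "padded n \<le> 2 * n + 1"
  proof (cases v)
    case (Suc w)
    then show ?thesis using lt[of w] by (simp add: padded_def v_def[symmetric])
  qed (simp add: padded_def v_def[symmetric])
qed

context multiplication
begin

abbreviation "aT2 \<equiv> b + 21"
abbreviation "aP2 \<equiv> b + 22"
abbreviation "aT1 \<equiv> b + 23"
abbreviation "aP1 \<equiv> b + 24"
abbreviation "aT3 \<equiv> b + 25"
abbreviation "aP3 \<equiv> b + 26"
abbreviation "aMASK \<equiv> b + 27"
abbreviation "aLEN \<equiv> b + 28"
abbreviation "aIC \<equiv> b + 29"
abbreviation "vP \<equiv> b + 30"
abbreviation "aROWS \<equiv> b + 31"
abbreviation "vG \<equiv> b + 32"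
abbreviation "vY \<equiv> b + 33"
abbreviation "vC \<equiv> b + 34"

section \<open>Padding, dimensions and numbers of common vertices\<close>

definition size_prog :: program where
  "size_prog = Seq (Assign vN (Const 0) (Const 1))
     (While (V vN \<^bold>< Cell 0 (Const 0)) (Assign vN (Const 0) (Const 2 \<^bold>* V vN)))"

lemma runs_size:
  assumes W: "10 < W" "2 * n < W" and s: "bounded W s" "s 0 0 = n"
  shows "runs W size_prog s (100 * padded n + 100) (\<lambda>s'. s' = s(vN := (s vN)(0 := padded n)))"
proof -
  have W1: "1 < W" using W by simp
  define v where "v = (LEAST v. n \<le> 2 ^ v)"
  define s1 where "s1 = s(vN := (s vN)(0 := 1))"
  have r1: "runs W (Assign vN (Const 0) (Const 1)) s 5 (\<lambda>s'. s' = s1)"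
    using s W by (intro runs_Assign) (auto simp: s1_def)
  note b1 = runs_to_bounded[OF r1]
  have r2: "runs W (While (V vN \<^bold>< Cell 0 (Const 0)) (Assign vN (Const 0) (Const 2 \<^bold>* V vN))) s1
     (v * 10 + (v + 1) * 10) (\<lambda>s'. s' = s(vN := (s vN)(0 := padded n)))"
  proof (rule runs_While[OF W1 b1, where m = v and I = "\<lambda>i s'. s' = s(vN := (s vN)(0 := 2 ^ i))" and t = "\<lambda>_. 10"], goal_cases)
    case (2 i s')
    then show ?case using padded(4)[of i n] W s by (auto simp: v_def)
  next
    case (3 i s')
    then have "2 ^ i < n" using padded(4)[of i n] by (simp add: v_def)
    then show ?case using 3(2) W unfolding 3(3) by (intro runs_Assign) auto
  next
    case (4 s')
    then show ?case by (simp add: padded_def v_def)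
  qed (auto simp: s1_def)
  show ?thesis unfolding size_prog_def
    by (rule runs_mono[OF runs_Seq_to[OF r1 r2]]) (use padded(3)[of n] in \<open>auto simp: v_def\<close>)
qed

definition prepared :: "nat list list \<Rightarrow> nat \<Rightarrow> nat \<Rightarrow> memory \<Rightarrow> bool" where
  "prepared xs p N s \<longleftrightarrow> s vN 0 = N \<and> s vP 0 = p \<and> (\<forall>i<N. s aLEN i = size_of xs i) \<and>
     (\<forall>i<N. s aMASK i = of_bool (listed xs (Suc p) i)) \<and>
     (\<forall>z<N * N. s aIC z = common xs (z mod N) (z div N))"

abbreviation "vYr \<equiv> V vY \<^bold>mod V vN"
abbreviation "vYc \<equiv> V vY \<^bold>div V vN"

definition common_prog :: program where
  "common_prog =
     Seq (Assign vC (Const 0) (Const 0))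
     (Seq (For vX (Cell aLEN vYr \<^bold>* Cell aLEN vYc)
       (Assign vC (Const 0) (V vC \<^bold>+
         (Cell 2 (Cell 1 vYr \<^bold>+ V vX \<^bold>div Cell aLEN vYc) \<^bold>= Cell 2 (Cell 1 vYc \<^bold>+ V vX \<^bold>mod Cell aLEN vYc)))))
     (Assign aIC (V vY) (V vC)))"

text \<open>As \<open>p\<close> may be the largest machine word, dimensions are compared by subtracting from the lengths.\<close>

definition input_prog :: program where
  "input_prog =
     Seq (Assign vP (Const 0) (Cell 0 (Const 1)))
     (Seq (Fill vX aLEN (Const 0) (V vN) ((V vX \<^bold>< Cell 0 (Const 0)) \<^bold>* (Cell 1 (V vX \<^bold>+ Const 1) \<^bold>- Cell 1 (V vX))))
     (Seq (Fill vX aMASK (Const 0) (V vN) ((Const 0 \<^bold>< Cell aLEN (V vX)) \<^bold>* (Cell aLEN (V vX) \<^bold>- Const 1 \<^bold>= V vP)))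
     (For vY (V vN \<^bold>* V vN) common_prog)))"

lemma runs_input:
  assumes W: "10 < W" "N * N + 4 * N < W" "l * l < W" and s: "bounded W s" and sN: "s vN 0 = N"
    and inp: "s 0 0 = length xs" "s 0 1 = p" "\<And>i. i \<le> length xs \<Longrightarrow> s 1 i = length (concat (take i xs))"
      "\<And>j. j < length (concat xs) \<Longrightarrow> s 2 j = concat xs ! j"
    and xs: "\<And>vs. vs \<in> set xs \<Longrightarrow> distinct vs \<and> vs \<noteq> [] \<and> length vs \<le> l" "length xs \<le> N"
  shows "runs W input_prog s (300 * (N * N) + 300 * N + 300 + N * N * (l * l * 100)) (prepared xs p N)"
proof -
  have W1: "1 < W" and NW: "N < W" and NNW: "N * N < W" using W(1,2) by linarith+
  define s1 where "s1 = s(vP := (s vP)(0 := p))"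
  have r1: "runs W (Assign vP (Const 0) (Cell 0 (Const 1))) s 10 (\<lambda>s'. s' = s1)"
    using s W by (intro runs_Assign) (auto simp: s1_def inp(2)[simplified])
  note b1 = runs_to_bounded[OF r1]
  have sz: "size_of xs i \<le> l" for i using xs(1)[of "xs ! i"] by (auto simp: size_of_def)
  have off: "s 1 (Suc i) = s 1 i + size_of xs i" if "i < length xs" for i
    using that inp(3)[of i] inp(3)[of "Suc i"] by (simp add: take_Suc_conv_app_nth size_of_def)
  define s2 where "s2 = s1(vX := (s1 vX)(0 := N), aLEN := filled (s1 aLEN) 0 N (size_of xs))"
  have r2: "runs W (Fill vX aLEN (Const 0) (V vN) ((V vX \<^bold>< Cell 0 (Const 0)) \<^bold>* (Cell 1 (V vX \<^bold>+ Const 1) \<^bold>- Cell 1 (V vX))))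
     s1 (100 * N + 100) (\<lambda>s'. s' = s2)"
    unfolding s2_def
  proof (rule runs_Fill[OF W1 b1 NW, where d = 0 and f = "size_of xs"], goal_cases)
    case (3 i h)
    \<comment> \<open>Behind the last simplex the cells are arbitrary. Their truncated difference
      still fits into a word and is multiplied by 0.\<close>
    have "s 1 (Suc i) - s 1 i < W" using boundedD[OF s, of 1 "Suc i"] by linarith
    then show ?case using 3 W NW off[of i]
      by (cases "i < length xs") (auto simp: s1_def inp(1) size_of_def)
  qed (use NW W1 in \<open>auto simp: s1_def sN\<close>)
  note b2 = runs_to_bounded[OF r2]
  define s3 where "s3 = s2(vX := (s2 vX)(0 := N), aMASK := filled (s2 aMASK) 0 N (\<lambda>i. of_bool (listed xs (Suc p) i)))"
  have r3: "runs W (Fill vX aMASK (Const 0) (V vN) ((Const 0 \<^bold>< Cell aLEN (V vX)) \<^bold>* (Cell aLEN (V vX) \<^bold>- Const 1 \<^bold>= V vP)))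
     s2 (100 * N + 100) (\<lambda>s'. s' = s3)"
    unfolding s3_def
  proof (rule runs_Fill[OF W1 b2 NW, where d = 0 and f = "\<lambda>i. of_bool (listed xs (Suc p) i)"], goal_cases)
    case (3 i h)
    then show ?case using W1 NW
      by (auto simp: s1_def s2_def filled_def size_of_def listed_def)
  qed (use NW W1 in \<open>auto simp: s1_def s2_def sN\<close>)
  note b3 = runs_to_bounded[OF r3]
  have v3: "s3 vN 0 = N" "s3 vP 0 = p" "\<And>i. i < N \<Longrightarrow> s3 aLEN i = size_of xs i"
    "\<And>i. i < N \<Longrightarrow> s3 aMASK i = of_bool (listed xs (Suc p) i)" "s3 1 = s 1" "s3 2 = s 2"
    by (simp_all add: s3_def s2_def s1_def sN filled_def)
  define I where "I = (\<lambda>y s'. s' vY 0 = y \<and> (\<forall>a. a \<noteq> vX \<longrightarrow> a \<noteq> vY \<longrightarrow> a \<noteq> vC \<longrightarrow> a \<noteq> aIC \<longrightarrow> s' a = s3 a) \<and>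
    (\<forall>z<y. s' aIC z = common xs (z mod N) (z div N)))"
  have r4: "runs W (For vY (V vN \<^bold>* V vN) common_prog) s3 (N * N * (150 + l * l * 100) + (N * N + 1) * 30) (prepared xs p N)"
  proof (rule runs_For[OF W1 b3 NNW, where I = I and t = "\<lambda>_. 150 + l * l * 100"], goal_cases)
    case prem: (3 y s')
    have eq: "\<And>a. a \<noteq> vX \<Longrightarrow> a \<noteq> vY \<Longrightarrow> a \<noteq> vC \<Longrightarrow> a \<noteq> aIC \<Longrightarrow> s' a = s3 a" and y: "s' vY 0 = y"
      using prem by (auto simp: I_def)
    define i j where "i = y mod N" and "j = y div N"
    have ij: "i < N" "j < N" using div_less_sq[OF prem(1)] by (auto simp: i_def j_def)
    define n where "n = size_of xs i * size_of xs j"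
    have nl: "n \<le> l * l" unfolding n_def by (intro mult_le_mono sz)
    have n0: "i < length xs" "j < length xs" if "x < n" for x
      using that by (auto simp: n_def size_of_def split: if_splits)
    define f where "f x = (of_bool (xs ! i ! (x div size_of xs j) = xs ! j ! (x mod size_of xs j)) :: nat)" for x
    have v: "s' vN 0 = N" "s' aLEN i = size_of xs i" "s' aLEN j = size_of xs j" "s' 1 = s 1" "s' 2 = s 2"
      using v3 ij by (simp_all add: eq)
    define t1 where "t1 = s'(vC := (s' vC)(0 := 0))"
    have q1: "runs W (Assign vC (Const 0) (Const 0)) s' 5 (\<lambda>s'. s' = t1)"
      using prem W1 by (intro runs_Assign) (auto simp: t1_def)
    note c1 = runs_to_bounded[OF q1]
    have sumf: "sum f {..<x} \<le> x" for x
      using sum_mono[of "{..<x}" f "\<lambda>_. 1"] by (simp add: f_def)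
    define t2 where "t2 = s'(vX := (s' vX)(0 := n), vC := (s' vC)(0 := sum f {..<n}))"
    have q2: "runs W (For vX (Cell aLEN vYr \<^bold>* Cell aLEN vYc)
       (Assign vC (Const 0) (V vC \<^bold>+
         (Cell 2 (Cell 1 vYr \<^bold>+ V vX \<^bold>div Cell aLEN vYc) \<^bold>= Cell 2 (Cell 1 vYc \<^bold>+ V vX \<^bold>mod Cell aLEN vYc)))))
       t1 (n * 40 + (n + 1) * 40) (\<lambda>s'. s' = t2)"
    proof (rule runs_For[OF W1 c1, where n = n and t = "\<lambda>_. 40" and
          I = "\<lambda>x t. t = s'(vX := (s' vX)(0 := x), vC := (s' vC)(0 := sum f {..<x}))"], goal_cases)
      case 1
      show ?case using nl W by linarith
    next
      case 2
      show ?case by (auto simp: t1_def)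
    next
      case (3 x t)
      then show ?case using nl W by (auto simp: y v i_def[symmetric] j_def[symmetric] n_def)
    next
      case (4 x t)
      have t: "t vC 0 = sum f {..<x}" "t vX 0 = x" "t vY 0 = y" "t vN 0 = N" "t aLEN i = size_of xs i"
        "t aLEN j = size_of xs j" "t 1 = s 1" "t 2 = s 2"
        using 4(3) v(4) by (simp_all add: y v(1,2,3,5))
      have x: "x div size_of xs j < size_of xs i" "x mod size_of xs j < size_of xs j"
        using 4(1) by (auto simp: n_def less_mult_imp_div_less intro!: mod_less_divisor Nat.gr0I)
      \<comment> \<open>The address lies before the start of the next vertex list, which array 1
        also stores as a word (after the last list, it stores the total length).\<close>
      have a1: "s 1 i + x div size_of xs j < W" "s 1 j + x mod size_of xs j < W"
        using boundedD[OF s, of 1 "Suc i"] boundedD[OF s, of 1 "Suc j"] off n0[OF 4(1)] x by simp_all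
      have a2: "s 2 (s 1 i + x div size_of xs j) = xs ! i ! (x div size_of xs j)"
        "s 2 (s 1 j + x mod size_of xs j) = xs ! j ! (x mod size_of xs j)"
        using x n0[OF 4(1)] nth_concat_take[of i xs "x div size_of xs j"] nth_concat_take[of j xs "x mod size_of xs j"]
        by (simp_all add: inp inp(3)[unfolded One_nat_def] size_of_def)
      have "sum f {..<x} + f x \<le> Suc x" using sumf[of "Suc x"] by simp
      then have a3: "sum f {..<x} + f x < W" using 4(1) nl W by linarith
      have e: "ev t (V vC \<^bold>+ (Cell 2 (Cell 1 vYr \<^bold>+ V vX \<^bold>div Cell aLEN vYc) \<^bold>= Cell 2 (Cell 1 vYc \<^bold>+ V vX \<^bold>mod Cell aLEN vYc)))
          = sum f {..<x} + f x"
        "safe W t (V vC \<^bold>+ (Cell 2 (Cell 1 vYr \<^bold>+ V vX \<^bold>div Cell aLEN vYc) \<^bold>= Cell 2 (Cell 1 vYc \<^bold>+ V vX \<^bold>mod Cell aLEN vYc)))"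
        using W1 a1 a3 by (simp_all add: t t(7)[unfolded One_nat_def] a2[unfolded One_nat_def] i_def[symmetric] j_def[symmetric] f_def)
      show ?case
        by (rule runs_Assign[OF 4(2) W1 _ e(2)], unfold e(1)) (use W1 in \<open>auto simp: 4(3) fun_eq_iff\<close>)
    qed (auto simp: t2_def)
    note c2 = runs_to_bounded[OF q2]
    have sf: "sum f {..<n} = common xs i j"
    proof (cases "i < length xs \<and> j < length xs")
      case True
      then show ?thesis using count_common[of "xs ! i" "xs ! j"] xs(1)[of "xs ! i"] xs(1)[of "xs ! j"]
        by (simp add: f_def[abs_def] n_def size_of_def common_def)
    qed (auto simp: n_def size_of_def common_def)
    have q3: "runs W (Assign aIC (V vY) (V vC)) t2 10 (\<lambda>s'. s' vY 0 = y \<and> I (Suc y) (s'(vY := (s' vY)(0 := Suc y))))"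
      using c2 W1 prem(3) by (intro runs_Assign) (auto simp: t2_def y I_def sf i_def j_def less_Suc_eq)
    have "runs W common_prog s' (5 + ((n * 40 + (n + 1) * 40) + 10)) (\<lambda>s'. s' vY 0 = y \<and> I (Suc y) (s'(vY := (s' vY)(0 := Suc y))))"
      unfolding common_prog_def by (intro runs_Seq_to[OF q1] runs_Seq_to[OF q2] q3)
    then show ?case by (rule runs_mono) (use nl in auto)
  next
    case (4 s')
    then show ?case using v3 by (auto simp: I_def prepared_def)
  qed (use W1 NNW v3 in \<open>auto simp: I_def\<close>)
  have "runs W input_prog s (10 + ((100 * N + 100) + ((100 * N + 100) + (N * N * (150 + l * l * 100) + (N * N + 1) * 30)))) (prepared xs p N)"
    unfolding input_prog_def by (intro runs_Seq_to[OF r1] runs_Seq_to[OF r2] runs_Seq_to[OF r3] r4)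
  then show ?thesis by (rule runs_mono) (auto simp: algebra_simps)
qed

section \<open>The two boundary matrices\<close>

abbreviation "vXr \<equiv> V vX \<^bold>mod V vN"
abbreviation "vXc \<equiv> V vX \<^bold>div V vN"

text \<open>A simplex is a face of another iff the number of common vertices equals its own size.
  For lists shorter than 2 the truncated difference is 0, which could be mistaken for p = 0; the
  first comparison excludes this.\<close>

definition coface_prog :: program where
  "coface_prog = Fill vX aM (Const 0) (V vN \<^bold>* V vN)
     (Cell aMASK vXr \<^bold>* ((Const 1 \<^bold>< Cell aLEN vXc) \<^bold>* ((Cell aLEN vXc \<^bold>- Const 2 \<^bold>= V vP) \<^bold>*
       (Cell aIC (V vX) \<^bold>= Cell aLEN vXr))))"

text \<open>For p = 0 the padding indices have size p; the comparison with 0 excludes them.\<close>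

definition face_prog :: program where
  "face_prog = Fill vX aM (Const 0) (V vN \<^bold>* V vN)
     (Cell aMASK vXr \<^bold>* ((Const 0 \<^bold>< Cell aLEN vXc) \<^bold>* ((Cell aLEN vXc \<^bold>= V vP) \<^bold>*
       (Cell aIC (V vX) \<^bold>= Cell aLEN vXc))))"

lemma card_Int_eq_iff: "finite A \<Longrightarrow> card (A \<inter> B) = card A \<longleftrightarrow> A \<subseteq> B"
  by (metis Int_absorb2 Int_lower1 card_subset_eq inf.orderI)

lemma of_bool_less: "1 < W \<Longrightarrow> of_bool P < (W :: nat)"
  by simp

lemma runs_matrix_fill:
  assumes W: "1 < W" "N * N < W" and s: "bounded W s" "s vN 0 = N" and a: "a \<noteq> vX" "a \<noteq> vN"
    and e: "\<And>t r c. r < N \<Longrightarrow> c < N \<Longrightarrow> t vX 0 = c * N + r \<Longrightarrow> (\<And>x. x \<noteq> vX \<Longrightarrow> x \<noteq> a \<Longrightarrow> t x = s x) \<Longrightarrow>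
      ev t vXr = r \<Longrightarrow> ev t vXc = c \<Longrightarrow> safe W t e \<and> ev t e = bit_nat (A r c)"
  shows "runs W (Fill vX a (Const 0) (V vN \<^bold>* V vN) e) s ((N * N + 1) * (expr_cost e + 60))
     (\<lambda>s'. holds N (s' a) A \<and> (\<forall>x. x \<noteq> vX \<longrightarrow> x \<noteq> a \<longrightarrow> s' x = s x))"
proof (rule runs_Fill[OF W(1) s(1) W(2), where d = 0 and f = "\<lambda>x. bit_nat (A (x mod N) (x div N))"], goal_cases)
  case (3 i h)
  have rc: "i div N < N" "i mod N < N" using div_less_sq[OF 3(1)] by auto
  show ?case
    using e[OF rc(2,1), of "s(vX := (s vX)(0 := i), a := h)"] 3 W a s(2) by simp
next
  case 4
  show ?case using a by (auto simp: holds_def filled_index)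
next
  case 5
  show ?case by (rule mult_le_mono2) simp
qed (use W s a in auto)

lemma runs_coface:
  assumes W: "10 < W" "N * N + 4 * N < W" and s: "bounded W s" "prepared xs p N s"
    and xs: "\<And>vs. vs \<in> set xs \<Longrightarrow> distinct vs"
  shows "runs W coface_prog s ((N * N + 1) * 100)
     (\<lambda>s'. holds N (s' aM) (coface_mat xs p) \<and> (\<forall>x. x \<noteq> vX \<longrightarrow> x \<noteq> aM \<longrightarrow> s' x = s x))"
  unfolding coface_prog_def
proof (rule runs_mono[OF runs_matrix_fill[where N = N and A = "coface_mat xs p"]], goal_cases)
  case prem: (7 t r c)
  have z: "(c * N + r) mod N = r" "(c * N + r) div N = c" using prem(1) by auto
  have v: "t vN 0 = N" "t vP 0 = p" "t aLEN r = size_of xs r" "t aLEN c = size_of xs c"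
    "t aMASK r = of_bool (listed xs (Suc p) r)" "t aIC (c * N + r) = common xs r c"
    using s(2) prem(1,2,4) index_less[OF prem(2,1)] z by (simp_all add: prepared_def)
  have "coface_mat xs p r c = of_bool (listed xs (Suc p) r \<and> 1 < size_of xs c \<and> size_of xs c - 2 = p \<and> common xs r c = size_of xs r)"
  proof (cases "r < length xs \<and> c < length xs")
    case True
    then have "card (set (xs ! r)) = length (xs ! r)" using xs[of "xs ! r"] distinct_card by simp
    then show ?thesis using True card_Int_eq_iff[of "set (xs ! r)" "set (xs ! c)"]
      by (auto simp: coface_mat_def listed_def size_of_def common_def)
  qed (auto simp: coface_mat_def listed_def size_of_def common_def)
  then show ?case using W prem(5,6)
    by (simp add: v prem(3) z of_bool_less of_bool_conj[symmetric] del: of_bool_conj)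
qed (use W s in \<open>auto simp: prepared_def\<close>)

lemma runs_face:
  assumes W: "10 < W" "N * N + 4 * N < W" and s: "bounded W s" "prepared xs p N s"
    and xs: "\<And>vs. vs \<in> set xs \<Longrightarrow> distinct vs \<and> vs \<noteq> []"
  shows "runs W face_prog s ((N * N + 1) * 100)
     (\<lambda>s'. holds N (s' aM) (face_mat xs p) \<and> (\<forall>x. x \<noteq> vX \<longrightarrow> x \<noteq> aM \<longrightarrow> s' x = s x))"
  unfolding face_prog_def
proof (rule runs_mono[OF runs_matrix_fill[where N = N and A = "face_mat xs p"]], goal_cases)
  case prem: (7 t r c)
  have z: "(c * N + r) mod N = r" "(c * N + r) div N = c" using prem(1) by auto
  have v: "t vN 0 = N" "t vP 0 = p" "t aLEN r = size_of xs r" "t aLEN c = size_of xs c"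
    "t aMASK r = of_bool (listed xs (Suc p) r)" "t aIC (c * N + r) = common xs r c"
    using s(2) prem(1,2,4) index_less[OF prem(2,1)] z by (simp_all add: prepared_def)
  have "face_mat xs p r c = of_bool (listed xs (Suc p) r \<and> 0 < size_of xs c \<and> size_of xs c = p \<and> common xs r c = size_of xs c)"
  proof (cases "r < length xs \<and> c < length xs")
    case True
    then have "card (set (xs ! c)) = length (xs ! c)" "xs ! c \<noteq> []" using xs[of "xs ! c"] distinct_card by auto
    then show ?thesis using True card_Int_eq_iff[of "set (xs ! c)" "set (xs ! r)"]
      by (auto simp: face_mat_def listed_def size_of_def common_def Int_commute)
  qed (auto simp: face_mat_def listed_def size_of_def common_def)
  then show ?case using W prem(5,6)
    by (simp add: v prem(3) z of_bool_less of_bool_conj[symmetric] del: of_bool_conj)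
qed (use W s in \<open>auto simp: prepared_def\<close>)

text \<open>The masks are put into the two factors, so one product of size \<open>N\<close>
  suffices. Column-major storage of T' is row-major storage of its transpose; the second factor is
  therefore copied in place, while the entries of the first one have to be rearranged.\<close>

definition pairing_prog :: program where
  "pairing_prog =
     Seq (Assign 0 (Const 0) (V vN))
     (Seq (Fill vX 1 (Const 0) (V vN \<^bold>* V vN)
        ((Const 1 \<^bold>- Cell aP2 vXc) \<^bold>* (Cell aMASK vXr \<^bold>* Cell aT2 (vXr \<^bold>* V vN \<^bold>+ vXc))))
     (Seq (Fill vX 2 (Const 0) (V vN \<^bold>* V vN) ((Const 1 \<^bold>- Cell aP1 vXr) \<^bold>* Cell aT1 (V vX)))
     (Seq Pm (Fill vX aM (Const 0) (V vN \<^bold>* V vN) (Cell 3 (vXr \<^bold>* V vN \<^bold>+ vXc))))))"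

lemma runs_pairing:
  assumes W: "10 < W" "N * N + 4 * N < W" "Bm N \<le> W" and s: "bounded W s" "s vN 0 = N"
    and T2: "holds N (s aT2) T2" "\<And>r. r < N \<Longrightarrow> s aP2 r = of_bool (r \<in> P2)"
    and T1: "holds N (s aT1) T1" "\<And>r. r < N \<Longrightarrow> s aP1 r = of_bool (r \<in> P1)"
    and S: "\<And>r. r < N \<Longrightarrow> s aMASK r = of_bool (r \<in> S)"
  shows "runs W pairing_prog s (Tm N + 300 * (N * N) + 400)
     (\<lambda>s'. holds N (s' aM) (pairing N S P2 P1 T2 T1) \<and> (\<forall>x\<ge>b + 10. s' x = s x))"
proof -
  have W1: "1 < W" and NW: "N < W" and NNW: "N * N < W" using W(1,2) by linarith+
  define s1 where "s1 = s(0 := (s 0)(0 := N))"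
  have r1: "runs W (Assign 0 (Const 0) (V vN)) s 10 (\<lambda>s'. s' = s1)"
    using s W by (intro runs_Assign) (auto simp: s1_def)
  note b1 = runs_to_bounded[OF r1]
  define A where "A = (\<lambda>r i. of_bool (r \<notin> P2) * (of_bool (i \<in> S) * T2 r i))"
  define B where "B = (\<lambda>i s. of_bool (s \<notin> P1) * T1 s i)"
  have small: "bit_nat x < W" for x using W1 by simp
  have r2: "runs W (Fill vX 1 (Const 0) (V vN \<^bold>* V vN)
        ((Const 1 \<^bold>- Cell aP2 vXc) \<^bold>* (Cell aMASK vXr \<^bold>* Cell aT2 (vXr \<^bold>* V vN \<^bold>+ vXc)))) s1 ((N * N + 1) * 100)
     (\<lambda>s'. holds N (s' 1) (\<lambda>i r. A r i) \<and> (\<forall>x. x \<noteq> vX \<longrightarrow> x \<noteq> 1 \<longrightarrow> s' x = s1 x))"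
  proof (rule runs_mono[OF runs_matrix_fill[OF W1 NNW b1, where A = "\<lambda>i r. A r i"]], goal_cases)
    case prem: (4 t r c)
    have z: "r * N + c < N * N" using index_less[OF prem(1,2)] .
    have v: "t vN 0 = N" "t aP2 c = of_bool (c \<in> P2)" "t aMASK r = of_bool (r \<in> S)" "t aT2 (r * N + c) = bit_nat (T2 c r)"
      using prem(1,2,4) s(2) T2 S by (simp_all add: s1_def holds_def)
    have "bit_nat (A c r) = (1 - of_bool (c \<in> P2)) * (of_bool (r \<in> S) * bit_nat (T2 c r))"
      by (auto simp: A_def bit_nat_mult)
    moreover have "of_bool (r \<in> S) * bit_nat (T2 c r) < W" using small[of "T2 c r"] W1 by simp
    moreover have "r * N < W" using z NNW by linarith
    ultimately show ?case using W1 prem(5,6) z NNW small[of "A c r"]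
      by (simp add: v)
  qed (use s W1 in \<open>auto simp: s1_def\<close>)
  have r3: "runs W (Fill vX 2 (Const 0) (V vN \<^bold>* V vN) ((Const 1 \<^bold>- Cell aP1 vXr) \<^bold>* Cell aT1 (V vX))) s2 ((N * N + 1) * 80)
     (\<lambda>s'. holds N (s' 2) (\<lambda>s i. B i s) \<and> holds N (s' 1) (\<lambda>i r. A r i) \<and> (\<forall>x. x \<noteq> vX \<longrightarrow> x \<noteq> 1 \<longrightarrow> x \<noteq> 2 \<longrightarrow> s' x = s1 x))"
    if b2: "bounded W s2" and s2: "holds N (s2 1) (\<lambda>i r. A r i) \<and> (\<forall>x. x \<noteq> vX \<longrightarrow> x \<noteq> 1 \<longrightarrow> s2 x = s1 x)" for s2
  proof (rule runs_mono[OF runs_matrix_fill[OF W1 NNW b2, where A = "\<lambda>s i. B i s"]], goal_cases)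
    case prem: (4 t r c)
    have v: "t vN 0 = N" "t aP1 r = of_bool (r \<in> P1)" "t aT1 (c * N + r) = bit_nat (T1 r c)"
      using prem(1,2,4) s(2) T1 s2 by (simp_all add: s1_def holds_def)
    have "bit_nat (B c r) = (1 - of_bool (r \<in> P1)) * bit_nat (T1 r c)" by (auto simp: B_def bit_nat_mult)
    then show ?case using W1 prem(3,5,6) NNW small[of "B c r"]
      by (simp add: v)
  qed (use s s2 in \<open>auto simp: s1_def\<close>)
  have r4: "runs W Pm s3 (Tm N) (\<lambda>s'. (\<forall>a\<ge>b + 5. s' a = s3 a) \<and> (\<forall>i<N. \<forall>j<N. s' 3 (i * N + j) = bit_nat (mat_mul N A B i j)))"
    if b3: "bounded W s3" and s3: "holds N (s3 2) (\<lambda>s i. B i s) \<and> holds N (s3 1) (\<lambda>i r. A r i) \<and> (\<forall>x. x \<noteq> vX \<longrightarrow> x \<noteq> 1 \<longrightarrow> x \<noteq> 2 \<longrightarrow> s3 x = s1 x)" for s3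
    by (rule runs_mult[OF W(3) b3]) (use s3 in \<open>auto simp: s1_def holds_def\<close>)
  have AB: "mat_mul N A B r c = pairing N S P2 P1 T2 T1 r c" for r c
    by (simp add: mat_mul_def pairing_def A_def B_def sum_distrib_left mult_ac)
  have r5: "runs W (Fill vX aM (Const 0) (V vN \<^bold>* V vN) (Cell 3 (vXr \<^bold>* V vN \<^bold>+ vXc))) s4 ((N * N + 1) * 80)
     (\<lambda>s'. holds N (s' aM) (pairing N S P2 P1 T2 T1) \<and> (\<forall>x. x \<noteq> vX \<longrightarrow> x \<noteq> aM \<longrightarrow> s' x = s4 x))"
    if b4: "bounded W s4" and s4: "s4 vN 0 = N" "\<forall>i<N. \<forall>j<N. s4 3 (i * N + j) = bit_nat (mat_mul N A B i j)" for s4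
  proof (rule runs_mono[OF runs_matrix_fill[OF W1 NNW b4, where A = "pairing N S P2 P1 T2 T1"]], goal_cases)
    case prem: (4 t r c)
    have z: "r * N + c < N * N" using index_less[OF prem(1,2)] .
    have v: "t vN 0 = N" "t 3 (r * N + c) = bit_nat (pairing N S P2 P1 T2 T1 r c)"
      using prem(1,2,4) s4 by (simp_all add: AB)
    have "r * N < W" using z NNW by linarith
    then show ?case using W1 prem(5,6) z NNW by (simp add: v)
  qed (use s4 in auto)
  have "runs W pairing_prog s (10 + ((N * N + 1) * 100 + ((N * N + 1) * 80 + (Tm N + (N * N + 1) * 80))))
     (\<lambda>s'. holds N (s' aM) (pairing N S P2 P1 T2 T1) \<and> (\<forall>x\<ge>b + 10. s' x = s x))"
    unfolding pairing_prog_def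
  proof (rule runs_Seq_to[OF r1], rule runs_Seq_mid[OF r2 _ order_refl], rule runs_Seq_mid[OF r3 _ order_refl], assumption,
      assumption, rule runs_Seq_mid[OF r4 _ order_refl], assumption, assumption, goal_cases)
    case prem: (1 s2 s3 s4)
    have fr: "s4 x = s x" if "x \<ge> b + 6" for x
      using prem that by (auto simp: s1_def)
    show ?case
      by (rule runs_mono[OF r5[OF prem(5)]]) (use prem fr s in auto)
  qed
  then show ?thesis by (rule runs_mono) auto
qed

end

section \<open>Output of the selected cocycles\<close>

definition sorted_rows :: "nat \<Rightarrow> nat set \<Rightarrow> nat list" where
  "sorted_rows N P = filter (\<lambda>r. r \<in> P) [0..<N]"

lemma sorted_rows: "set (sorted_rows N P) = {r. r < N \<and> r \<in> P}" "distinct (sorted_rows N P)" "length (sorted_rows N P) \<le> N"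
  using length_filter_le[of "\<lambda>r. r \<in> P" "[0..<N]"] by (auto simp: sorted_rows_def)

text \<open>The outcome in terms of linear algebra alone. It separates the verification of the
  program from the topological argument.\<close>

definition annotates :: "nat list list \<Rightarrow> nat \<Rightarrow> nat \<Rightarrow> memory \<Rightarrow> bool" where
  "annotates xs p N s \<longleftrightarrow> (\<exists>T P T' Q T'' B.
     eliminates N (coface_mat xs p) T P \<and> eliminates N (face_mat xs p) T' Q \<and>
     eliminates N (pairing N {i. listed xs (Suc p) i} P Q T T') T'' B \<and>
     s 3 0 = length (sorted_rows N B) \<and>
     (\<forall>i<N. \<forall>q<length (sorted_rows N B). s 4 (i * length (sorted_rows N B) + q) = bit_nat (T (sorted_rows N B ! q) i)))"

context multiplication
begin

definition output_prog :: program where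
  "output_prog =
     Seq (Assign vG (Const 0) (Const 0))
     (Seq (For vX (V vN) (Cond (Cell aP3 (V vX))
        (Seq (Assign aROWS (V vG) (V vX)) (Assign vG (Const 0) (V vG \<^bold>+ Const 1))) Skip))
     (Seq (Assign 3 (Const 0) (V vG))
       (Fill vX 4 (Const 0) (V vN \<^bold>* V vG)
          (Cell aT2 ((V vX \<^bold>div V vG) \<^bold>* V vN \<^bold>+ Cell aROWS (V vX \<^bold>mod V vG))))))"

lemma runs_output:
  fixes N P
  defines "L \<equiv> sorted_rows N P"
  assumes W: "10 < W" "N * N + 4 * N < W" and s: "bounded W s" "s vN 0 = N"
    and T2: "holds N (s aT2) T2" and P: "\<And>r. r < N \<Longrightarrow> s aP3 r = of_bool (r \<in> P)"
  shows "runs W output_prog s (200 * (N * N) + 200 * N + 300)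
     (\<lambda>s'. s' 3 0 = length L \<and> (\<forall>i<N. \<forall>q<length L. s' 4 (i * length L + q) = bit_nat (T2 (L ! q) i)))"
proof -
  have W1: "1 < W" and NW: "N < W" and NNW: "N * N < W" using W(1,2) by linarith+
  define s1 where "s1 = s(vG := (s vG)(0 := 0))"
  have r1: "runs W (Assign vG (Const 0) (Const 0)) s 10 (\<lambda>s'. s' = s1)"
    using s W by (intro runs_Assign) (auto simp: s1_def)
  note b1 = runs_to_bounded[OF r1]
  define I where "I = (\<lambda>i s'. s' vX 0 = i \<and> (\<forall>x. x \<noteq> vX \<longrightarrow> x \<noteq> vG \<longrightarrow> x \<noteq> aROWS \<longrightarrow> s' x = s x) \<and>
     s' vG 0 = length (sorted_rows i P) \<and> (\<forall>q<length (sorted_rows i P). s' aROWS q = sorted_rows i P ! q))"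
  have r2: "runs W (For vX (V vN) (Cond (Cell aP3 (V vX))
        (Seq (Assign aROWS (V vG) (V vX)) (Assign vG (Const 0) (V vG \<^bold>+ Const 1))) Skip)) s1 (90 * N + 50) (I N)"
  proof (rule runs_For[OF W1 b1 NW, where I = I and t = "\<lambda>_. 40"], goal_cases)
    case 1
    then show ?case by (auto simp: I_def s1_def sorted_rows_def)
  next
    case (2 i t)
    then show ?case using s W1 by (auto simp: I_def)
  next
    case prem: (3 i t)
    let ?L = "sorted_rows i P"
    have v: "t vX 0 = i" "t vG 0 = length ?L" "t aP3 i = of_bool (i \<in> P)"
      using prem P by (auto simp: I_def)
    have fr: "\<forall>x. x \<noteq> vX \<longrightarrow> x \<noteq> vG \<longrightarrow> x \<noteq> aROWS \<longrightarrow> t x = s x" and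
      rows: "\<forall>q<length ?L. t aROWS q = ?L ! q" using prem(3) by (auto simp: I_def)
    have lenL: "length ?L < N" using sorted_rows(3)[of i P] prem(1) by simp
    show ?case
    proof (rule runs_Cond[OF prem(2) W1, where t = 30], goal_cases)
      case 1
      then show ?case using W1 by simp
    next
      case 2
      then have iP: "i \<in> P" by (simp add: v)
      then have L: "sorted_rows (Suc i) P = ?L @ [i]" by (simp add: sorted_rows_def)
      define t1 where "t1 = t(aROWS := (t aROWS)(length ?L := i))"
      have q1: "runs W (Assign aROWS (V vG) (V vX)) t 10 (\<lambda>s'. s' = t1)"
        using prem W1 by (intro runs_Assign) (auto simp: t1_def v)
      note b1 = runs_to_bounded[OF q1]
      have q2: "runs W (Assign vG (Const 0) (V vG \<^bold>+ Const 1)) t1 10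
         (\<lambda>s'. s' vX 0 = i \<and> I (Suc i) (s'(vX := (s' vX)(0 := Suc i))))"
        using b1 W1 lenL NW
        by (intro runs_Assign) (auto simp: t1_def v I_def L fr rows less_Suc_eq nth_append)
      show ?case by (rule runs_mono[OF runs_Seq_to[OF q1 q2]]) auto
    next
      case 3
      then have iP: "i \<notin> P" by (simp add: v)
      then have L: "sorted_rows (Suc i) P = ?L" by (simp add: sorted_rows_def)
      show ?case using prem(2)
        by (intro runs_Skip) (auto simp: v I_def L fr rows)
    qed simp
  next
    case 5
    then show ?case by simp
  qed
  have r3: "runs W (Assign 3 (Const 0) (V vG)) s2 10
     (\<lambda>s'. s' 3 0 = length L \<and> s' vG 0 = length L \<and> s' vN 0 = N \<and> s' aT2 = s aT2 \<and> (\<forall>q<length L. s' aROWS q = L ! q))"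
    if "bounded W s2" "I N s2" for s2
    using that W1 s by (intro runs_Assign) (auto simp: I_def L_def)
  have r4: "runs W (Fill vX 4 (Const 0) (V vN \<^bold>* V vG)
          (Cell aT2 ((V vX \<^bold>div V vG) \<^bold>* V vN \<^bold>+ Cell aROWS (V vX \<^bold>mod V vG)))) s3 ((N * N + 1) * 80)
     (\<lambda>s'. s' 3 0 = length L \<and> (\<forall>i<N. \<forall>q<length L. s' 4 (i * length L + q) = bit_nat (T2 (L ! q) i)))"
    if b3: "bounded W s3" and s3: "s3 3 0 = length L \<and> s3 vG 0 = length L \<and> s3 vN 0 = N \<and> s3 aT2 = s aT2 \<and> (\<forall>q<length L. s3 aROWS q = L ! q)" for s3
  proof -
    have g: "N * length L \<le> N * N" using sorted_rows(3)[of N P] by (simp add: L_def)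
    then have gW: "N * length L < W" using NNW by linarith
    show ?thesis
    proof (rule runs_Fill[OF W1 b3 gW, where d = 0 and f = "\<lambda>x. bit_nat (T2 (L ! (x mod length L)) (x div length L))"], goal_cases)
      case (3 i h)
      have i: "i div length L < N" "i mod length L < length L"
        using 3(1) by (auto simp: less_mult_imp_div_less intro!: mod_less_divisor Nat.gr0I)
      have Lr: "L ! (i mod length L) < N" using nth_mem[OF i(2)] sorted_rows(1)[of N P] by (auto simp: L_def)
      have z: "i div length L * N + L ! (i mod length L) < N * N" using index_less[OF i(1) Lr] .
      have z2: "i div length L * N < W" using z NNW by linarith
      have "s aT2 (i div length L * N + L ! (i mod length L)) = bit_nat (T2 (L ! (i mod length L)) (i div length L))"
        using T2 i Lr by (simp add: holds_def)
      then show ?case using s3 3(1) gW W1 NNW z z2 i by simp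
    next
      case 5
      show ?case using g by (intro mult_le_mono) auto
    qed (use s3 W1 gW in \<open>auto simp: filled_index index_div_mod\<close>)
  qed
  have "runs W output_prog s (10 + ((90 * N + 50) + (10 + (N * N + 1) * 80)))
     (\<lambda>s'. s' 3 0 = length L \<and> (\<forall>i<N. \<forall>q<length L. s' 4 (i * length L + q) = bit_nat (T2 (L ! q) i)))"
    unfolding output_prog_def
    by (rule runs_Seq_to[OF r1], rule runs_Seq_mid[OF r2 _ order_refl], rule runs_Seq_mid[OF r3 r4 order_refl])
  then show ?thesis by (rule runs_mono) auto
qed

section \<open>The whole program\<close>

definition annotate_prog :: program where
  "annotate_prog =
     Seq size_prog (Seq input_prog
     (Seq coface_prog (Seq (reduce_prog aT2 aP2)
     (Seq face_prog (Seq (reduce_prog aT1 aP1)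
     (Seq pairing_prog (Seq (reduce_prog aT3 aP3) output_prog)))))))"

definition annotate_time :: "nat \<Rightarrow> nat \<Rightarrow> nat" where
  "annotate_time N l = 3 * reduce_time N + Tm N + 2000 * (N * N) + 2000 * N + 3000 + N * N * (l * l * 100)"

lemma runs_annotate:
  fixes xs :: "nat list list"
  defines "N \<equiv> padded (length xs)"
  assumes W: "10 < W" "N * N + 4 * N < W" "l * l < W" "\<And>k. k \<le> N \<Longrightarrow> Bm k \<le> W" and s: "bounded W s"
    and inp: "annotation_input (K, xs, p) s"
    and xs: "\<And>vs. vs \<in> set xs \<Longrightarrow> distinct vs \<and> vs \<noteq> [] \<and> length vs \<le> l"
  shows "runs W annotate_prog s (annotate_time N l) (annotates xs p N)"
proof -
  have le: "length xs \<le> N" "N = 2 ^ (LEAST v. length xs \<le> 2 ^ v)" unfolding N_def using padded(1) by (simp_all add: padded_def)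
  note inp' = inp[unfolded annotation_input_def prod.case]
  have W2: "2 * length xs < W" using W(2) le(1) by linarith
  define s1 where "s1 = s(vN := (s vN)(0 := N))"
  have r1: "runs W size_prog s (100 * N + 100) (\<lambda>s'. s' = s1)"
    unfolding s1_def N_def using inp' by (intro runs_size W W2 s) auto
  note b1 = runs_to_bounded[OF r1]
  have r2: "runs W input_prog s1 (300 * (N * N) + 300 * N + 300 + N * N * (l * l * 100)) (prepared xs p N)"
    by (rule runs_input[OF W(1-3) b1]) (use inp' xs le in \<open>auto simp: s1_def\<close>)
  define S2 where "S2 = (\<lambda>T P s. prepared xs p N s \<and> eliminates N (coface_mat xs p) T P \<and> holds N (s aT2) T \<and> (\<forall>r<N. s aP2 r = of_bool (r \<in> P)))"
  have r3: "runs W coface_prog s ((N * N + 1) * 100) (\<lambda>s'. prepared xs p N s' \<and> holds N (s' aM) (coface_mat xs p))"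
    if b: "bounded W s" and prep: "prepared xs p N s" for s
    by (rule runs_mono[OF runs_coface[OF W(1,2) b prep]]) (use xs prep in \<open>auto simp: prepared_def\<close>)
  have r4: "runs W (reduce_prog aT2 aP2) s (reduce_time N) (\<lambda>s'. \<exists>T P. S2 T P s')"
    if b: "bounded W s" and prep: "prepared xs p N s \<and> holds N (s aM) (coface_mat xs p)" for s
  proof (rule runs_mono[OF runs_reduce[OF W(1,2,4) b le(2), where A = "coface_mat xs p"]], goal_cases)
    case (8 s')
    then obtain T P where "eliminates N (coface_mat xs p) T P" "holds N (s' aT2) T" "\<forall>r<N. s' aP2 r = of_bool (r \<in> P)"
      "\<forall>x\<ge>b + 18. x \<noteq> aT2 \<longrightarrow> x \<noteq> aP2 \<longrightarrow> s' x = s x" by blast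
    then show ?case unfolding S2_def using prep by (intro exI[of _ T] exI[of _ P]) (auto simp: prepared_def)
  qed (use prep in \<open>auto simp: prepared_def\<close>)
  define S1 where "S1 = (\<lambda>T P T' Q s. S2 T P s \<and> eliminates N (face_mat xs p) T' Q \<and> holds N (s aT1) T' \<and> (\<forall>r<N. s aP1 r = of_bool (r \<in> Q)))"
  have r5: "runs W face_prog s ((N * N + 1) * 100) (\<lambda>s'. S2 T P s' \<and> holds N (s' aM) (face_mat xs p))"
    if b: "bounded W s" and S: "S2 T P s" for s T P
  proof (rule runs_mono[OF runs_face[OF W(1,2) b, where xs = xs and p = p]], goal_cases)
    case (4 s')
    then show ?case using S by (auto simp: S2_def prepared_def)
  qed (use S xs in \<open>auto simp: S2_def\<close>)
  have r6: "runs W (reduce_prog aT1 aP1) s (reduce_time N) (\<lambda>s'. \<exists>T' Q. S1 T P T' Q s')"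
    if b: "bounded W s" and S: "S2 T P s \<and> holds N (s aM) (face_mat xs p)" for s T P
  proof (rule runs_mono[OF runs_reduce[OF W(1,2,4) b le(2), where A = "face_mat xs p"]], goal_cases)
    case (8 s')
    then obtain T' Q where "eliminates N (face_mat xs p) T' Q" "holds N (s' aT1) T'" "\<forall>r<N. s' aP1 r = of_bool (r \<in> Q)"
      "\<forall>x\<ge>b + 18. x \<noteq> aT1 \<longrightarrow> x \<noteq> aP1 \<longrightarrow> s' x = s x" by blast
    then show ?case unfolding S1_def using S by (intro exI[of _ T'] exI[of _ Q]) (auto simp: S2_def prepared_def)
  qed (use S in \<open>auto simp: S2_def prepared_def\<close>)
  let ?S = "{i. listed xs (Suc p) i}"
  have r7: "runs W pairing_prog s (Tm N + 300 * (N * N) + 400) (\<lambda>s'. S1 T P T' Q s' \<and> holds N (s' aM) (pairing N ?S P Q T T'))"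
    if b: "bounded W s" and S: "S1 T P T' Q s" for s T P T' Q
  proof (rule runs_mono[OF runs_pairing[OF W(1,2) _ b, where S = ?S and ?T2.0 = T and ?P2.0 = P and ?T1.0 = T' and ?P1.0 = Q]], goal_cases)
    case (9 s')
    then show ?case using S by (auto simp: S1_def S2_def prepared_def)
  qed (use S W(4) in \<open>auto simp: S1_def S2_def prepared_def\<close>)
  define S3 where "S3 = (\<lambda>T P T' Q T'' B s. S1 T P T' Q s \<and> eliminates N (pairing N ?S P Q T T') T'' B \<and> (\<forall>r<N. s aP3 r = of_bool (r \<in> B)))"
  have r8: "runs W (reduce_prog aT3 aP3) s (reduce_time N) (\<lambda>s'. \<exists>T'' B. S3 T P T' Q T'' B s')"
    if b: "bounded W s" and S: "S1 T P T' Q s \<and> holds N (s aM) (pairing N ?S P Q T T')" for s T P T' Q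
  proof (rule runs_mono[OF runs_reduce[OF W(1,2,4) b le(2), where A = "pairing N ?S P Q T T'"]], goal_cases)
    case (8 s')
    then obtain T'' B where "eliminates N (pairing N ?S P Q T T') T'' B" "\<forall>r<N. s' aP3 r = of_bool (r \<in> B)"
      "\<forall>x\<ge>b + 18. x \<noteq> aT3 \<longrightarrow> x \<noteq> aP3 \<longrightarrow> s' x = s x" by blast
    then show ?case unfolding S3_def using S by (intro exI[of _ T''] exI[of _ B]) (auto simp: S1_def S2_def prepared_def)
  qed (use S in \<open>auto simp: S1_def S2_def prepared_def\<close>)
  have r9: "runs W output_prog s (200 * (N * N) + 200 * N + 300) (annotates xs p N)"
    if b: "bounded W s" and S: "S3 T P T' Q T'' B s" for s T P T' Q T'' B
  proof (rule runs_mono[OF runs_output[OF W(1,2) b, where ?T2.0 = T and P = B]], goal_cases)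
    case (5 s')
    then show ?case using S unfolding S3_def S1_def S2_def annotates_def by blast
  qed (use S in \<open>auto simp: S3_def S1_def S2_def prepared_def\<close>)
  \<comment> \<open>The matrices found by a reduction exist only from the state that it reaches. The
    program is therefore verified from its end, each tail for arbitrary matrices found before
    it.\<close>
  let ?P8 = "Seq (reduce_prog aT3 aP3) output_prog"
  let ?t8 = "reduce_time N + (200 * (N * N) + 200 * N + 300)"
  let ?P6 = "Seq (reduce_prog aT1 aP1) (Seq pairing_prog ?P8)"
  let ?t6 = "reduce_time N + ((Tm N + 300 * (N * N) + 400) + ?t8)"
  let ?P4 = "Seq (reduce_prog aT2 aP2) (Seq face_prog ?P6)"
  let ?t4 = "reduce_time N + ((N * N + 1) * 100 + ?t6)"
  have t8: "runs W ?P8 s ?t8 (annotates xs p N)"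
    if "bounded W s" "S1 T P T' Q s \<and> holds N (s aM) (pairing N ?S P Q T T')" for s T P T' Q
    by (rule runs_Seq_mid[OF r8[OF that] _ order_refl]) (use r9 in blast)
  have t6: "runs W ?P6 s
     ?t6 (annotates xs p N)"
    if "bounded W s" "S2 T P s \<and> holds N (s aM) (face_mat xs p)" for s T P
  proof (rule runs_Seq_mid[OF r6[OF that] _ order_refl])
    fix s' assume b: "bounded W s'" and "\<exists>T' Q. S1 T P T' Q s'"
    then obtain T' Q where "S1 T P T' Q s'" by blast
    note next_step = r7[OF b this]
    show "runs W (Seq pairing_prog ?P8) s' ((Tm N + 300 * (N * N) + 400) + ?t8) (annotates xs p N)"
      by (rule runs_Seq_mid[OF next_step _ order_refl]) (rule t8)
  qed
  have t4: "runs W ?P4 s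
     ?t4 (annotates xs p N)"
    if "bounded W s" "prepared xs p N s \<and> holds N (s aM) (coface_mat xs p)" for s
  proof (rule runs_Seq_mid[OF r4[OF that] _ order_refl])
    fix s' assume b: "bounded W s'" and "\<exists>T P. S2 T P s'"
    then obtain T P where "S2 T P s'" by blast
    note next_step = r5[OF b this]
    show "runs W (Seq face_prog ?P6) s'
      ((N * N + 1) * 100 + ?t6) (annotates xs p N)"
      by (rule runs_Seq_mid[OF next_step _ order_refl]) (rule t6)
  qed
  have "runs W annotate_prog s ((100 * N + 100) + ((300 * (N * N) + 300 * N + 300 + N * N * (l * l * 100)) + ((N * N + 1) * 100 +
     ?t4)))
     (annotates xs p N)"
    unfolding annotate_prog_def
    by (rule runs_Seq_to[OF r1], rule runs_Seq_mid[OF r2 _ order_refl], rule runs_Seq_mid[OF r3 t4 order_refl])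
  then show ?thesis by (rule runs_mono) (auto simp: annotate_time_def)
qed

end

section \<open>Coordinates on homology\<close>

lemma bit_vec_add_self: "(y :: bit vec) \<in> carrier_vec g \<Longrightarrow> y + y = 0\<^sub>v g"
  by (rule eq_vecI) auto

text \<open>Classes are the fibres of \<open>\<phi>\<close>, so sending a vector to its fibre is a
  bijection onto the homology. It respects addition and scalars, so the vector space axioms carry
  over along it, and it preserves the dimension.\<close>

lemma homology_coordinates:
  fixes \<phi> :: "'v set set \<Rightarrow> bit vec"
  assumes cyc: "{} \<in> cycles K p" "\<And>z z'. z \<in> cycles K p \<Longrightarrow> z' \<in> cycles K p \<Longrightarrow> sym_diff z z' \<in> cycles K p"
    and B: "boundaries K p \<subseteq> cycles K p"
    and closed: "\<And>z. z \<in> cycles K p \<Longrightarrow> \<phi> z \<in> carrier_vec g"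
    and surj: "\<And>y. y \<in> carrier_vec g \<Longrightarrow> \<exists>z\<in>cycles K p. \<phi> z = y"
    and add: "\<And>z z'. z \<in> cycles K p \<Longrightarrow> z' \<in> cycles K p \<Longrightarrow> \<phi> (sym_diff z z') = \<phi> z + \<phi> z'"
    and ker: "\<And>z. z \<in> cycles K p \<Longrightarrow> \<phi> z = 0\<^sub>v g \<longleftrightarrow> z \<in> boundaries K p"
  shows "homology_dim K p = g \<and> (\<forall>z\<in>cycles K p. \<forall>z'\<in>cycles K p.
    homology_class K p z = homology_class K p z' \<longleftrightarrow> \<phi> z = \<phi> z')"
proof -
  \<comment> \<open>The fibre over \<open>y\<close>, which turns out to be the homology class with
    coordinates \<open>y\<close>.\<close>
  define T where "T y = {z \<in> cycles K p. \<phi> z = y}" for y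
  let ?H = "homology K p" and ?B = "boundaries K p"
  have coset: "?B #>\<^bsub>cycle_group K p\<^esub> z = T (\<phi> z)" if z: "z \<in> cycles K p" for z
  proof (intro equalityI subsetI)
    fix w assume "w \<in> ?B #>\<^bsub>cycle_group K p\<^esub> z"
    then obtain h where h: "h \<in> ?B" "w = sym_diff h z" by (auto simp: r_coset_def cycle_group_def)
    then have hc: "h \<in> cycles K p" "\<phi> h = 0\<^sub>v g" using B ker by auto
    then show "w \<in> T (\<phi> z)" using h(2) cyc(2)[OF hc(1) z] add[OF hc(1) z] closed[OF z] by (simp add: T_def)
  next
    fix w assume "w \<in> T (\<phi> z)"
    then have w: "w \<in> cycles K p" "\<phi> w = \<phi> z" by (auto simp: T_def)
    have "\<phi> (sym_diff w z) = 0\<^sub>v g" using add[OF w(1) z] w(2) bit_vec_add_self[OF closed[OF z]] by simp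
    then have "sym_diff w z \<in> ?B" using ker[OF cyc(2)[OF w(1) z]] by simp
    moreover have "w = sym_diff (sym_diff w z) z" by auto
    ultimately show "w \<in> ?B #>\<^bsub>cycle_group K p\<^esub> z" by (auto simp: r_coset_def cycle_group_def)
  qed
  have inj: "y = y'" if "y \<in> carrier_vec g" "T y = T y'" for y y'
    using surj[OF that(1)] that(2) by (auto simp: T_def)
  have cls: "homology_class K p z = homology_class K p z' \<longleftrightarrow> \<phi> z = \<phi> z'"
    if "z \<in> cycles K p" "z' \<in> cycles K p" for z z'
    unfolding homology_class_def coset[OF that(1)] coset[OF that(2)] using inj closed[OF that(1)] by auto
  have \<phi>0: "\<phi> {} = 0\<^sub>v g" using add[OF cyc(1) cyc(1)] closed[OF cyc(1)] bit_vec_add_self by simp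
  have BT: "?B = T (0\<^sub>v g)" using coset[OF cyc(1)] B by (auto simp: \<phi>0 T_def ker)
  have mult: "T y <#>\<^bsub>cycle_group K p\<^esub> T y' = T (y + y')" if y: "y \<in> carrier_vec g" "y' \<in> carrier_vec g" for y y'
  proof (intro equalityI subsetI)
    fix w assume "w \<in> T y <#>\<^bsub>cycle_group K p\<^esub> T y'"
    then show "w \<in> T (y + y')" using cyc(2) add by (auto simp: set_mult_def cycle_group_def T_def)
  next
    fix w assume "w \<in> T (y + y')"
    then have w: "w \<in> cycles K p" "\<phi> w = y + y'" by (auto simp: T_def)
    obtain z where z: "z \<in> cycles K p" "\<phi> z = y" using surj[OF y(1)] by blast
    have "\<phi> (sym_diff z w) = y + (y + y')" using add[OF z(1) w(1)] z w by simp
    also have "\<dots> = (y + y) + y'" using y by (simp add: assoc_add_vec[of y g y y'])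
    also have "\<dots> = y'" using y bit_vec_add_self[OF y(1)] by simp
    finally have "sym_diff z w \<in> T y'" using cyc(2)[OF z(1) w(1)] by (simp add: T_def)
    moreover have "z \<in> T y" using z by (simp add: T_def)
    moreover have "w = sym_diff z (sym_diff z w)" by auto
    ultimately show "w \<in> T y <#>\<^bsub>cycle_group K p\<^esub> T y'"
      unfolding set_mult_def cycle_group_def by (simp del: Un_iff) blast
  qed
  have carr: "carrier ?H = T ` carrier_vec g"
  proof -
    have "carrier ?H = (\<lambda>z. T (\<phi> z)) ` cycles K p"
      using coset by (auto simp: homology_def FactGroup_def RCOSETS_def) (auto simp: cycle_group_def)
    also have "\<dots> = T ` carrier_vec g" using closed surj by (auto simp: image_iff)
    finally show ?thesis .
  qed
  have H: "zero ?H = T (0\<^sub>v g)" "\<And>y y'. y \<in> carrier_vec g \<Longrightarrow> y' \<in> carrier_vec g \<Longrightarrow> add ?H (T y) (T y') = T (y + y')"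
    "\<And>c y. y \<in> carrier_vec g \<Longrightarrow> smult ?H c (T y) = T (c \<cdot>\<^sub>v y)"
  proof -
    have "0 \<cdot>\<^sub>v y = 0\<^sub>v g" "1 \<cdot>\<^sub>v y = y" if "y \<in> carrier_vec g" for y :: "bit vec"
      using that by (auto intro!: eq_vecI)
    then show "smult ?H c (T y) = T (c \<cdot>\<^sub>v y)" if "y \<in> carrier_vec g" for c y
      using that BT by (cases c) (simp_all add: homology_def)
  qed (use mult BT in \<open>auto simp: homology_def FactGroup_def\<close>)
  have ag: "abelian_group ?H"
  proof (rule abelian_groupI)
    fix x assume "x \<in> carrier ?H"
    then obtain y where y: "y \<in> carrier_vec g" "x = T y" using carr by auto
    then show "\<exists>y\<in>carrier ?H. y \<oplus>\<^bsub>?H\<^esub> x = \<zero>\<^bsub>?H\<^esub>"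
      using H bit_vec_add_self[OF y(1)] carr y by (intro bexI[of _ x]) auto
  qed (auto simp: carr H comm_add_vec assoc_add_vec[of _ g])
  have vs: "vectorspace class_ring ?H"
  proof -
    have "Module.module class_ring ?H"
    proof (rule moduleI)
      show "cring (class_ring :: bit ring)" by (rule Module.module.axioms(1)[OF vec_module])
    qed (auto simp: ag carr H class_ring_simps add_smult_distrib_vec smult_add_distrib_vec[of _ g] smult_smult_assoc)
    then show ?thesis by (simp add: vectorspace_def class_field)
  qed
  have hom: "T \<in> LinearCombinations.module_hom class_ring (module_vec TYPE(bit) g) ?H"
    by (simp add: LinearCombinations.module_hom_def carr H module_vec_simps)
  interpret V: vec_space "TYPE(bit)" g .
  interpret W: vectorspace class_ring ?H by (rule vs)
  interpret L: linear_map class_ring "module_vec TYPE(bit) g" ?H T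
    by unfold_locales (rule hom)
  have "V.dim = W.dim"
  proof (rule L.dim_eq[OF V.fin_dim])
    show "inj_on T (carrier (module_vec TYPE(bit) g))" using inj by (intro inj_onI) (simp add: module_vec_simps)
    show "T ` carrier (module_vec TYPE(bit) g) = carrier ?H" by (simp add: carr module_vec_simps)
  qed
  then show ?thesis unfolding homology_dim_def using V.dim_is_n cls by simp
qed

section \<open>Correctness of the annotation\<close>

lemma sum_of_bool_bit: "finite A \<Longrightarrow> (\<Sum>x\<in>A. of_bool (P x) :: bit) = of_bool (odd (card {x\<in>A. P x}))"
proof (induction A rule: finite_induct)
  case (insert x A)
  have "{y \<in> insert x A. P y} = (if P x then insert x {y\<in>A. P y} else {y\<in>A. P y})" by auto
  then show ?case using insert by (auto simp: of_bool_def)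
qed simp

locale listed_complex =
  fixes K :: "nat set set" and xs :: "nat list list" and p N :: nat
  assumes complex: "finite_simplicial_complex K" and lists: "lists_complex xs K"
    and N: "length xs \<le> N"
begin

definition \<sigma> :: "nat \<Rightarrow> nat set" where "\<sigma> i = set (xs ! i)"

lemma \<sigma>_bij: "bij_betw \<sigma> {..<length xs} K"
proof -
  have "distinct (map set xs)" "set (map set xs) = K" using lists by (auto simp: lists_complex_def)
  then have "bij_betw ((!) (map set xs)) {..<length xs} K" by (intro bij_betw_nth) auto
  then show ?thesis by (rule bij_betw_cong[THEN iffD1, rotated]) (simp add: \<sigma>_def)
qed

lemma \<sigma>_inj: "i < length xs \<Longrightarrow> j < length xs \<Longrightarrow> \<sigma> i = \<sigma> j \<longleftrightarrow> i = j"
  using \<sigma>_bij by (auto simp: bij_betw_def inj_on_def)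

lemma card_\<sigma>: "i < length xs \<Longrightarrow> card (\<sigma> i) = length (xs ! i)"
  using lists by (auto simp: lists_complex_def \<sigma>_def intro!: distinct_card)

lemma \<sigma>_K: "i < length xs \<Longrightarrow> \<sigma> i \<in> K"
  using \<sigma>_bij by (auto simp: bij_betw_def)

lemma \<sigma>_cases: "\<rho> \<in> K \<Longrightarrow> (\<And>i. i < length xs \<Longrightarrow> \<rho> = \<sigma> i \<Longrightarrow> thesis) \<Longrightarrow> thesis"
  using \<sigma>_bij unfolding bij_betw_def by blast

lemma listed_iff: "listed xs d i \<longleftrightarrow> i < length xs \<and> card (\<sigma> i) = d"
  using card_\<sigma> by (auto simp: listed_def)

lemma listed_simplices: "listed xs (Suc d) i \<longleftrightarrow> i < length xs \<and> \<sigma> i \<in> simplices K d"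
  using \<sigma>_K by (auto simp: listed_iff simplices_def)

lemma finite_K: "finite K" and subset_closed: "\<rho> \<in> K \<Longrightarrow> \<tau> \<subseteq> \<rho> \<Longrightarrow> \<tau> \<noteq> {} \<Longrightarrow> \<tau> \<in> K"
  and finite_simplex: "\<rho> \<in> K \<Longrightarrow> finite \<rho>"
  using complex unfolding finite_simplicial_complex_def by meson+

definition chain_vec :: "nat set set \<Rightarrow> nat \<Rightarrow> bit" where
  "chain_vec z i = of_bool (i < length xs \<and> \<sigma> i \<in> z)"

lemma chain_finite: "z \<in> chains K d \<Longrightarrow> finite z" "z \<in> chains K d \<Longrightarrow> z \<subseteq> K"
  using finite_K finite_subset[of z K] by (auto simp: chains_def simplices_def)

text \<open>Sums over indices with values in \<int>_2 are parities of such counts; this turns them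
  into parities of numbers of simplices, as in the definition of the boundary.\<close>

lemma card_chain:
  assumes "z \<subseteq> K"
  shows "card {r\<in>{..<N}. r < length xs \<and> \<sigma> r \<in> z \<and> Q (\<sigma> r)} = card {\<rho>\<in>z. Q \<rho>}"
proof (rule bij_betw_same_card[of \<sigma>])
  show "bij_betw \<sigma> {r\<in>{..<N}. r < length xs \<and> \<sigma> r \<in> z \<and> Q (\<sigma> r)} {\<rho>\<in>z. Q \<rho>}"
  proof (rule bij_betw_imageI)
    show "inj_on \<sigma> {r\<in>{..<N}. r < length xs \<and> \<sigma> r \<in> z \<and> Q (\<sigma> r)}" 
    proof (rule inj_onI)
      fix i j assume "i \<in> {r\<in>{..<N}. r < length xs \<and> \<sigma> r \<in> z \<and> Q (\<sigma> r)}" "j \<in> {r\<in>{..<N}. r < length xs \<and> \<sigma> r \<in> z \<and> Q (\<sigma> r)}" "\<sigma> i = \<sigma> j"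
      then show "i = j" using \<sigma>_inj[of i j] by simp
    qed
    show "\<sigma> ` {r\<in>{..<N}. r < length xs \<and> \<sigma> r \<in> z \<and> Q (\<sigma> r)} = {\<rho>\<in>z. Q \<rho>}"
    proof (intro equalityI subsetI)
      fix \<rho> assume \<rho>: "\<rho> \<in> {\<rho>\<in>z. Q \<rho>}"
      then have "\<rho> \<in> K" using assms by blast
      then obtain i where "i < length xs" "\<rho> = \<sigma> i" by (rule \<sigma>_cases)
      then show "\<rho> \<in> \<sigma> ` {r\<in>{..<N}. r < length xs \<and> \<sigma> r \<in> z \<and> Q (\<sigma> r)}" using \<rho> N by auto
    qed auto
  qed
qed

lemma chain_vec_sym_diff: "chain_vec (sym_diff z z') i = chain_vec z i + chain_vec z' i"
  by (auto simp: chain_vec_def)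

lemma chain_vec_inj:
  assumes "z \<subseteq> K" "z' \<subseteq> K" "\<And>i. i < N \<Longrightarrow> chain_vec z i = chain_vec z' i"
  shows "z = z'"
proof -
  have "\<rho> \<in> z \<longleftrightarrow> \<rho> \<in> z'" if \<rho>: "\<rho> \<in> K" for \<rho>
  proof -
    obtain i where i: "i < length xs" "\<rho> = \<sigma> i" using \<rho> by (rule \<sigma>_cases)
    then show ?thesis using assms(3)[of i] N by (cases "\<sigma> i \<in> z"; cases "\<sigma> i \<in> z'") (simp_all add: chain_vec_def)
  qed
  then show ?thesis using assms by blast
qed

lemma chain_of_vec:
  assumes "\<And>i. i < N \<Longrightarrow> \<not> listed xs (Suc d) i \<Longrightarrow> v i = 0"
  shows "\<exists>z\<in>chains K d. \<forall>i<N. chain_vec z i = v i"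
proof -
  define z where "z = \<sigma> ` {i. i < length xs \<and> v i = 1}"
  have "z \<in> chains K d"
  proof -
    have "\<sigma> i \<in> simplices K d" if "i < length xs" "v i = 1" for i
      using assms[of i] that N listed_simplices[of d i] by (cases "listed xs (Suc d) i") auto
    then show ?thesis by (auto simp: z_def chains_def)
  qed
  moreover have "chain_vec z i = v i" if "i < N" for i
    using assms[OF that] \<sigma>_inj by (cases "v i") (auto simp: chain_vec_def z_def listed_def)
  ultimately show ?thesis by blast
qed

text \<open>The chain multiplies from the left because \<open>face_mat\<close> is
  transposed.\<close>

lemma face_mat_chain:
  assumes "z \<in> chains K p" "c < N"
  shows "(\<Sum>r<N. chain_vec z r * face_mat xs p r c) = of_bool (c < length xs \<and> \<sigma> c \<in> boundary K p z)"
proof -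
  have z: "z \<subseteq> simplices K p" "z \<subseteq> K" using assms chain_finite by (auto simp: chains_def)
  have "(\<Sum>r<N. chain_vec z r * face_mat xs p r c) =
     (\<Sum>r<N. of_bool (listed xs p c \<and> r < length xs \<and> \<sigma> r \<in> z \<and> \<sigma> c \<subseteq> \<sigma> r))"
    using z by (intro sum.cong refl) (auto simp: chain_vec_def face_mat_def listed_simplices \<sigma>_def[symmetric])
  also have "\<dots> = of_bool (listed xs p c \<and> odd (card {\<rho>\<in>z. \<sigma> c \<subseteq> \<rho>}))"
    using card_chain[OF z(2), of "\<lambda>\<rho>. \<sigma> c \<subseteq> \<rho>"] by (cases "listed xs p c") (simp_all add: sum_of_bool_bit del: sum_of_bool_eq)
  also have "\<dots> = of_bool (c < length xs \<and> \<sigma> c \<in> boundary K p z)"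
    using \<sigma>_K by (auto simp: boundary_def listed_iff)
  finally show ?thesis .
qed

lemma coface_mat_chain:
  assumes "w \<in> chains K (Suc p)" "r < N"
  shows "mat_vec N (coface_mat xs p) (chain_vec w) r = chain_vec (boundary K (Suc p) w) r"
proof -
  have w: "w \<subseteq> simplices K (Suc p)" "w \<subseteq> K" using assms chain_finite by (auto simp: chains_def)
  have "mat_vec N (coface_mat xs p) (chain_vec w) r =
     (\<Sum>c<N. of_bool (listed xs (Suc p) r \<and> c < length xs \<and> \<sigma> c \<in> w \<and> \<sigma> r \<subseteq> \<sigma> c))"
    unfolding mat_vec_def using w
    by (intro sum.cong refl) (auto simp: chain_vec_def coface_mat_def listed_simplices \<sigma>_def[symmetric])
  also have "\<dots> = of_bool (listed xs (Suc p) r \<and> odd (card {\<rho>\<in>w. \<sigma> r \<subseteq> \<rho>}))"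
    using card_chain[OF w(2), of "\<lambda>\<rho>. \<sigma> r \<subseteq> \<rho>"] by (cases "listed xs (Suc p) r") (simp_all add: sum_of_bool_bit del: sum_of_bool_eq)
  also have "\<dots> = chain_vec (boundary K (Suc p) w) r"
    using \<sigma>_K by (auto simp: boundary_def listed_iff chain_vec_def)
  finally show ?thesis .
qed

lemma cycle_iff: "z \<in> cycles K p \<longleftrightarrow> z \<in> chains K p \<and> (\<forall>c<N. (\<Sum>r<N. chain_vec z r * face_mat xs p r c) = 0)"
proof -
  have "boundary K p z = {} \<longleftrightarrow> (\<forall>c<N. \<not> (c < length xs \<and> \<sigma> c \<in> boundary K p z))"
  proof -
    have "\<exists>c<N. c < length xs \<and> \<sigma> c \<in> boundary K p z" if \<rho>: "\<rho> \<in> boundary K p z" for \<rho>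
    proof -
      have "\<rho> \<in> K" using \<rho> by (simp add: boundary_def)
      then obtain c where "c < length xs" "\<rho> = \<sigma> c" by (rule \<sigma>_cases)
      then show ?thesis using \<rho> N by (intro exI[of _ c]) simp
    qed
    then show ?thesis by blast
  qed
  then show ?thesis using face_mat_chain by (auto simp: cycles_def)
qed

lemma boundary_iff:
  assumes "z \<in> chains K p"
  shows "z \<in> boundaries K p \<longleftrightarrow> (\<exists>w. \<forall>r<N. chain_vec z r = mat_vec N (coface_mat xs p) w r)"
proof
  assume "z \<in> boundaries K p"
  then obtain w where "w \<in> chains K (Suc p)" "z = boundary K (Suc p) w" by (auto simp: boundaries_def)
  then show "\<exists>w. \<forall>r<N. chain_vec z r = mat_vec N (coface_mat xs p) w r"
    using coface_mat_chain by (intro exI[of _ "chain_vec w"]) auto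
next
  assume "\<exists>w. \<forall>r<N. chain_vec z r = mat_vec N (coface_mat xs p) w r"
  then obtain v where v: "\<And>r. r < N \<Longrightarrow> chain_vec z r = mat_vec N (coface_mat xs p) v r" by blast
  \<comment> \<open>The solution may be nonzero at indices that are not (p + 1)-simplices. The
    columns of the matrix vanish there, so these entries can be cut off to obtain a chain.\<close>
  obtain w where w: "w \<in> chains K (Suc p)" "\<And>i. i < N \<Longrightarrow> chain_vec w i = (if listed xs (Suc (Suc p)) i then v i else 0)"
    using chain_of_vec[of "Suc p" "\<lambda>i. if listed xs (Suc (Suc p)) i then v i else 0"] by auto
  have "mat_vec N (coface_mat xs p) v r = mat_vec N (coface_mat xs p) (chain_vec w) r" for r
    unfolding mat_vec_def using w by (intro sum.cong refl) (auto simp: coface_mat_def)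
  then have "z = boundary K (Suc p) w"
    using v coface_mat_chain[OF w(1)] chain_finite(2)[OF assms]
    by (intro chain_vec_inj) (auto simp: boundary_def)
  then show "z \<in> boundaries K p" using w(1) by (auto simp: boundaries_def)
qed

text \<open>Between a simplex and a face of codimension 2 there are exactly two simplices.\<close>

lemma coface_face:
  assumes "c < N" "c' < N"
  shows "(\<Sum>r<N. coface_mat xs p r c * face_mat xs p r c') = 0"
proof -
  let ?A = "{\<rho>\<in>simplices K p. \<sigma> c' \<subseteq> \<rho> \<and> \<rho> \<subseteq> \<sigma> c}"
  have "(\<Sum>r<N. coface_mat xs p r c * face_mat xs p r c') =
    (\<Sum>r<N. of_bool (listed xs (Suc (Suc p)) c \<and> listed xs p c' \<and> r < length xs \<and> \<sigma> r \<in> simplices K p \<and> \<sigma> c' \<subseteq> \<sigma> r \<and> \<sigma> r \<subseteq> \<sigma> c))"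
    by (intro sum.cong refl) (auto simp: coface_mat_def face_mat_def listed_simplices[of p] \<sigma>_def[symmetric])
  also have "\<dots> = of_bool (listed xs (Suc (Suc p)) c \<and> listed xs p c' \<and> odd (card ?A))"
    using card_chain[of "simplices K p" "\<lambda>\<rho>. \<sigma> c' \<subseteq> \<rho> \<and> \<rho> \<subseteq> \<sigma> c"]
    by (cases "listed xs (Suc (Suc p)) c \<and> listed xs p c'") (auto simp: sum_of_bool_bit simplices_def simp del: sum_of_bool_eq)
  also have "even (card ?A)" if l: "listed xs (Suc (Suc p)) c" "listed xs p c'"
  proof (cases "\<sigma> c' \<subseteq> \<sigma> c")
    case True
    have \<sigma>: "\<sigma> c \<in> K" "finite (\<sigma> c)" "card (\<sigma> c) = Suc (Suc p)" "card (\<sigma> c') = p" using l \<sigma>_K finite_simplex by (auto simp: listed_iff)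
    \<comment> \<open>A simplex in between omits one vertex of the large simplex, and this must be
      one of the two vertices outside the small one.\<close>
    have "?A = (\<lambda>v. \<sigma> c - {v}) ` (\<sigma> c - \<sigma> c')"
    proof (intro equalityI subsetI)
      fix \<rho> assume "\<rho> \<in> ?A"
      then have \<rho>: "card \<rho> = Suc p" "\<sigma> c' \<subseteq> \<rho>" "\<rho> \<subseteq> \<sigma> c" by (auto simp: simplices_def)
      have "card (\<sigma> c - \<rho>) = 1" using \<rho> \<sigma> by (simp add: card_Diff_subset finite_subset)
      then obtain v where "\<sigma> c - \<rho> = {v}" by (auto simp: card_1_singleton_iff)
      then show "\<rho> \<in> (\<lambda>v. \<sigma> c - {v}) ` (\<sigma> c - \<sigma> c')" using \<rho> by (intro image_eqI[of _ _ v]) auto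
    next
      fix \<rho> assume "\<rho> \<in> (\<lambda>v. \<sigma> c - {v}) ` (\<sigma> c - \<sigma> c')"
      then obtain v where v: "\<rho> = \<sigma> c - {v}" "v \<in> \<sigma> c" "v \<notin> \<sigma> c'" by auto
      then have "card \<rho> = Suc p" using \<sigma> by simp
      moreover from this have "\<rho> \<noteq> {}" by auto
      ultimately show "\<rho> \<in> ?A" using v True subset_closed[OF \<sigma>(1), of \<rho>] by (auto simp: simplices_def)
    qed
    moreover have "inj_on (\<lambda>v. \<sigma> c - {v}) (\<sigma> c - \<sigma> c')" by (rule inj_onI) blast
    ultimately have "card ?A = card (\<sigma> c - \<sigma> c')" by (simp add: card_image)
    also have "\<dots> = 2" using \<sigma> True by (simp add: card_Diff_subset finite_subset)
    finally show ?thesis by simp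
  next
    case False
    then have "?A = {}" by auto
    then show ?thesis by (simp only: card.empty) simp
  qed
  then have "of_bool (listed xs (Suc (Suc p)) c \<and> listed xs p c' \<and> odd (card ?A)) = (0 :: bit)" by simp
  finally show ?thesis .
qed

lemma boundaries_subset_cycles: "boundaries K p \<subseteq> cycles K p"
proof
  fix z assume "z \<in> boundaries K p"
  then obtain w where w: "w \<in> chains K (Suc p)" "z = boundary K (Suc p) w" by (auto simp: boundaries_def)
  have "z \<in> chains K p" using w by (auto simp: boundary_def chains_def simplices_def)
  moreover have "(\<Sum>r<N. chain_vec z r * face_mat xs p r c) = 0" if c: "c < N" for c
  proof -
    have "(\<Sum>r<N. chain_vec z r * face_mat xs p r c) =
      (\<Sum>r<N. mat_vec N (coface_mat xs p) (chain_vec w) r * face_mat xs p r c)"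
      using w coface_mat_chain by (intro sum.cong refl) auto
    also have "\<dots> = (\<Sum>r<N. \<Sum>i<N. chain_vec w i * (coface_mat xs p r i * face_mat xs p r c))"
      by (simp add: mat_vec_def sum_distrib_left sum_distrib_right mult_ac)
    also have "\<dots> = (\<Sum>i<N. \<Sum>r<N. chain_vec w i * (coface_mat xs p r i * face_mat xs p r c))" by (rule sum.swap)
    also have "\<dots> = (\<Sum>i<N. chain_vec w i * (\<Sum>r<N. coface_mat xs p r i * face_mat xs p r c))"
      by (simp add: sum_distrib_left)
    also have "\<dots> = 0" using coface_face c by (intro sum.neutral) auto
    finally show ?thesis .
  qed
  ultimately show "z \<in> cycles K p" by (simp add: cycle_iff)
qed

lemma cycles_sym_diff:
  assumes "z \<in> cycles K p" "z' \<in> cycles K p"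
  shows "sym_diff z z' \<in> cycles K p"
proof -
  have "(\<Sum>r<N. chain_vec (sym_diff z z') r * face_mat xs p r c) =
     (\<Sum>r<N. chain_vec z r * face_mat xs p r c) + (\<Sum>r<N. chain_vec z' r * face_mat xs p r c)" for c
    by (simp only: chain_vec_sym_diff ring_distribs sum.distrib)
  then show ?thesis using assms by (auto simp: cycle_iff chains_def)
qed

text \<open>The values of the selected cocycles on a cycle are its coordinates
  \<open>\<phi>\<close>. The two parts of \<open>cohomology_basis\<close> give surjectivity and the
  kernel; the sum of the annotations over a cycle is \<open>\<phi>\<close> because cocycles are
  linear.\<close>

lemma annotates_output:
  assumes "annotates xs p N s"
  shows "annotation_output (K, xs, p) s"
proof -
  obtain T P T' Q T'' B where C: "eliminates N (coface_mat xs p) T P" and D: "eliminates N (face_mat xs p) T' Q"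
    and H: "eliminates N (pairing N {i. listed xs (Suc p) i} P Q T T') T'' B"
    and s: "s 3 0 = length (sorted_rows N B)"
      "\<And>i q. i < N \<Longrightarrow> q < length (sorted_rows N B) \<Longrightarrow> s 4 (i * length (sorted_rows N B) + q) = bit_nat (T (sorted_rows N B ! q) i)"
    using assms by (auto simp: annotates_def)
  define L where "L = sorted_rows N B"
  define g where "g = length L"
  have L: "set L = B" "distinct L" using sorted_rows[of N B] eliminates_subset[OF H] by (auto simp: L_def)
  define \<phi> where "\<phi> z = vec g (\<lambda>q. mat_vec N T (chain_vec z) (L ! q))" for z
  let ?S = "{i. listed xs (Suc p) i}"
  define Z where "Z = {z. (\<forall>r<N. r \<notin> ?S \<longrightarrow> z r = 0) \<and> (\<forall>c<N. (\<Sum>r<N. z r * face_mat xs p r c) = 0)}"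
  have rows0: "r \<notin> ?S \<Longrightarrow> coface_mat xs p r c = 0" "r \<notin> ?S \<Longrightarrow> face_mat xs p r c = 0" for r c
    by (auto simp: coface_mat_def face_mat_def)
  have basis1: "\<exists>z\<in>Z. \<forall>r\<in>B. mat_vec N T z r = y r" for y
    unfolding Z_def by (rule cohomology_basis(1)[OF C _ D _ H]) (use rows0 in auto)
  have basis2: "(\<forall>r\<in>B. mat_vec N T z r = 0) \<longleftrightarrow> (\<exists>w. \<forall>r<N. z r = mat_vec N (coface_mat xs p) w r)" if "z \<in> Z" for z
    using that unfolding Z_def by (intro cohomology_basis(2)[OF C _ D _ H]) (use rows0 in auto)
  have cycZ: "chain_vec z \<in> Z" if "z \<in> cycles K p" for z
    using that by (auto simp: Z_def cycle_iff chain_vec_def chains_def listed_simplices)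
  have all_rows: "(\<forall>q<g. f (L ! q) = 0) \<longleftrightarrow> (\<forall>r\<in>B. f r = 0)" for f :: "nat \<Rightarrow> bit"
    unfolding L(1)[symmetric] g_def by (simp add: all_set_conv_all_nth)
  have coords: "homology_dim K p = g \<and> (\<forall>z\<in>cycles K p. \<forall>z'\<in>cycles K p.
    homology_class K p z = homology_class K p z' \<longleftrightarrow> \<phi> z = \<phi> z')"
  proof (rule homology_coordinates[of K p \<phi> g], goal_cases)
    case 1
    then show ?case by (simp add: cycle_iff chains_def chain_vec_def)
  next
    case (2 z z') then show ?case by (rule cycles_sym_diff)
  next
    case 3 show ?case by (rule boundaries_subset_cycles)
  next
    case (4 z) show ?case by (simp add: \<phi>_def)
  next
    case (5 y)
    \<comment> \<open>The vector \<open>y\<close> is indexed by positions in \<open>L\<close>, the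
      prescribed values by the pivot rows themselves.\<close>
    define y' where "y' r = y $ (inv_into {..<g} ((!) L) r)" for r
    obtain v where v: "v \<in> Z" "\<And>r. r \<in> B \<Longrightarrow> mat_vec N T v r = y' r" using basis1[of y'] by blast
    obtain z where z: "z \<in> chains K p" "\<And>i. i < N \<Longrightarrow> chain_vec z i = v i"
      using chain_of_vec[of p v] v(1) by (auto simp: Z_def)
    have "z \<in> cycles K p" using z v(1) by (simp add: cycle_iff Z_def)
    moreover have "\<phi> z = y"
    proof (rule eq_vecI)
      fix q assume "q < dim_vec y"
      then have q: "q < g" using 5 by simp
      have "mat_vec N T (chain_vec z) (L ! q) = mat_vec N T v (L ! q)" by (rule mat_vec_cong) (simp_all add: z)
      also have "\<dots> = y' (L ! q)" using v(2) nth_mem[of q L] q L(1) by (simp add: g_def)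
      also have "\<dots> = y $ q"
      proof -
        have "inj_on ((!) L) {..<g}" using L(2) by (auto simp: inj_on_def g_def nth_eq_iff_index_eq)
        then show ?thesis using q by (simp add: y'_def inv_into_f_f)
      qed
      finally show "\<phi> z $ q = y $ q" using q by (simp add: \<phi>_def)
    qed (use 5 in \<open>simp add: \<phi>_def\<close>)
    ultimately show ?case by blast
  next
    case (6 z z')
    have "chain_vec (sym_diff z z') = (\<lambda>i. chain_vec z i + chain_vec z' i)" by (rule ext) (rule chain_vec_sym_diff)
    then show ?case by (intro eq_vecI) (simp_all add: \<phi>_def mat_vec_add)
  next
    case (7 z)
    have "\<phi> z = 0\<^sub>v g \<longleftrightarrow> (\<forall>q<g. mat_vec N T (chain_vec z) (L ! q) = 0)"
      by (auto simp: \<phi>_def vec_eq_iff)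
    also have "\<dots> \<longleftrightarrow> z \<in> boundaries K p"
      using all_rows[of "mat_vec N T (chain_vec z)"] basis2[OF cycZ[OF 7]] boundary_iff[of z] 7
      by (simp add: cycle_iff)
    finally show ?case .
  qed
  then have dim: "homology_dim K p = g" ..
  \<comment> \<open>Annotations are functions of simplices, whereas the rows of \<open>T\<close> are
    indexed by positions in the list.\<close>
  define idx where "idx = the_inv_into {..<length xs} \<sigma>"
  have idx: "idx (\<sigma> i) = i" if "i < length xs" for i
    unfolding idx_def using \<sigma>_bij that by (intro the_inv_into_f_f) (auto simp: bij_betw_def)
  define a where "a \<rho> = vec g (\<lambda>q. T (L ! q) (idx \<rho>))" for \<rho>
  have sum_a: "finsum_vec TYPE(bit) g a z = \<phi> z" if z: "z \<in> cycles K p" for z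
  proof (rule eq_vecI)
    have zK: "finite z" "z \<subseteq> K" using z chain_finite[of z p] by (auto simp: cycles_def)
    have a: "a \<in> z \<rightarrow> carrier_vec g" by (auto simp: a_def)
    show "dim_vec (finsum_vec TYPE(bit) g a z) = dim_vec (\<phi> z)"
      using finsum_vec_closed[OF a] by (simp add: \<phi>_def)
    fix q assume "q < dim_vec (\<phi> z)"
    then have q: "q < g" by (simp add: \<phi>_def)
    have "finsum_vec TYPE(bit) g a z $ q = (\<Sum>\<rho>\<in>z. a \<rho> $ q)"
      by (rule index_finsum_vec) (use zK q a in auto)
    also have "\<dots> = (\<Sum>\<rho>\<in>z. T (L ! q) (idx \<rho>))" using q by (simp add: a_def)
    also have "\<dots> = (\<Sum>i\<in>{i\<in>{..<N}. i < length xs \<and> \<sigma> i \<in> z}. T (L ! q) i)"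
    proof (rule sum.reindex_bij_witness[of _ \<sigma> idx])
      fix \<rho> assume "\<rho> \<in> z"
      then have "\<rho> \<in> K" using zK by blast
      then obtain i where i: "i < length xs" "\<rho> = \<sigma> i" by (rule \<sigma>_cases)
      then show "\<sigma> (idx \<rho>) = \<rho>" "idx \<rho> \<in> {i\<in>{..<N}. i < length xs \<and> \<sigma> i \<in> z}" using idx \<open>\<rho> \<in> z\<close> N by auto
    qed (auto simp: idx)
    also have "\<dots> = (\<Sum>i<N. T (L ! q) i * chain_vec z i)"
      by (rule sum.mono_neutral_cong_left) (auto simp: chain_vec_def)
    finally show "finsum_vec TYPE(bit) g a z $ q = \<phi> z $ q" using q by (simp add: \<phi>_def mat_vec_def)
  qed
  have "is_annotation K p a"
    unfolding is_annotation_def dim using coords sum_a by (auto simp: a_def)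
  moreover have "s 4 (i * g + j) = of_bool (a (\<sigma> i) $ j = 1)" if "i < length xs" "j < g" for i j
    using s(2)[of i j] that N idx[OF that(1)] by (simp add: L_def[symmetric] g_def[symmetric] a_def bit_nat_def)
  moreover have "s 3 0 = g" using s(1) by (simp add: g_def L_def)
  ultimately show ?thesis
    unfolding annotation_output_def prod.case dim \<sigma>_def by blast
qed

end

section \<open>Running time\<close>

text \<open>Turns an eventual bound into one for all n \<ge> 1, since multiplication is also called
  at small sizes. The finitely many exceptions are absorbed by adding their ratios to the
  constant.\<close>

lemma bigo_bound:
  fixes f :: "nat \<Rightarrow> nat" and g :: "nat \<Rightarrow> real"
  assumes "(\<lambda>n. real (f n)) \<in> O(g)" and g: "\<And>n. n \<ge> 1 \<Longrightarrow> g n > 0"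
  shows "\<exists>C\<ge>0. \<forall>n\<ge>1. real (f n) \<le> C * g n"
proof -
  obtain c where c: "c > 0" "eventually (\<lambda>n. norm (real (f n)) \<le> c * norm (g n)) at_top"
    using landau_o.bigE[OF assms(1)] by blast
  then obtain m where m: "\<And>n. n \<ge> m \<Longrightarrow> real (f n) \<le> c * \<bar>g n\<bar>" by (auto simp: eventually_at_top_linorder)
  define C where "C = c + (\<Sum>i\<in>{1..<m}. real (f i) / g i)"
  have pos: "0 \<le> (\<Sum>i\<in>{1..<m}. real (f i) / g i)" 
    using less_imp_le[OF g] by (intro sum_nonneg divide_nonneg_nonneg) auto
  have "real (f n) \<le> C * g n" if n: "n \<ge> 1" for n
  proof (cases "n < m")
    case True
    have "real (f n) / g n \<le> (\<Sum>i\<in>{1..<m}. real (f i) / g i)"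
      using True n less_imp_le[OF g] by (intro member_le_sum divide_nonneg_nonneg) auto
    then have "real (f n) / g n \<le> C" using c by (simp add: C_def)
    then show ?thesis using g[OF n] by (simp add: field_simps)
  next
    case False
    then have "real (f n) \<le> c * g n" using m[of n] g[OF n] by simp
    also have "\<dots> \<le> C * g n" using g[OF n] pos by (intro mult_right_mono) (auto simp: C_def)
    finally show ?thesis .
  qed
  then show ?thesis using c pos by (intro exI[of _ C]) (auto simp: C_def)
qed

lemma card_dvd_Suc: "0 < d \<Longrightarrow> card {j. j < N \<and> d dvd Suc j} \<le> N div d"
proof -
  assume d: "0 < d"
  have "{j. j < N \<and> d dvd Suc j} \<subseteq> (\<lambda>i. Suc i * d - 1) ` {..<N div d}"
  proof
    fix j assume "j \<in> {j. j < N \<and> d dvd Suc j}"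
    then obtain i where i: "Suc j = d * i" "j < N" by (auto elim: dvdE)
    then obtain i' where i': "i = Suc i'" by (cases i) auto
    have "Suc i' * d \<le> N" using i i' by (simp add: mult.commute)
    then have "Suc i' \<le> N div d" using d by (simp only: less_eq_div_iff_mult_less_eq)
    moreover have "j = Suc i' * d - 1" using i i' by (metis diff_Suc_1 mult.commute)
    ultimately show "j \<in> (\<lambda>i. Suc i * d - 1) ` {..<N div d}" by (intro image_eqI[of _ _ i']) auto
  qed
  then have "card {j. j < N \<and> d dvd Suc j} \<le> card ((\<lambda>i. Suc i * d - 1) ` {..<N div d})"
    by (intro card_mono) auto
  also have "\<dots> \<le> N div d" using card_image_le[of "{..<N div d}" "\<lambda>i. Suc i * d - 1"] by simp
  finally show ?thesis .
qed

text \<open>After interchanging the sums, size 2^w is charged once for each multiple of 2^w among 1,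
  ..., 2^v, and there are 2^(v-w) of these.\<close>

lemma sum_multiplicity_le:
  fixes f :: "nat \<Rightarrow> nat"
  shows "(\<Sum>j<2^v. \<Sum>w\<le>multiplicity 2 (Suc j). f w) \<le> (\<Sum>w\<le>v. 2^(v - w) * f w)"
proof -
  have "(\<Sum>j<2^v. \<Sum>w\<le>multiplicity 2 (Suc j). f w) = (\<Sum>j<2^v. \<Sum>w\<le>v. if 2^w dvd Suc j then f w else 0)"
  proof (rule sum.cong[OF refl])
    fix j :: nat assume j: "j \<in> {..<2^v}"
    have *: "2^w dvd Suc j \<longleftrightarrow> w \<le> multiplicity 2 (Suc j)" for w
      by (rule power_dvd_iff_le_multiplicity) auto
    have "(2::nat) ^ multiplicity 2 (Suc j) \<le> Suc j" "Suc j \<le> 2 ^ v"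
      using dvd_imp_le[OF multiplicity_dvd[of 2 "Suc j"]] j by simp_all
    then have "(2::nat) ^ multiplicity 2 (Suc j) \<le> 2 ^ v" by (rule order_trans)
    then have le: "multiplicity 2 (Suc j) \<le> v" by simp
    show "(\<Sum>w\<le>multiplicity 2 (Suc j). f w) = (\<Sum>w\<le>v. if 2^w dvd Suc j then f w else 0)"
      unfolding * using le by (intro sum.mono_neutral_cong_left) auto
  qed
  also have "\<dots> = (\<Sum>w\<le>v. \<Sum>j<2^v. if 2^w dvd Suc j then f w else 0)" by (rule sum.swap)
  also have "\<dots> \<le> (\<Sum>w\<le>v. 2^(v - w) * f w)"
  proof (rule sum_mono)
    fix w assume w: "w \<in> {..v}"
    have "(\<Sum>j<2^v. if 2^w dvd Suc j then f w else 0) = card {j. j < 2^v \<and> 2^w dvd Suc j} * f w"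
      by (simp add: sum.If_cases Int_def)
    also have "\<dots> \<le> (2^v div 2^w) * f w" by (intro mult_le_mono1 card_dvd_Suc) simp
    also have "(2::nat)^v div 2^w = 2^(v - w)" using w by (simp add: power_diff)
    finally show "(\<Sum>j<2^v. if 2^w dvd Suc j then f w else 0) \<le> 2^(v - w) * f w" .
  qed
  finally show ?thesis .
qed

context multiplication
begin

text \<open>At size 2^w there are 2^(v-w) transformations with 2^(v-w) products each, of total cost
  of order N^2 q^w. For \<omega> > 2 the last term of the sum over w dominates, and N^2 q^v =
  N^\<omega>.\<close>

lemma eliminate_time_bound:
  assumes \<omega>: "\<omega> > 2" and C: "0 \<le> C" "\<And>n. n \<ge> 1 \<Longrightarrow> real (Tm n) \<le> C * real n powr \<omega>"
  shows "\<exists>D. \<forall>v. real (eliminate_time (2^v)) \<le> D * real (2^v) powr \<omega>"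
proof -
  \<comment> \<open>The ratio of the multiplication costs at consecutive block sizes: one product
    costs 2^\<omega> times as much, but only a quarter as many are needed.\<close>
  define q where "q = (2::real) powr (\<omega> - 2)"
  have q: "q > 1" using \<omega> by (simp add: q_def)
  \<comment> \<open>1400 collects the terms 1000 N^2, 200 N and 200. The factor 2 stems from
    \<open>column_time\<close>, and q / (q - 1) bounds the geometric sum relative to its last
    term.\<close>
  define D where "D = 1400 + 2 * ((2000 + C) * q / (q - 1))"
  have "real (eliminate_time (2^v)) \<le> D * real (2^v) powr \<omega>" for v
  proof -
    let ?N = "2^v :: nat"
    define X where "X = real ?N ^ 2"
    have qv: "X * q ^ v = real ?N powr \<omega>"
    proof -
      have "q ^ v = 2 powr (real v * (\<omega> - 2))" unfolding q_def by (simp add: powr_realpow[symmetric] powr_powr mult.commute)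
      moreover have "X = 2 powr (real v * 2)" unfolding X_def by (simp add: powr_realpow[symmetric] powr_powr power_mult[symmetric])
      moreover have "real ?N powr \<omega> = 2 powr (real v * \<omega>)" by (simp add: powr_realpow[symmetric] powr_powr)
      ultimately show ?thesis by (simp add: powr_add[symmetric] algebra_simps)
    qed
    have X1: "1 \<le> X" "real ?N \<le> X"
      using self_le_power[of "real ?N" 2] one_le_power[of "real ?N" 2] by (simp_all add: X_def)
    have Xw: "X \<le> real ?N powr \<omega>"
    proof -
      have "X * 1 \<le> X * q ^ v" using q X1 by (intro mult_left_mono) auto
      then show ?thesis using qv by simp
    qed
    have summand: "real (2^(v - w) * transform_time ?N (2^w)) \<le> (2000 + C) * X * q ^ w" if w: "w \<le> v" for w
    proof -
      have dv: "?N div 2^w = 2^(v - w)" using w by (simp add: power_diff)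
      have n: "real (2^(v - w)) * 2 ^ w = real ?N" using w by (simp add: power_add[symmetric])
      have e1: "real (2^(v - w)) * real (?N * 2^w) = X"
        using n unfolding X_def by (simp add: power2_eq_square mult_ac)
      have e2: "real (2^(v - w)) * real (2^(v - w)) * real (2^w :: nat) powr \<omega> = X * q ^ w"
      proof -
        have "real (2^w :: nat) powr \<omega> = real (2^w :: nat) ^ 2 * q ^ w"
        proof -
          have "q ^ w = 2 powr (real w * (\<omega> - 2))" unfolding q_def by (simp add: powr_realpow[symmetric] powr_powr mult.commute)
          moreover have "real (2^w :: nat) ^ 2 = 2 powr (real w * 2)" by (simp add: powr_realpow[symmetric] powr_powr power_mult[symmetric])
          moreover have "real (2^w :: nat) powr \<omega> = 2 powr (real w * \<omega>)" by (simp add: powr_realpow[symmetric] powr_powr)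
          ultimately show ?thesis by (simp add: powr_add[symmetric] algebra_simps)
        qed
        moreover have "X = (real (2^(v - w)) * 2 ^ w) ^ 2" unfolding n X_def ..
        ultimately show ?thesis by (simp add: power2_eq_square mult_ac)
      qed
      have T: "real (Tm (2^w)) \<le> C * real (2^w :: nat) powr \<omega>" by (rule C) simp
      have "real (2^(v - w) * transform_time ?N (2^w)) =
        2000 * (real (2^(v - w)) * real (?N * 2^w)) + real (2^(v - w)) * real (2^(v - w)) * real (Tm (2^w))"
        unfolding transform_time_def dv by (simp add: algebra_simps)
      also have "\<dots> \<le> 2000 * X + real (2^(v - w)) * real (2^(v - w)) * (C * real (2^w :: nat) powr \<omega>)"
        unfolding e1 using T by (intro add_left_mono mult_left_mono) auto
      also have "\<dots> = 2000 * X + C * (X * q ^ w)" using e2 by (simp add: mult_ac)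
      also have "\<dots> \<le> 2000 * (X * q ^ w) + C * (X * q ^ w)"
        using q X1 mult_left_mono[of 1 "q ^ w" X] by simp
      finally show ?thesis by (simp add: algebra_simps)
    qed
    have "real (\<Sum>j<?N. \<Sum>w\<le>multiplicity 2 (Suc j). transform_time ?N (2^w)) \<le>
      real (\<Sum>w\<le>v. 2^(v - w) * transform_time ?N (2^w))"
      using sum_multiplicity_le by (simp only: of_nat_le_iff)
    also have "\<dots> \<le> (\<Sum>w\<le>v. (2000 + C) * X * q ^ w)" unfolding of_nat_sum using summand by (intro sum_mono) auto
    also have "\<dots> = (2000 + C) * X * (\<Sum>w<Suc v. q ^ w)" by (simp add: sum_distrib_left lessThan_Suc_atMost)
    also have "\<dots> = (2000 + C) * X * ((q ^ Suc v - 1) / (q - 1))" using q by (subst geometric_sum) auto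
    also have "\<dots> \<le> (2000 + C) * X * (q ^ Suc v / (q - 1))"
      using q C X1 by (intro mult_left_mono divide_right_mono) auto
    also have "\<dots> = (2000 + C) * q / (q - 1) * real ?N powr \<omega>" unfolding qv[symmetric] by simp
    finally have S: "real (\<Sum>j<?N. \<Sum>w\<le>multiplicity 2 (Suc j). transform_time ?N (2^w)) \<le> (2000 + C) * q / (q - 1) * real ?N powr \<omega>" .
    have "real (eliminate_time ?N) = 200 * real ?N + 200 + 1000 * X + 2 * real (\<Sum>j<?N. \<Sum>w\<le>multiplicity 2 (Suc j). transform_time ?N (2^w))"
      by (simp add: eliminate_time_def column_time_def sum.distrib sum_distrib_left[symmetric] X_def power2_eq_square)
    also have "\<dots> \<le> 1400 * real ?N powr \<omega> + 2 * ((2000 + C) * q / (q - 1) * real ?N powr \<omega>)"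
      using S X1 Xw by linarith
    finally show ?thesis by (simp add: D_def algebra_simps)
  qed
  then show ?thesis by blast
qed

definition size_bound :: "nat \<Rightarrow> nat" where
  "size_bound n = nat \<lfloor>log 2 (real n + 1)\<rfloor>"

lemma annotate_time_bigo:
  assumes \<omega>: "\<omega> > 2" and T: "(\<lambda>n. real (Tm n)) \<in> O(\<lambda>n. real n powr \<omega>)"
  shows "(\<lambda>n. real (annotate_time (padded n) (size_bound n))) \<in> O(\<lambda>n. real n powr \<omega>)"
proof -
  obtain C where C: "0 \<le> C" "\<And>n. n \<ge> 1 \<Longrightarrow> real (Tm n) \<le> C * real n powr \<omega>"
    using bigo_bound[OF T] by auto
  obtain D where D: "\<And>v. real (eliminate_time (2^v)) \<le> D * real (2^v) powr \<omega>"
    using eliminate_time_bound[OF \<omega> C] by blast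
  \<comment> \<open>Three eliminations, one product of size N, and the lower terms 2300 N^2, 2900 N
    and 4200, whose coefficients add up to less than 10000.\<close>
  define E where "E = 3 * D + C + 10000"
  have bound: "real (annotate_time (padded n) (size_bound n)) \<le>
      \<bar>E\<bar> * 3 powr \<omega> * real n powr \<omega> + 900 * (real n ^ 2 * log 2 (real n + 1) ^ 2)" if n: "n \<ge> 1" for n
  proof -
    define N where "N = padded n"
    have N2: "N = 2 ^ (LEAST v. n \<le> 2 ^ v)" by (simp add: N_def padded_def)
    have N1: "1 \<le> N" unfolding N2 by simp
    have N3: "real N \<le> 3 * real n" using padded(2)[of n] n by (simp add: N_def)
    have el: "real (eliminate_time N) \<le> D * real N powr \<omega>" unfolding N2 by (rule D)
    have Tn: "real (Tm N) \<le> C * real N powr \<omega>" by (rule C) fact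
    have p2: "real N powr 2 \<le> real N powr \<omega>" using N1 \<omega> by (intro powr_mono) auto
    have NN: "real N * real N \<le> real N powr \<omega>" using p2 N1 by (simp add: powr_numeral power2_eq_square)
    have N': "real N \<le> real N * real N" "1 \<le> real N * real N" using N1 by (simp_all add: mult_ge1_I)
    have l: "real (size_bound n) \<le> log 2 (real n + 1)" "0 \<le> log 2 (real n + 1)"
      by (auto simp: size_bound_def intro!: of_nat_floor)
    have "real (N * N * (size_bound n * size_bound n * 100)) = 100 * (real N ^ 2 * real (size_bound n) ^ 2)"
      by (simp add: power2_eq_square)
    also have "\<dots> \<le> 100 * ((3 * real n) ^ 2 * log 2 (real n + 1) ^ 2)"
      using N3 l by (intro mult_left_mono mult_mono power_mono) auto
    finally have L: "real (N * N * (size_bound n * size_bound n * 100)) \<le> 900 * (real n ^ 2 * log 2 (real n + 1) ^ 2)"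
      by (simp add: power2_eq_square)
    have "real (annotate_time N (size_bound n)) = 3 * real (eliminate_time N) + real (Tm N) + 2300 * (real N * real N) + 2900 * real N + 4200
       + real (N * N * (size_bound n * size_bound n * 100))"
      by (simp add: annotate_time_def reduce_time_def)
    also have "\<dots> \<le> E * real N powr \<omega> + 900 * (real n ^ 2 * log 2 (real n + 1) ^ 2)"
      unfolding E_def ring_distribs using el Tn NN N' L by linarith
    also have "E * real N powr \<omega> \<le> \<bar>E\<bar> * (3 * real n) powr \<omega>"
      using N3 \<omega> by (intro mult_mono powr_mono2) auto
    also have "\<dots> = \<bar>E\<bar> * 3 powr \<omega> * real n powr \<omega>" by (simp add: powr_mult)
    finally show ?thesis by (simp add: N_def)
  qed
  \<comment> \<open>The comparison of simplices is absorbed because the exponent exceeds 2 strictly,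
    which outweighs the squared logarithm.\<close>
  have "(\<lambda>n::nat. real n ^ 2 * log 2 (real n + 1) ^ 2) \<in> O(\<lambda>n. real n powr \<omega>)"
    using \<omega> by real_asymp
  then have "(\<lambda>n::nat. \<bar>E\<bar> * 3 powr \<omega> * real n powr \<omega> + 900 * (real n ^ 2 * log 2 (real n + 1) ^ 2)) \<in> O(\<lambda>n. real n powr \<omega>)"
    by (intro sum_in_bigo) auto
  moreover have "(\<lambda>n. real (annotate_time (padded n) (size_bound n))) \<in>
      O(\<lambda>n::nat. \<bar>E\<bar> * 3 powr \<omega> * real n powr \<omega> + 900 * (real n ^ 2 * log 2 (real n + 1) ^ 2))"
    by (rule landau_o.big_mono) (use bound in \<open>auto simp: eventually_at_top_linorder intro!: exI[of _ 1] order_trans[OF bound abs_ge_self]\<close>)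
  ultimately show ?thesis by (rule landau_o.big_trans[rotated])
qed

text \<open>Products of many sizes are formed, and \<open>Bm\<close> may fail to be monotone, so all
  of its values up to the padded size are added up. The other terms cover addresses, block sizes and
  the pairs of vertices of two simplices.\<close>

definition word_bound :: "nat \<Rightarrow> nat" where
  "word_bound n = 20 + padded n * padded n + 4 * padded n + n * n + (\<Sum>k\<le>padded n. Bm k)"

lemma word_bound_bigo:
  assumes B: "(\<lambda>n. real (Bm n)) \<in> O(\<lambda>n. real n ^ k)"
  shows "(\<lambda>n. real (word_bound n)) \<in> O(\<lambda>n. real n ^ (k + 2))"
proof -
  obtain C where C: "0 \<le> C" "\<And>n. n \<ge> 1 \<Longrightarrow> real (Bm n) \<le> C * real n ^ k"
    using bigo_bound[OF B] by auto
  \<comment> \<open>42 = 20 + 9 + 12 + 1 comes from the terms outside the sum, with the padded size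
    at most 3 n. The sum has at most 4 n terms; \<open>Bm 0\<close> is listed apart since the bound
    by \<open>C\<close> starts at 1.\<close>
  define D where "D = 42 + 4 * (C * 3 ^ k + real (Bm 0))"
  have "real (word_bound n) \<le> D * real n ^ (k + 2)" if n: "n \<ge> 1" for n
  proof -
    let ?x = "real n"
    have x: "1 \<le> ?x" using n by simp
    have N: "real (padded n) \<le> 3 * ?x" using padded(2)[of n] n by simp
    have Bk: "real (Bm i) \<le> (C * 3 ^ k + real (Bm 0)) * ?x ^ k" if "i \<le> padded n" for i
    proof (cases "i = 0")
      case True
      have "real (Bm 0) * 1 \<le> (C * 3 ^ k + real (Bm 0)) * ?x ^ k" using C(1) x by (intro mult_mono) auto
      then show ?thesis using True by simp
    next
      case False
      have "real (Bm i) \<le> C * real i ^ k" using False by (intro C) simp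
      also have "\<dots> \<le> C * (3 * ?x) ^ k" using that N C(1) by (intro mult_left_mono power_mono) linarith+
      also have "\<dots> \<le> (C * 3 ^ k + real (Bm 0)) * ?x ^ k" by (simp add: power_mult_distrib ring_distribs)
      finally show ?thesis .
    qed
    have "real (\<Sum>i\<le>padded n. Bm i) \<le> (\<Sum>i\<le>padded n. (C * 3 ^ k + real (Bm 0)) * ?x ^ k)"
      unfolding of_nat_sum by (intro sum_mono Bk) auto
    also have "\<dots> = (1 + real (padded n)) * ((C * 3 ^ k + real (Bm 0)) * ?x ^ k)" by simp
    also have "\<dots> \<le> (4 * ?x) * ((C * 3 ^ k + real (Bm 0)) * ?x ^ k)"
      using N x C(1) by (intro mult_right_mono) auto
    also have "\<dots> = 4 * (C * 3 ^ k + real (Bm 0)) * ?x ^ (k + 1)" by simp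
    also have "\<dots> \<le> 4 * (C * 3 ^ k + real (Bm 0)) * ?x ^ (k + 2)"
      using x C(1) by (intro mult_left_mono power_increasing) auto
    finally have S: "real (\<Sum>i\<le>padded n. Bm i) \<le> 4 * (C * 3 ^ k + real (Bm 0)) * ?x ^ (k + 2)" .
    have p: "1 \<le> ?x ^ (k + 2)" "?x \<le> ?x ^ (k + 2)" "?x * ?x \<le> ?x ^ (k + 2)"
      using power_increasing[of 0 "k + 2" ?x] power_increasing[of 1 "k + 2" ?x] power_increasing[of 2 "k + 2" ?x] x
      by (simp_all add: power2_eq_square del: power_Suc)
    have NN: "real (padded n) * real (padded n) \<le> 9 * (?x * ?x)"
      using mult_mono[OF N N] x by simp
    have "real (word_bound n) = 20 + real (padded n) * real (padded n) + 4 * real (padded n) + ?x * ?x + real (\<Sum>i\<le>padded n. Bm i)"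
      by (simp add: word_bound_def)
    also have "\<dots> \<le> 42 * ?x ^ (k + 2) + 4 * (C * 3 ^ k + real (Bm 0)) * ?x ^ (k + 2)"
      using NN N p S by linarith
    finally show ?thesis by (simp add: D_def ring_distribs)
  qed
  then show ?thesis
    by (intro bigoI[of _ D]) (auto simp: eventually_at_top_linorder intro!: exI[of _ 1])
qed

end

text \<open>A simplex with l vertices has 2^l - 1 nonempty faces, all of which belong to the
  complex.\<close>

lemma (in listed_complex) length_bound:
  assumes "vs \<in> set xs"
  shows "2 ^ length vs \<le> length xs + 1"
proof -
  obtain i where i: "i < length xs" "vs = xs ! i" using assms by (auto simp: in_set_conv_nth)
  have "Pow (\<sigma> i) - {{}} \<subseteq> K" using subset_closed[OF \<sigma>_K[OF i(1)]] by auto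
  then have "card (Pow (\<sigma> i) - {{}}) \<le> card K" using finite_K by (rule card_mono[rotated])
  moreover have "card K = length xs" using bij_betw_same_card[OF \<sigma>_bij] by simp
  moreover have "card (Pow (\<sigma> i) - {{}}) = 2 ^ length vs - 1"
    using card_\<sigma>[OF i(1)] finite_simplex[OF \<sigma>_K[OF i(1)]] i by (simp add: card_Diff_subset card_Pow)
  ultimately show ?thesis by simp
qed

theorem theorem6p2:
  fixes \<omega> :: real
  assumes "\<omega> > 2"
    and "matrices_multipliable_in_time (\<lambda>n. real n powr \<omega>)"
  shows "annotations_computable_in_time (\<lambda>n. real n powr \<omega>)"
proof -
  obtain Pm Tm Bm k where T: "(\<lambda>n. real (Tm n)) \<in> O(\<lambda>n. real n powr \<omega>)"
    and B: "(\<lambda>n. real (Bm n)) \<in> O(\<lambda>n. real n ^ k)"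
    and P: "\<forall>x\<in>{(n, A, B). A \<in> carrier_mat n n \<and> B \<in> carrier_mat n n}. \<forall>W\<ge>Bm ((\<lambda>(n, A, B). n) x). \<forall>s.
      (\<forall>a i. s a i < W) \<and> multiplication_input x s \<longrightarrow>
      (\<exists>t s'. exec W Pm s t s' \<and> t \<le> Tm ((\<lambda>(n, A, B). n) x) \<and> multiplication_output x s')"
    using assms(2) unfolding matrices_multipliable_in_time_def solvable_in_time_def by (elim exE conjE) (rule that)
  \<comment> \<open>Separates the arrays of the multiplication program from the working
    arrays.\<close>
  obtain b where b: "\<forall>a\<in>written Pm. a < b" using finite_written finite_nat_set_iff_bounded by blast
  interpret multiplication Pm b Tm Bm
  proof
    show "a < b + 5" if "a \<in> written Pm" for a using b that by auto
    show "\<exists>t s'. exec W Pm s t s' \<and> t \<le> Tm n \<and> multiplication_output (n, A, B) s'"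
      if "A \<in> carrier_mat n n" "B \<in> carrier_mat n n" "Bm n \<le> W" "bounded W s" "multiplication_input (n, A, B) s"
      for A B n W s
      using P[rule_format, of "(n, A, B)" W s] that by (simp add: bounded_def)
  qed
  show ?thesis
    unfolding annotations_computable_in_time_def solvable_in_time_def
  proof (rule exI[of _ annotate_prog], rule exI[of _ "\<lambda>n. annotate_time (padded n) (size_bound n)"],
      rule exI[of _ word_bound], rule exI[of _ "k + 2"], intro conjI ballI allI impI)
    show "(\<lambda>n. real (annotate_time (padded n) (size_bound n))) \<in> O(\<lambda>n. real n powr \<omega>)"
      by (rule annotate_time_bigo[OF assms(1) T])
    show "(\<lambda>n. real (word_bound n)) \<in> O(\<lambda>n. real n ^ (k + 2))" by (rule word_bound_bigo[OF B])
  next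
    fix x :: "nat set set \<times> nat list list \<times> nat" and W s
    assume x: "x \<in> {(K, xs, p). finite_simplicial_complex K \<and> connected_complex K \<and> lists_complex xs K}"
      and W: "word_bound (case x of (K, xs, p) \<Rightarrow> card K) \<le> W"
      and s: "(\<forall>a i. s a i < W) \<and> annotation_input x s"
    obtain K xs p where x': "x = (K, xs, p)" by (cases x) auto
    have K: "finite_simplicial_complex K" "lists_complex xs K" using x x' by auto
    define n where "n = length xs"
    interpret listed_complex K xs p "padded n"
      using K padded(1)[of n] by unfold_locales (auto simp: n_def)
    have cK: "card K = n" using bij_betw_same_card[OF \<sigma>_bij] by (simp add: n_def)
    have W': "word_bound n \<le> W" using W x' cK by simp
    have lb: "2 ^ size_bound n \<le> real n + 1"
    proof -
      have "2 ^ size_bound n = 2 powr real (size_bound n)" by (simp add: powr_realpow)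
      also have "\<dots> \<le> 2 powr log 2 (real n + 1)" unfolding size_bound_def by (intro powr_mono of_nat_floor) auto
      finally show ?thesis by simp
    qed
    \<comment> \<open>Needed for the loop counters: the number of pairs of vertices of two simplices
      is at most n * n, which \<open>word_bound\<close> covers.\<close>
    have ln: "size_bound n \<le> n"
    proof -
      have "(2::nat) ^ size_bound n \<le> n + 1" using lb by (metis (mono_tags) of_nat_1 of_nat_add of_nat_le_iff of_nat_numeral of_nat_power)
      then show ?thesis using less_exp[of "size_bound n"] by linarith
    qed
    have xs: "distinct vs \<and> vs \<noteq> [] \<and> length vs \<le> size_bound n" if vs: "vs \<in> set xs" for vs
    proof -
      have "set vs \<in> K" using K(2) vs by (auto simp: lists_complex_def)
      then have "vs \<noteq> []" using K(1) by (auto simp: finite_simplicial_complex_def)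
      moreover have "distinct vs" using K(2) vs by (simp add: lists_complex_def)
      moreover have "length vs \<le> size_bound n"
      proof -
        have "real (2 ^ length vs) \<le> real (n + 1)" using length_bound[OF vs] by (simp only: of_nat_le_iff n_def)
        then have "2 powr real (length vs) \<le> real n + 1" by (simp add: powr_realpow)
        then have "real (length vs) \<le> log 2 (real n + 1)" by (simp add: le_log_iff)
        then show ?thesis by (simp add: size_bound_def le_nat_floor)
      qed
      ultimately show ?thesis by simp
    qed
    have "runs W annotate_prog s (annotate_time (padded n) (size_bound n)) (annotates xs p (padded n))"
      unfolding n_def
    proof (rule runs_annotate[where K = K], unfold n_def[symmetric])
      have ll: "size_bound n * size_bound n \<le> n * n" using ln by (intro mult_le_mono)
      show "10 < W" "padded n * padded n + 4 * padded n < W" "size_bound n * size_bound n < W"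
        using W' ll unfolding word_bound_def by linarith+
      show "Bm i \<le> W" if "i \<le> padded n" for i
      proof -
        have "Bm i \<le> (\<Sum>k\<le>padded n. Bm k)" using that by (intro member_le_sum) auto
        then show ?thesis using W' unfolding word_bound_def by linarith
      qed
      show "bounded W s" "annotation_input (K, xs, p) s" using s x' by (auto simp: bounded_def)
    qed (use xs in auto)
    then obtain t s' where r: "exec W annotate_prog s t s'" "t \<le> annotate_time (padded n) (size_bound n)" "annotates xs p (padded n) s'"
      by (auto simp: runs_def)
    show "\<exists>t s'. exec W annotate_prog s t s' \<and> t \<le> annotate_time (padded (case x of (K, xs, p) \<Rightarrow> card K)) (size_bound (case x of (K, xs, p) \<Rightarrow> card K)) \<and> annotation_output x s'"
      using r annotates_output[OF r(3)] by (auto simp: x' cK)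
  qed
qed

end
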